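(* Let $d\in\mathbb{N}$ and $u_0\in\mathcal{V}(d)$. Assume that there exists $s_0>\frac12$ such that the solution $t\mapsto u(t)$ of \[ i\partial_t u=2J(u)\,\Pi(|u|^2)+\overline{J(u)}\,u^2,\qquad u(0)=u_0,\] is unbounded in $H^{s_0}_+$. Then $u(t)$ is unbounded in every $H^s$, $s>\frac12$. Furthermore, for some $k\ge1$ such that $\sigma_k^2$ is the $k$-th nonzero eigenvalue of $K_{u_0}^2$, one has \[\ell_k(u_0)=0 .\]
   Context: $\mathbb{T}=\mathbb{R}/2\pi\mathbb{Z}$ carries the normalized measure $dx/2\pi$, and $(f|g)=\int_{\mathbb{T}} f\bar g$. $L^2_+$ is the closed subspace of $L^2(\mathbb{T})$ of functions whose Fourier series is supported on nonnegative frequencies; $\Pi:L^2\to L^2_+$ is the orthogonal projection; $H^s_+:=H^s(\mathbb{T})\cap L^2_+$. Set $J(u)=\int_{\mathbb{T}}|u|^2u$ and $Q(u)=\int_{\mathbb{T}}|u|^2$. The flow of the equation is globally well defined on every $H^s_+$, $s>1/2$. For $u\in H^{1/2}_+$, $H_u:L^2_+\to L^2_+$, $H_u(h)=\Pi(u\bar h)$, is the ($\mathbb{C}$-antilinear) Hankel operator, $S$ is multiplication by $e^{ix}$, and $K_u=H_uS$; $K_u^2$ is compact, selfadjoint, nonnegative. $\mathcal{V}(d)$ is the set of $u\in H^{1/2}_+$ with $\operatorname{rk}(H_u)+\operatorname{rk}(K_u)=d$; it consists of rational functions of $z=e^{ix}$ and is invariant under the flow. Let $\sigma_1^2(u)>\sigma_2^2(u)>\cdots$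 be the distinct nonzero eigenvalues of $K_u^2$ (they are conserved by the flow). Let $u_k^K$ (resp. $w_k^K$) be the orthogonal projection of $u$ (resp. of $\Pi(|u|^2)$) onto $\ker(K_u^2-\sigma_k^2 I)$, and \[\ell_k(u):=(2Q+\sigma_k^2)\|u_k^K\|_{L^2}^2-\|w_k^K\|_{L^2}^2 .\] *)

theory Defs
  imports "HOL-Analysis.Analysis"
begin

section \<open>Measurable functions on the circle modulo null sets\<close>

text \<open>The circle is represented by its fundamental domain \<open>[0, 2\<pi>)\<close> with the normalized measure
  \<open>dx / 2\<pi>\<close>.  Values of a representative outside \<open>[0, 2\<pi>)\<close> are irrelevant.\<close>

definition circle_measure :: "real measure" where
  "circle_measure = uniform_measure lborel {0..<2 * pi}"

definition ae_eq :: "(real \<Rightarrow> complex) \<Rightarrow> (real \<Rightarrow> complex) \<Rightarrow> bool" where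
  "ae_eq f g \<longleftrightarrow> f \<in> borel_measurable circle_measure \<and> g \<in> borel_measurable circle_measure \<and>
     (AE x in circle_measure. f x = g x)"

lemma sets_circle_measure [measurable_cong]: "sets circle_measure = sets borel"
  by (simp add: circle_measure_def)

lemma space_circle_measure [simp]: "space circle_measure = UNIV"
  by (simp add: circle_measure_def)

lemma emeasure_circle_measure_UNIV: "emeasure circle_measure UNIV = 1"
  unfolding circle_measure_def by (subst emeasure_uniform_measure) (auto simp: ennreal_divide_self)

lemma part_equivp_ae_eq: "part_equivp ae_eq"
proof (rule part_equivpI)
  show "\<exists>x. ae_eq x x"
    by (rule exI[of _ "\<lambda>_. 0"]) (simp add: ae_eq_def)
  show "symp ae_eq"
    by (auto simp: symp_def ae_eq_def elim: AE_mp)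
  show "transp ae_eq"
  proof (rule transpI)
    fix f g h assume fg: "ae_eq f g" and gh: "ae_eq g h"
    have "AE x in circle_measure. f x = h x"
      using fg gh unfolding ae_eq_def by (auto elim: AE_mp)
    with fg gh show "ae_eq f h" by (simp add: ae_eq_def)
  qed
qed

quotient_type tfun = "real \<Rightarrow> complex" / partial: ae_eq
  by (rule part_equivp_ae_eq)

instantiation tfun :: comm_ring_1
begin

lift_definition zero_tfun :: tfun is "\<lambda>_. 0" by (simp add: ae_eq_def)
lift_definition one_tfun :: tfun is "\<lambda>_. 1" by (simp add: ae_eq_def)
lift_definition plus_tfun :: "tfun \<Rightarrow> tfun \<Rightarrow> tfun" is "\<lambda>f g x. f x + g x"
  by (auto simp: ae_eq_def)
lift_definition minus_tfun :: "tfun \<Rightarrow> tfun \<Rightarrow> tfun" is "\<lambda>f g x. f x - g x"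
  by (auto simp: ae_eq_def)
lift_definition uminus_tfun :: "tfun \<Rightarrow> tfun" is "\<lambda>f x. - f x"
  by (auto simp: ae_eq_def)
lift_definition times_tfun :: "tfun \<Rightarrow> tfun \<Rightarrow> tfun" is "\<lambda>f g x. f x * g x"
  by (auto simp: ae_eq_def)

instance
proof
  have "\<not> (AE x in circle_measure. (0::complex) = 1)"
    using emeasure_circle_measure_UNIV
    by (auto simp: AE_iff_measurable[OF _ refl])
  then show "(0::tfun) \<noteq> 1" by transfer (simp add: ae_eq_def)
qed (transfer; auto simp: ae_eq_def algebra_simps)+

end

lift_definition scaleT :: "complex \<Rightarrow> tfun \<Rightarrow> tfun" is "\<lambda>c f x. c * f x"
  by (auto simp: ae_eq_def)

lift_definition cnjT :: "tfun \<Rightarrow> tfun" is "\<lambda>f x. cnj (f x)"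
  by (auto simp: ae_eq_def intro!: borel_measurable_continuous_on[OF continuous_on_cnj[OF continuous_on_id]])

text \<open>\<open>expT n\<close> is the function \<open>x \<mapsto> exp (i n x)\<close>.\<close>

lift_definition expT :: "int \<Rightarrow> tfun" is "\<lambda>n x. cis (of_int n * x)"
  by (auto simp: ae_eq_def cis_conv_exp)

text \<open>As in the library, the integral of a non-integrable function is \<open>0\<close>.\<close>

lift_definition integralT :: "tfun \<Rightarrow> complex" is "\<lambda>f. integral\<^sup>L circle_measure f"
  by (auto simp: ae_eq_def intro: integral_cong_AE)

lift_definition square_integrable :: "tfun \<Rightarrow> bool" is
  "\<lambda>f. integrable circle_measure (\<lambda>x. (norm (f x))\<^sup>2)"
proof -
  fix f g :: "real \<Rightarrow> complex"
  assume fg: "ae_eq f g"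
  then have [measurable]: "f \<in> borel_measurable circle_measure" "g \<in> borel_measurable circle_measure"
    and ae: "AE x in circle_measure. f x = g x" by (auto simp: ae_eq_def)
  show "integrable circle_measure (\<lambda>x. (norm (f x))\<^sup>2) =
        integrable circle_measure (\<lambda>x. (norm (g x))\<^sup>2)"
    by (rule integrable_cong_AE) (use ae in auto)
qed

interpretation tfun: vector_space scaleT
  by standard (transfer; auto simp: ae_eq_def algebra_simps)+

section \<open>Hardy and Sobolev spaces\<close>

definition innerT :: "tfun \<Rightarrow> tfun \<Rightarrow> complex" where
  "innerT f g = integralT (f * cnjT g)"

definition normL2 :: "tfun \<Rightarrow> real" where
  "normL2 f = sqrt (Re (innerT f f))"

definition fourier :: "tfun \<Rightarrow> int \<Rightarrow> complex" where
  "fourier f n = integralT (f * expT (- n))"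

definition L2 :: "tfun set" where
  "L2 = {f. square_integrable f}"

definition L2_plus :: "tfun set" where
  "L2_plus = {f \<in> L2. \<forall>n<0. fourier f n = 0}"

definition orth_proj :: "tfun set \<Rightarrow> tfun \<Rightarrow> tfun" where
  "orth_proj V f = (THE g. g \<in> V \<and> (\<forall>h\<in>V. innerT (f - g) h = 0))"

text \<open>The Szego projector truncates Fourier series to nonnegative frequencies.  On \<open>L2\<close> this is
  the orthogonal projection onto \<open>L2_plus\<close>.  It is stated with Fourier coefficients because in
  \<open>hankel\<close> below it is applied to \<open>u * cnjT h\<close> with \<open>u\<close> in \<open>H^{1/2}\<close> and \<open>h\<close> in \<open>L2\<close>, a product
  which in general is only in \<open>L^1\<close>, although its projection is in \<open>L2_plus\<close>.\<close>

definition szego :: "tfun \<Rightarrow> tfun" where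
  "szego f = (THE g. g \<in> L2_plus \<and> (\<forall>n\<ge>0. fourier g n = fourier f n))"

definition Hs_plus :: "real \<Rightarrow> tfun set" where
  "Hs_plus s = {f \<in> L2_plus.
     (\<lambda>n. (1 + (of_int n)\<^sup>2) powr s * (norm (fourier f n))\<^sup>2) summable_on UNIV}"

definition Hs_norm :: "real \<Rightarrow> tfun \<Rightarrow> real" where
  "Hs_norm s f = sqrt (\<Sum>\<^sub>\<infinity>n. (1 + (of_int n)\<^sup>2) powr s * (norm (fourier f n))\<^sup>2)"

section \<open>Hankel operators\<close>

definition hankel :: "tfun \<Rightarrow> tfun \<Rightarrow> tfun" where
  "hankel u h = szego (u * cnjT h)"

definition shifted_hankel :: "tfun \<Rightarrow> tfun \<Rightarrow> tfun" where
  "shifted_hankel u h = hankel u (expT 1 * h)"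

text \<open>The ranges of these antilinear operators are complex subspaces.  Finite dimensionality is
  required explicitly since \<open>tfun.dim\<close> is \<open>0\<close> on infinite-dimensional spaces.\<close>

definition finite_dim :: "tfun set \<Rightarrow> bool" where
  "finite_dim V \<longleftrightarrow> (\<exists>B. finite B \<and> V \<subseteq> tfun.span B)"

definition V_rank :: "nat \<Rightarrow> tfun set" where
  "V_rank d = {u \<in> Hs_plus (1/2).
     finite_dim (hankel u ` L2_plus) \<and> finite_dim (shifted_hankel u ` L2_plus) \<and>
     tfun.dim (hankel u ` L2_plus) + tfun.dim (shifted_hankel u ` L2_plus) = d}"

text \<open>\<open>K_eigenspace u \<mu>\<close> is the kernel of \<open>K_u^2 - \<mu> I\<close> on \<open>L2_plus\<close>; \<open>\<mu>\<close> plays the role of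
  \<open>\<sigma>^2\<close> and is real because \<open>K_u^2\<close> is selfadjoint.\<close>

definition K_eigenspace :: "tfun \<Rightarrow> real \<Rightarrow> tfun set" where
  "K_eigenspace u \<mu> =
     {h \<in> L2_plus. shifted_hankel u (shifted_hankel u h) = scaleT (of_real \<mu>) h}"

definition nonzero_eigenvalues :: "tfun \<Rightarrow> real set" where
  "nonzero_eigenvalues u = {\<mu>. \<mu> \<noteq> 0 \<and> (\<exists>h\<in>K_eigenspace u \<mu>. h \<noteq> 0)}"

text \<open>\<open>\<mu>\<close> is the \<open>k\<close>-th element, counted from \<open>1\<close>, of the decreasing enumeration of the distinct
  nonzero eigenvalues of \<open>K_u^2\<close>.\<close>

definition is_kth_eigenvalue :: "tfun \<Rightarrow> nat \<Rightarrow> real \<Rightarrow> bool" where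
  "is_kth_eigenvalue u k \<mu> \<longleftrightarrow> \<mu> \<in> nonzero_eigenvalues u \<and>
     finite {\<nu> \<in> nonzero_eigenvalues u. \<mu> \<le> \<nu>} \<and>
     card {\<nu> \<in> nonzero_eigenvalues u. \<mu> \<le> \<nu>} = k"

section \<open>The quadratic Szego equation\<close>

definition cubicJ :: "tfun \<Rightarrow> complex" where
  "cubicJ u = integralT (u * cnjT u * u)"

definition massQ :: "tfun \<Rightarrow> real" where
  "massQ u = Re (integralT (u * cnjT u))"

text \<open>\<open>ell u \<mu>\<close> is \<open>\<ell>\<^sub>k(u)\<close> for \<open>\<mu> = \<sigma>\<^sub>k^2\<close>.\<close>

definition ell :: "tfun \<Rightarrow> real \<Rightarrow> real" where
  "ell u \<mu> =
     (2 * massQ u + \<mu>) * (normL2 (orth_proj (K_eigenspace u \<mu>) u))\<^sup>2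
       - (normL2 (orth_proj (K_eigenspace u \<mu>) (szego (u * cnjT u))))\<^sup>2"

definition has_Hs_derivative :: "real \<Rightarrow> (real \<Rightarrow> tfun) \<Rightarrow> tfun \<Rightarrow> real \<Rightarrow> bool" where
  "has_Hs_derivative s u v t \<longleftrightarrow> v \<in> Hs_plus s \<and>
     ((\<lambda>h. Hs_norm s (scaleT (of_real (1 / h)) (u (t + h) - u t) - v)) \<longlongrightarrow> 0) (at 0)"

text \<open>The right-hand side of the equation is continuous on \<open>H^s_+\<close> for \<open>s > 1/2\<close>, so a solution
  that is continuous in time with values in \<open>H^s_+\<close> is differentiable in the sense used here.\<close>

definition Hs_solution :: "real \<Rightarrow> (real \<Rightarrow> tfun) \<Rightarrow> bool" where
  "Hs_solution s u \<longleftrightarrow> (\<forall>t. u t \<in> Hs_plus s \<and>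
     (\<exists>v. has_Hs_derivative s u v t \<and>
        scaleT \<i> v = scaleT (2 * cubicJ (u t)) (szego (u t * cnjT (u t)))
                      + scaleT (cnj (cubicJ (u t))) (u t * u t)))"

text \<open>By well-posedness in every \<open>H^s_+\<close>, \<open>s > 1/2\<close>, the solution with a given initial datum does
  not depend on the exponent in which it is sought.\<close>

definition solution :: "(real \<Rightarrow> tfun) \<Rightarrow> bool" where
  "solution u \<longleftrightarrow> (\<exists>s>1/2. Hs_solution s u)"

definition unbounded_in_Hs :: "real \<Rightarrow> (real \<Rightarrow> tfun) \<Rightarrow> bool" where
  "unbounded_in_Hs s u \<longleftrightarrow> (\<forall>t. u t \<in> Hs_plus s) \<and> \<not> (\<exists>C. \<forall>t. Hs_norm s (u t) \<le> C)"

end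

theory Submission
  imports Defs "HOL-Computational_Algebra.Fundamental_Theorem_Algebra"
begin

text \<open>Identify \<open>L\<^sup>2\<^sub>+\<close> with the sequence space \<open>ell2\<close>. With
  \<open>A = J T\<^sub>u\<^sup>* + \<J> T\<^sub>u\<close>, where \<open>\<J>\<close> is the conjugate of \<open>J\<close>, a solution satisfies the Lax
  equation \<open>i K\<^sub>u' = A K\<^sub>u + K\<^sub>u A\<close>, so that \<open>K\<^sub>u\<^sub>(\<^sub>t\<^sub>) = U(t) K\<^sub>u\<^sub>(\<^sub>0\<^sub>) U(t)\<^sup>*\<close> for the unitary
  propagator \<open>U\<close> of \<open>i f' = A f\<close>. For \<open>c\<close> in an eigenspace \<open>E\<close> of \<open>K\<^sup>2\<close>, the numbers
  \<open>\<alpha> = (u | U c)\<close> and \<open>\<beta> = (\<Pi>(|u|\<^sup>2) | U c)\<close> solve \<open>i \<alpha>' = J \<beta>\<close>,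
  \<open>i \<beta>' = - \<J> (\<sigma>\<^sup>2 + 2 Q) \<alpha>\<close>; hence \<open>(\<sigma>\<^sup>2 + 2 Q) |\<alpha>|\<^sup>2 - |\<beta>|\<^sup>2\<close> is conserved.

  The solution is bounded in one, equivalently in every, \<open>H\<^sup>s\<close> with \<open>s > 1/2\<close> iff some fixed power of
  \<open>S\<^sup>*\<close> halves norms on all the (finite-dimensional) ranges of \<open>K\<^sub>u\<^sub>(\<^sub>t\<^sub>)\<close>. If this fails, a compactness
  argument produces times \<open>t\<^sub>n\<close>, a number \<open>\<lambda>\<close> of modulus one and an eigenvector \<open>h\<close> of
  \<open>K\<^sub>u\<^sub>(\<^sub>0\<^sub>)\<^sup>2\<close> such that \<open>S\<^sup>* U(t\<^sub>n) h - \<lambda> U(t\<^sub>n) h\<close> tends to \<open>0\<close>; this forces \<open>\<alpha>\<close> and \<open>\<beta>\<close> of \<open>h\<close> to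
  tend to \<open>0\<close> along \<open>t\<^sub>n\<close>. If \<open>\<ell>\<close> did not vanish on the eigenspace of \<open>h\<close>, the proportionality of the
  projections of \<open>u\<close> and \<open>\<Pi>(|u|\<^sup>2)\<close> would make \<open>\<alpha>\<close> and \<open>\<beta>\<close> of \<open>h\<close> vanish identically. Then \<open>S\<^sup>*\<close>
  commutes with \<open>U\<close> on \<open>h\<close>, so \<open>S\<^sup>* h = \<lambda> h\<close>, which is impossible in \<open>L\<^sup>2\<^sub>+\<close>.\<close>

section \<open>The Hilbert space of square summable sequences\<close>

text \<open>Each Sobolev space with exponent above 1/2 embeds in the Wiener algebra of absolutely
  summable coefficients, and that norm bounds the Toeplitz and Hankel operators of a symbol. Hence
  \<open>K\<close>, \<open>A\<close> and the propagator are built from bounded operators, and the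
  difference quotients of the equation converge in one norm whatever the exponent. The spaces
  \<open>range (K t)\<close> move with time, so compactness cannot be used on them directly. Pulling
  \<open>shl\<close> back by the unitary \<open>U t\<close> gives contractions of the fixed space
  \<open>range (K 0)\<close>; if their powers fail to decay, a limit of them has a unimodular
  eigenvalue. The limits of \<alpha> and \<beta> rest on two facts: the norm lost under
  \<open>shl\<close> is the modulus of the mean (in squares), so approximate eigenvectors have means
  tending to 0; and \<open>shl u\<close> is \<open>K\<close> applied to the constant 1, so that
  pairings with \<open>u\<close> and \<Pi>(|u|^2) reduce to such means. The last step works because
  the commutator of \<open>shl\<close> with \<open>A\<close> has rank one and carries the factor
  \<open>coef x 0\<close>.\<close>

lemma power2_norm_add_le: "(norm (a + b))\<^sup>2 \<le> 2 * (norm a)\<^sup>2 + 2 * (norm b)\<^sup>2"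
  for a b :: "'a::real_normed_vector"
proof -
  have "(norm (a + b))\<^sup>2 \<le> (norm a + norm b)\<^sup>2"
    by (intro power_mono norm_triangle_ineq) auto
  also have "\<dots> \<le> 2 * (norm a)\<^sup>2 + 2 * (norm b)\<^sup>2"
    using sum_squares_bound[of "norm a" "norm b"] by (simp add: power2_sum)
  finally show ?thesis .
qed

lemma summable_norm_mult:
  fixes f g :: "nat \<Rightarrow> complex"
  assumes "summable (\<lambda>n. (norm (f n))\<^sup>2)" "summable (\<lambda>n. (norm (g n))\<^sup>2)"
  shows "summable (\<lambda>n. norm (f n * g n))"
proof (rule summable_comparison_test'[OF summable_add[OF assms]])
  fix n
  show "norm (norm (f n * g n)) \<le> (norm (f n))\<^sup>2 + (norm (g n))\<^sup>2"
    using sum_squares_bound[of "norm (f n)" "norm (g n)"] mult_nonneg_nonneg[OF norm_ge_zero[of "f n"] norm_ge_zero[of "g n"]]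
    unfolding norm_mult real_norm_def abs_mult abs_norm_cancel by linarith
qed

text \<open>A type of its own, since the Banach space classes behind bounded operators and
  differential equations attach to types, while \<open>L2_plus\<close> is a subset of
  \<open>tfun\<close>.\<close>

typedef ell2 = "{f :: nat \<Rightarrow> complex. summable (\<lambda>n. (norm (f n))\<^sup>2)}"
  morphisms coef Abs_ell2
  by (rule exI[of _ "\<lambda>_. 0"]) auto

setup_lifting type_definition_ell2

lemma summable_coef: "summable (\<lambda>n. (norm (coef x n))\<^sup>2)"
  using coef[of x] by simp

lemma ell2_eqI: "(\<And>n. coef x n = coef y n) \<Longrightarrow> x = y"
  by (simp add: coef_inject[symmetric] fun_eq_iff)

instantiation ell2 :: real_vector
begin

lift_definition zero_ell2 :: ell2 is "\<lambda>_. 0" by simp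
lift_definition plus_ell2 :: "ell2 \<Rightarrow> ell2 \<Rightarrow> ell2" is "\<lambda>f g n. f n + g n"
proof -
  fix f g :: "nat \<Rightarrow> complex"
  assume "summable (\<lambda>n. (norm (f n))\<^sup>2)" "summable (\<lambda>n. (norm (g n))\<^sup>2)"
  then have "summable (\<lambda>n. 2 * (norm (f n))\<^sup>2 + 2 * (norm (g n))\<^sup>2)"
    by (intro summable_add summable_mult)
  then show "summable (\<lambda>n. (norm (f n + g n))\<^sup>2)"
    by (rule summable_comparison_test'[where N=0]) (use power2_norm_add_le in auto)
qed
lift_definition uminus_ell2 :: "ell2 \<Rightarrow> ell2" is "\<lambda>f n. - f n" by simp
definition minus_ell2 :: "ell2 \<Rightarrow> ell2 \<Rightarrow> ell2" where "minus_ell2 x y = x + (- y)"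
lift_definition scaleR_ell2 :: "real \<Rightarrow> ell2 \<Rightarrow> ell2" is "\<lambda>c f n. c *\<^sub>R f n"
  by (simp add: power_mult_distrib summable_mult)

lemmas coef_rep_eq = zero_ell2.rep_eq plus_ell2.rep_eq uminus_ell2.rep_eq scaleR_ell2.rep_eq

instance
proof
  fix a b c :: ell2 and r s :: real
  show "a + b + c = a + (b + c)" by (rule ell2_eqI) (simp add: coef_rep_eq)
  show "a + b = b + a" by (rule ell2_eqI) (simp add: coef_rep_eq)
  show "0 + a = a" by (rule ell2_eqI) (simp add: coef_rep_eq)
  show "- a + a = 0" by (rule ell2_eqI) (simp add: coef_rep_eq)
  show "a - b = a + - b" by (rule minus_ell2_def)
  show "r *\<^sub>R (a + b) = r *\<^sub>R a + r *\<^sub>R b" by (rule ell2_eqI) (simp add: coef_rep_eq algebra_simps)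
  show "(r + s) *\<^sub>R a = r *\<^sub>R a + s *\<^sub>R a" by (rule ell2_eqI) (simp add: coef_rep_eq algebra_simps)
  show "r *\<^sub>R s *\<^sub>R a = (r * s) *\<^sub>R a" by (rule ell2_eqI) (simp add: coef_rep_eq)
  show "1 *\<^sub>R a = a" by (rule ell2_eqI) (simp add: coef_rep_eq)
qed

end

text \<open>The type classes provide real scalars. Complex scalars are a separate operation, so that
  complex linear and antilinear maps both live in the real space
  \<open>ell2 \<Rightarrow>\<^sub>L ell2\<close>.\<close>

lift_definition cmul :: "complex \<Rightarrow> ell2 \<Rightarrow> ell2" (infixr "*\<^sub>c" 75) is "\<lambda>c f n. c * f n"
  by (simp add: norm_mult power_mult_distrib summable_mult)

lemma coef_zero [simp]: "coef 0 n = 0"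
  and coef_add [simp]: "coef (x + y) n = coef x n + coef y n"
  and coef_uminus [simp]: "coef (- x) n = - coef x n"
  and coef_minus [simp]: "coef (x - y) n = coef x n - coef y n"
  and coef_scaleR [simp]: "coef (r *\<^sub>R x) n = r *\<^sub>R coef x n"
  and coef_cmul [simp]: "coef (c *\<^sub>c x) n = c * coef x n"
  by (simp_all only: coef_rep_eq minus_ell2_def cmul.rep_eq diff_conv_add_uminus)

lemma coef_sum [simp]: "coef (sum f A) n = (\<Sum>i\<in>A. coef (f i) n)"
  by (induction A rule: infinite_finite_induct) auto

definition cinner :: "ell2 \<Rightarrow> ell2 \<Rightarrow> complex" where
  "cinner x y = (\<Sum>n. coef x n * cnj (coef y n))"

lemma summable_cinner: "summable (\<lambda>n. coef x n * cnj (coef y n))"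
  by (rule summable_norm_cancel, rule summable_norm_mult) (use summable_coef in auto)

lemma cinner_add_left: "cinner (x + y) z = cinner x z + cinner y z"
  unfolding cinner_def using suminf_add[OF summable_cinner[of x z] summable_cinner[of y z]]
  by (simp add: algebra_simps)

lemma cinner_cmul_left: "cinner (c *\<^sub>c x) y = c * cinner x y"
  unfolding cinner_def using suminf_mult[OF summable_cinner[of x y], of c]
  by (simp add: algebra_simps)

lemma cinner_commute: "cinner y x = cnj (cinner x y)"
proof -
  have "cnj (cinner x y) = (\<Sum>n. cnj (coef x n * cnj (coef y n)))"
    unfolding cinner_def using summable_cinner[of x y]
    by (intro bounded_linear.suminf[OF bounded_linear_cnj])
  then show ?thesis by (simp add: cinner_def mult.commute)
qed

lemma cinner_add_right: "cinner z (x + y) = cinner z x + cinner z y"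
  by (metis cinner_add_left cinner_commute complex_cnj_add)

lemma cinner_cmul_right: "cinner x (c *\<^sub>c y) = cnj c * cinner x y"
  by (metis cinner_cmul_left cinner_commute complex_cnj_mult)

lemma scaleR_cmul: "r *\<^sub>R x = of_real r *\<^sub>c x"
  by (rule ell2_eqI) (simp add: scaleR_conv_of_real)

lemma cinner_self: "cinner x x = of_real (\<Sum>n. (norm (coef x n))\<^sup>2)"
  unfolding cinner_def complex_norm_square[symmetric]
  by (rule suminf_of_real[OF summable_coef, symmetric])

instantiation ell2 :: real_inner
begin

definition inner_ell2 :: "ell2 \<Rightarrow> ell2 \<Rightarrow> real" where "inner_ell2 x y = Re (cinner x y)"
definition norm_ell2 :: "ell2 \<Rightarrow> real" where "norm_ell2 x = sqrt (inner x x)"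
definition dist_ell2 :: "ell2 \<Rightarrow> ell2 \<Rightarrow> real" where "dist_ell2 x y = norm (x - y)"
definition sgn_ell2 :: "ell2 \<Rightarrow> ell2" where "sgn_ell2 x = inverse (norm x) *\<^sub>R x"
definition uniformity_ell2 :: "(ell2 \<times> ell2) filter" where
  "uniformity_ell2 = (INF e\<in>{0<..}. principal {(x, y). dist x y < e})"
definition open_ell2 :: "ell2 set \<Rightarrow> bool" where
  "open_ell2 U \<longleftrightarrow> (\<forall>x\<in>U. \<forall>\<^sub>F (x', y) in uniformity. x' = x \<longrightarrow> y \<in> U)"

instance
proof
  fix x y z :: ell2 and r :: real
  show "inner x y = inner y x"
    unfolding inner_ell2_def by (subst cinner_commute) simp
  show "inner (x + y) z = inner x z + inner y z"
    by (simp add: inner_ell2_def cinner_add_left)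
  show "inner (r *\<^sub>R x) y = r * inner x y"
    by (simp add: inner_ell2_def cinner_cmul_left scaleR_cmul)
  show "0 \<le> inner x x"
    by (simp add: inner_ell2_def cinner_self suminf_nonneg summable_coef)
  show "(inner x x = 0) = (x = 0)"
    by (auto simp: inner_ell2_def cinner_self suminf_eq_zero_iff summable_coef intro: ell2_eqI)
qed (simp_all add: norm_ell2_def dist_ell2_def sgn_ell2_def uniformity_ell2_def open_ell2_def)

end

lemma norm_ell2_sq: "(norm x)\<^sup>2 = (\<Sum>n. (norm (coef x n))\<^sup>2)"
  by (simp add: power2_norm_eq_inner inner_ell2_def cinner_self)

lemma cinner_self_norm: "cinner x x = of_real ((norm x)\<^sup>2)"
  by (simp add: cinner_self norm_ell2_sq)

lemma sum_coef_le_norm: "(\<Sum>k<n. (norm (coef x k))\<^sup>2) \<le> (norm x)\<^sup>2"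
  unfolding norm_ell2_sq by (rule sum_le_suminf) (auto simp: summable_coef)

lemma norm_ell2_le:
  assumes "\<And>n. (\<Sum>k<n. (norm (coef x k))\<^sup>2) \<le> C\<^sup>2" "0 \<le> C"
  shows "norm x \<le> C"
proof -
  have "(norm x)\<^sup>2 \<le> C\<^sup>2"
    unfolding norm_ell2_sq by (rule suminf_le_const[OF summable_coef assms(1)])
  then show ?thesis using assms(2) by (rule power2_le_imp_le)
qed

lemma norm_coef_le: "norm (coef x n) \<le> norm x"
proof -
  have "(norm (coef x n))\<^sup>2 \<le> (\<Sum>k<Suc n. (norm (coef x k))\<^sup>2)"
    by (simp add: sum_nonneg)
  also have "\<dots> \<le> (norm x)\<^sup>2" by (rule sum_coef_le_norm)
  finally show ?thesis by (rule power2_le_imp_le) simp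
qed

instance ell2 :: complete_space
proof
  fix X :: "nat \<Rightarrow> ell2" assume X: "Cauchy X"
  have "Cauchy (\<lambda>m. coef (X m) n)" for n
  proof (rule metric_CauchyI)
    fix e :: real assume "0 < e"
    then obtain M where "\<And>m k. m \<ge> M \<Longrightarrow> k \<ge> M \<Longrightarrow> dist (X m) (X k) < e"
      using metric_CauchyD[OF X] by metis
    moreover have "dist (coef (X m) n) (coef (X k) n) \<le> dist (X m) (X k)" for m k
      using norm_coef_le[of "X m - X k" n] by (simp add: dist_norm)
    ultimately show "\<exists>M. \<forall>m\<ge>M. \<forall>k\<ge>M. dist (coef (X m) n) (coef (X k) n) < e"
      using le_less_trans by blast
  qed
  then have "\<exists>l. (\<lambda>m. coef (X m) n) \<longlonglongrightarrow> l" for n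
    using Cauchy_convergent convergent_def by blast
  then obtain f where f: "\<And>n. (\<lambda>m. coef (X m) n) \<longlonglongrightarrow> f n" by metis
  have close: "\<exists>M. \<forall>m\<ge>M. \<forall>N. (\<Sum>k<N. (norm (coef (X m) k - f k))\<^sup>2) \<le> e\<^sup>2" if e: "0 < e" for e
  proof -
    obtain M where M: "\<And>m k. m \<ge> M \<Longrightarrow> k \<ge> M \<Longrightarrow> dist (X m) (X k) < e"
      using metric_CauchyD[OF X e] by metis
    have "(\<Sum>k<N. (norm (coef (X m) k - f k))\<^sup>2) \<le> e\<^sup>2" if m: "m \<ge> M" for m N
    proof (rule LIMSEQ_le_const2)
      show "(\<lambda>n. \<Sum>k<N. (norm (coef (X m) k - coef (X n) k))\<^sup>2)
          \<longlonglongrightarrow> (\<Sum>k<N. (norm (coef (X m) k - f k))\<^sup>2)"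
        by (intro tendsto_intros f)
      show "\<exists>N'. \<forall>n\<ge>N'. (\<Sum>k<N. (norm (coef (X m) k - coef (X n) k))\<^sup>2) \<le> e\<^sup>2"
      proof (intro exI allI impI)
        fix n assume "n \<ge> M"
        have "(\<Sum>k<N. (norm (coef (X m) k - coef (X n) k))\<^sup>2) \<le> (norm (X m - X n))\<^sup>2"
          using sum_coef_le_norm[of "X m - X n" N] by simp
        also have "\<dots> \<le> e\<^sup>2"
          using M[OF m \<open>n \<ge> M\<close>] by (intro power_mono) (auto simp: dist_norm)
        finally show "(\<Sum>k<N. (norm (coef (X m) k - coef (X n) k))\<^sup>2) \<le> e\<^sup>2" .
      qed
    qed
    then show ?thesis by blast
  qed
  \<comment> \<open>The limit \<open>f\<close> inherits square summability from one
    \<open>X M\<close> through their difference.\<close>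
  obtain M where M: "\<And>N. (\<Sum>k<N. (norm (coef (X M) k - f k))\<^sup>2) \<le> 1\<^sup>2"
    using close[of 1] by auto
  have "summable (\<lambda>k. (norm (coef (X M) k - f k))\<^sup>2)"
    by (rule summableI_nonneg_bounded[OF _ M]) auto
  then have "coef (Abs_ell2 (\<lambda>k. coef (X M) k - f k)) = (\<lambda>k. coef (X M) k - f k)"
    by (simp add: Abs_ell2_inverse)
  then have "\<And>n. coef (X M - Abs_ell2 (\<lambda>k. coef (X M) k - f k)) n = f n"
    by simp
  then obtain x where x: "\<And>n. coef x n = f n" by blast
  have "X \<longlonglongrightarrow> x"
  proof (rule metric_LIMSEQ_I)
    fix r :: real assume "0 < r"
    then obtain M where M: "\<And>m N. m \<ge> M \<Longrightarrow> (\<Sum>k<N. (norm (coef (X m) k - f k))\<^sup>2) \<le> (r/2)\<^sup>2"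
      using close[of "r/2"] by auto
    have "dist (X m) x < r" if "m \<ge> M" for m
    proof -
      have "norm (X m - x) \<le> r / 2"
        by (rule norm_ell2_le) (use M[OF that] x \<open>0 < r\<close> in auto)
      then show ?thesis using \<open>0 < r\<close> by (simp add: dist_norm)
    qed
    then show "\<exists>no. \<forall>n\<ge>no. dist (X n) x < r" by blast
  qed
  then show "convergent X" by (auto simp: convergent_def)
qed

instance ell2 :: banach ..

lemma cmul_simps [simp]:
  "1 *\<^sub>c x = x" "0 *\<^sub>c x = 0" "c *\<^sub>c 0 = 0" "(- c) *\<^sub>c x = - (c *\<^sub>c x)"
  "c *\<^sub>c (- x) = - (c *\<^sub>c x)" "c *\<^sub>c d *\<^sub>c x = (c * d) *\<^sub>c x"
  by (auto intro!: ell2_eqI)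

lemma cmul_distribs:
  "c *\<^sub>c (x + y) = c *\<^sub>c x + c *\<^sub>c y" "(c + d) *\<^sub>c x = c *\<^sub>c x + d *\<^sub>c x"
  "c *\<^sub>c (x - y) = c *\<^sub>c x - c *\<^sub>c y" "(c - d) *\<^sub>c x = c *\<^sub>c x - d *\<^sub>c x"
  by (auto intro!: ell2_eqI simp: algebra_simps)

lemma cmul_scaleR [simp]: "c *\<^sub>c (r *\<^sub>R x) = r *\<^sub>R (c *\<^sub>c x)"
  by (auto intro!: ell2_eqI)

lemma norm_cmul [simp]: "norm (c *\<^sub>c x) = norm c * norm x"
proof -
  have "(norm (c *\<^sub>c x))\<^sup>2 = (norm c * norm x)\<^sup>2"
    unfolding power_mult_distrib norm_ell2_sq
    by (simp add: norm_mult power_mult_distrib suminf_mult summable_coef)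
  then show ?thesis by (metis mult_nonneg_nonneg norm_ge_zero power2_eq_imp_eq)
qed

lemma bounded_bilinear_cmul: "bounded_bilinear (*\<^sub>c)"
  by (standard; (auto simp: cmul_distribs intro!: ell2_eqI exI[of _ 1])?)

lemma norm_cinner_le: "norm (cinner x y) \<le> norm x * norm y"
proof -
  \<comment> \<open>A unimodular factor makes the product real, which reduces the claim to real
    Cauchy-Schwarz.\<close>
  obtain c where c: "norm c = 1" "c * cinner x y = of_real (norm (cinner x y))"
  proof (cases "cinner x y = 0")
    case False
    then show ?thesis
      by (intro that[of "cnj (cinner x y) / of_real (norm (cinner x y))"])
         (auto simp: norm_divide complex_norm_square[symmetric] power2_eq_square mult.commute
           simp flip: of_real_mult of_real_divide)
  qed (auto intro: that[of 1])
  have "norm (cinner x y) = inner (c *\<^sub>c x) y"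
    by (simp add: inner_ell2_def cinner_cmul_left c)
  also have "\<dots> \<le> norm (c *\<^sub>c x) * norm y" by (rule norm_cauchy_schwarz)
  finally show ?thesis using c by simp
qed

lemma bounded_bilinear_cinner: "bounded_bilinear cinner"
proof
  fix x y z :: ell2 and r :: real
  show "cinner (r *\<^sub>R x) y = r *\<^sub>R cinner x y" "cinner x (r *\<^sub>R y) = r *\<^sub>R cinner x y"
    by (simp_all add: scaleR_cmul cinner_cmul_left cinner_cmul_right scaleR_conv_of_real)
  show "\<exists>K. \<forall>a b. norm (cinner a b) \<le> norm a * norm b * K"
    using norm_cinner_le by (auto intro!: exI[of _ 1])
qed (simp_all add: cinner_add_left cinner_add_right)

interpretation cmul: bounded_bilinear "(*\<^sub>c)" by (rule bounded_bilinear_cmul)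
interpretation cinner: bounded_bilinear cinner by (rule bounded_bilinear_cinner)

lemmas cinner_simps [simp] = cinner_cmul_left cinner_cmul_right
  cinner.add_left cinner.add_right cinner.diff_left cinner.diff_right
  cinner.zero_left cinner.zero_right cinner.minus_left cinner.minus_right

lemma cinner_eq_0_commute: "cinner x y = 0 \<longleftrightarrow> cinner y x = 0"
  by (subst cinner_commute) simp

section \<open>Shifts, Toeplitz and Hankel operators\<close>

lift_definition shl :: "ell2 \<Rightarrow> ell2" is "\<lambda>f n. f (Suc n)"
  by (subst summable_Suc_iff)
lift_definition shr :: "ell2 \<Rightarrow> ell2" is "\<lambda>f n. case n of 0 \<Rightarrow> 0 | Suc m \<Rightarrow> f m"
  by (subst summable_Suc_iff[symmetric]) simp
lift_definition basis :: "nat \<Rightarrow> ell2" is "\<lambda>m n. if n = m then 1 else 0"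
  by (rule summable_finite[of "{m}" for m]) auto
lift_definition flip :: "nat \<Rightarrow> ell2 \<Rightarrow> ell2" is "\<lambda>n f l. if l \<le> n then cnj (f (n - l)) else 0"
  by (rule summable_finite[of "{..m}" for m]) auto

lemma coef_shl [simp]: "coef (shl x) n = coef x (Suc n)"
  and coef_shr: "coef (shr x) n = (case n of 0 \<Rightarrow> 0 | Suc m \<Rightarrow> coef x m)"
  and coef_basis: "coef (basis m) n = (if n = m then 1 else 0)"
  and coef_flip: "coef (flip n x) l = (if l \<le> n then cnj (coef x (n - l)) else 0)"
  by (simp_all add: shl.rep_eq shr.rep_eq basis.rep_eq flip.rep_eq)

lemma coef_shr_simps [simp]: "coef (shr x) 0 = 0" "coef (shr x) (Suc n) = coef x n"
  by (simp_all add: coef_shr)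

lemma shl_shr [simp]: "shl (shr x) = x"
  by (rule ell2_eqI) simp

lemma shr_shl: "shr (shl x) = x - coef x 0 *\<^sub>c basis 0"
  by (rule ell2_eqI) (simp add: coef_shr coef_basis split: nat.split)

lemma shr_shl_add: "x = shr (shl x) + coef x 0 *\<^sub>c basis 0"
  by (simp add: shr_shl)

lemma shl_linear [simp]: "shl (x + y) = shl x + shl y" "shl (c *\<^sub>c x) = c *\<^sub>c shl x"
  "shl (r *\<^sub>R x) = r *\<^sub>R shl x" "shl (- x) = - shl x" "shl (x - y) = shl x - shl y" "shl 0 = 0"
  by (auto intro!: ell2_eqI)

lemma shr_linear [simp]: "shr (x + y) = shr x + shr y" "shr (c *\<^sub>c x) = c *\<^sub>c shr x"
  "shr (r *\<^sub>R x) = r *\<^sub>R shr x" "shr (- x) = - shr x" "shr (x - y) = shr x - shr y" "shr 0 = 0"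
  by (auto intro!: ell2_eqI simp: coef_shr split: nat.split)

lemma coef_shl_pow [simp]: "coef ((shl ^^ m) x) n = coef x (m + n)"
  by (induction m arbitrary: n) auto

lemma shl_pow_shl: "(shl ^^ n) (shl x) = shl ((shl ^^ n) x)"
  by (simp add: funpow_swap1)

lemma shr_pow_shr: "(shr ^^ n) (shr x) = shr ((shr ^^ n) x)"
  by (simp add: funpow_swap1)

lemma shl_pow_linear [simp]: "(shl ^^ n) (x + y) = (shl ^^ n) x + (shl ^^ n) y"
  "(shl ^^ n) (c *\<^sub>c x) = c *\<^sub>c (shl ^^ n) x" "(shl ^^ n) (r *\<^sub>R x) = r *\<^sub>R (shl ^^ n) x"
  by (induction n; simp)+

lemma shr_pow_linear [simp]: "(shr ^^ n) (x + y) = (shr ^^ n) x + (shr ^^ n) y"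
  "(shr ^^ n) (c *\<^sub>c x) = c *\<^sub>c (shr ^^ n) x" "(shr ^^ n) (r *\<^sub>R x) = r *\<^sub>R (shr ^^ n) x"
  by (induction n; simp)+

lemma shr_basis: "shr (basis n) = basis (Suc n)"
  by (rule ell2_eqI) (simp add: coef_shr coef_basis split: nat.split)

lemma shl_basis_0 [simp]: "shl (basis 0) = 0"
  by (rule ell2_eqI) (simp add: coef_basis)

lemma shr_pow_basis [simp]: "(shr ^^ n) (basis 0) = basis n"
  by (induction n) (auto simp: shr_basis)

lemma cinner_basis [simp]: "cinner x (basis n) = coef x n"
proof -
  have "(\<lambda>k. coef x k * cnj (coef (basis n) k)) = (\<lambda>k. if k = n then coef x k else 0)"
    by (auto simp: coef_basis)
  then show ?thesis
    unfolding cinner_def using sums_unique[OF sums_single[of n "coef x"]] by simp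
qed

text \<open>The norm lost under \<open>shl\<close> sits entirely in the zeroth coefficient. This is
  how a vector whose norm \<open>shl\<close> nearly preserves is later seen to have a small
  mean.\<close>

lemma norm_shl_sq: "(norm (shl x))\<^sup>2 = (norm x)\<^sup>2 - (norm (coef x 0))\<^sup>2"
  unfolding norm_ell2_sq using suminf_split_head[OF summable_coef[of x]] by simp

lemma norm_shl_le: "norm (shl x) \<le> norm x"
  by (rule power2_le_imp_le) (simp_all add: norm_shl_sq)

lemma norm_shl_pow_le: "norm ((shl ^^ n) x) \<le> norm x"
  by (induction n) (auto intro: order_trans[OF norm_shl_le])

lemma norm_shr [simp]: "norm (shr x) = norm x"
  using norm_shl_sq[of "shr x"] by simp

lemma norm_shr_pow [simp]: "norm ((shr ^^ n) x) = norm x"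
  by (induction n) auto

lemma cinner_shr_left: "cinner (shr x) y = cinner x (shl y)"
  unfolding cinner_def using suminf_split_head[OF summable_cinner[of "shr x" y]] by simp

lemma cinner_shl_left: "cinner (shl x) y = cinner x (shr y)"
  by (metis cinner_commute cinner_shr_left)

lemma cinner_shr_pow_left: "cinner ((shr ^^ n) x) y = cinner x ((shl ^^ n) y)"
  by (induction n arbitrary: y) (simp_all add: cinner_shr_left shl_pow_shl)

lemma norm_flip_le: "norm (flip n x) \<le> norm x"
proof (rule norm_ell2_le)
  fix N
  have "(\<Sum>k<N. (norm (coef (flip n x) k))\<^sup>2) = (\<Sum>k\<in>{..<N} \<inter> {..n}. (norm (coef x (n - k)))\<^sup>2)"
    by (intro sum.mono_neutral_cong_right) (auto simp: coef_flip)
  also have "\<dots> \<le> (\<Sum>k\<in>{..<Suc n}. (norm (coef x (Suc n - Suc k)))\<^sup>2)"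
    unfolding diff_Suc_Suc by (intro sum_mono2) auto
  also have "\<dots> = (\<Sum>k<Suc n. (norm (coef x k))\<^sup>2)"
    by (rule sum.nat_diff_reindex)
  also have "\<dots> \<le> (norm x)\<^sup>2" by (rule sum_coef_le_norm)
  finally show "(\<Sum>k<N. (norm (coef (flip n x) k))\<^sup>2) \<le> (norm x)\<^sup>2" .
qed simp

lemma flip_linear [simp]: "flip n (x + y) = flip n x + flip n y"
  "flip n (c *\<^sub>c x) = cnj c *\<^sub>c flip n x" "flip n (r *\<^sub>R x) = r *\<^sub>R flip n x"
  by (auto intro!: ell2_eqI simp: coef_flip)

text \<open>The Hankel relation for a single frequency; summed over the symbol it yields
  \<open>hank_shr\<close>.\<close>

lemma shl_flip: "shl (flip n x) = flip n (shr x)"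
proof (rule ell2_eqI)
  fix l
  show "coef (shl (flip n x)) l = coef (flip n (shr x)) l"
  proof (cases "Suc l \<le> n")
    case True
    then obtain d where "n = Suc l + d" using le_Suc_ex by blast
    then show ?thesis by (simp add: coef_flip)
  qed (auto simp: coef_flip coef_shr not_less_eq_eq split: nat.split)
qed

lemma cinner_flip: "cinner (flip n x) y = cinner (flip n y) x"
proof -
  have *: "cinner (flip n x) y = (\<Sum>k<Suc n. cnj (coef x (n - k)) * cnj (coef y k))" for x y
    unfolding cinner_def by (subst suminf_finite[of "{..<Suc n}"]) (auto simp: coef_flip intro!: sum.cong)
  have "(\<Sum>k<Suc n. cnj (coef x (n - k)) * cnj (coef y k))
      = (\<Sum>k<Suc n. cnj (coef x (n - (Suc n - Suc k))) * cnj (coef y (Suc n - Suc k)))"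
    by (rule sum.nat_diff_reindex[symmetric])
  also have "\<dots> = (\<Sum>k<Suc n. cnj (coef y (n - k)) * cnj (coef x k))"
    by (intro sum.cong) auto
  finally show ?thesis unfolding * .
qed

lemma bounded_linear_shl: "bounded_linear shl" and bounded_linear_shr: "bounded_linear shr"
  and bounded_linear_flip: "bounded_linear (flip n)"
  and bounded_linear_shl_pow: "bounded_linear (shl ^^ n)"
  and bounded_linear_shr_pow: "bounded_linear (shr ^^ n)"
  by (rule bounded_linear_intro[where K=1];
      simp add: norm_shl_le norm_flip_le norm_shl_pow_le)+

lemma truncation_tendsto: "(\<lambda>n. \<Sum>k<n. coef x k *\<^sub>c basis k) \<longlonglongrightarrow> x"
proof -
  \<comment> \<open>The remainder is written with shifts because \<open>shr\<close> is isometric: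
    its norm is that of \<open>(shl ^^ n) x\<close>, a tail sum.\<close>
  have eq: "x - (\<Sum>k<n. coef x k *\<^sub>c basis k) = (shr ^^ n) ((shl ^^ n) x)" for n
  proof (induction n)
    case (Suc n)
    have "(shr ^^ Suc n) ((shl ^^ Suc n) x) = (shr ^^ n) (shr (shl ((shl ^^ n) x)))"
      by (simp add: shr_pow_shr)
    also have "\<dots> = (shr ^^ n) ((shl ^^ n) x) - coef x n *\<^sub>c basis n"
      using shr_pow_linear(1)[of n "shr (shl ((shl ^^ n) x))" "coef x n *\<^sub>c basis 0"]
      by (simp add: shr_shl)
    finally show ?case using Suc by simp
  qed simp
  have "(\<lambda>n. (norm (x - (\<Sum>k<n. coef x k *\<^sub>c basis k)))\<^sup>2) \<longlonglongrightarrow> 0"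
  proof -
    have "(\<lambda>n. \<Sum>k. (norm (coef x (k + n)))\<^sup>2) \<longlonglongrightarrow> 0"
      by (rule suminf_exist_split2[OF summable_coef])
    then show ?thesis by (simp add: eq norm_ell2_sq add.commute)
  qed
  from tendsto_real_sqrt[OF this]
  have "(\<lambda>n. norm (x - (\<Sum>k<n. coef x k *\<^sub>c basis k))) \<longlonglongrightarrow> 0" by simp
  then have "(\<lambda>n. x - (\<Sum>k<n. coef x k *\<^sub>c basis k)) \<longlonglongrightarrow> 0"
    by (rule tendsto_norm_zero_cancel)
  then show ?thesis
    using tendsto_diff[OF tendsto_const[of x]] by fastforce
qed

text \<open>Consequently \<open>shl\<close> has no unimodular eigenvalue on \<open>ell2\<close>,
  which gives the final contradiction.\<close>

lemma norm_shl_pow_tendsto: "(\<lambda>n. norm ((shl ^^ n) x)) \<longlonglongrightarrow> 0"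
proof -
  have "(\<lambda>n. \<Sum>k. (norm (coef x (k + n)))\<^sup>2) \<longlonglongrightarrow> 0"
    by (rule suminf_exist_split2[OF summable_coef])
  then have "(\<lambda>n. (norm ((shl ^^ n) x))\<^sup>2) \<longlonglongrightarrow> 0"
    by (simp add: norm_ell2_sq add.commute)
  from tendsto_real_sqrt[OF this] show ?thesis by simp
qed

text \<open>Agreement is demanded on all complex multiples of the basis vectors, because a bounded
  real linear map may be antilinear, and both kinds are treated alike.\<close>

lemma bounded_linear_eq_on_basis:
  assumes "bounded_linear X" "bounded_linear Y"
    and "\<And>c m. X (c *\<^sub>c basis m) = Y (c *\<^sub>c basis m)"
  shows "X = Y"
proof
  fix x
  interpret X: bounded_linear X by fact
  interpret Y: bounded_linear Y by fact
  let ?s = "\<lambda>n. \<Sum>k<n. coef x k *\<^sub>c basis k"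
  have "(\<lambda>n. X (?s n)) \<longlonglongrightarrow> X x" by (rule X.tendsto[OF truncation_tendsto])
  moreover have "(\<lambda>n. X (?s n)) \<longlonglongrightarrow> Y x"
    using Y.tendsto[OF truncation_tendsto[of x]] by (simp add: X.sum Y.sum assms(3))
  ultimately show "X x = Y x" by (rule LIMSEQ_unique)
qed

subsection \<open>Operators with absolutely summable symbols\<close>

text \<open>Membership in the Wiener algebra and its norm; \<open>anorm\<close> is meaningful under
  \<open>asum\<close>. It dominates the operator norms below and is dominated, up to a constant, by
  each Sobolev norm with exponent above 1/2.\<close>

definition asum :: "ell2 \<Rightarrow> bool" where "asum x \<longleftrightarrow> summable (\<lambda>n. norm (coef x n))"
definition anorm :: "ell2 \<Rightarrow> real" where "anorm x = (\<Sum>n. norm (coef x n))"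

lift_definition cmulL :: "complex \<Rightarrow> ell2 \<Rightarrow>\<^sub>L ell2" is "(*\<^sub>c)"
  by (rule cmul.bounded_linear_right)

lemma norm_cmulL_le: "norm (cmulL c) \<le> norm c"
  by (rule norm_blinfun_bound) (auto simp: cmulL.rep_eq)

lemma bounded_linear_cmulL: "bounded_linear cmulL"
  by (rule bounded_linear_intro[where K=1])
     (auto intro!: blinfun_eqI simp: cmulL.rep_eq cmul_distribs blinfun.bilinear_simps
       scaleR_conv_of_real norm_cmulL_le scaleR_cmul)

text \<open>Toeplitz operators, their adjoints and Hankel operators are all series of contractions
  weighted by the coefficients of a symbol, so convergence, norm bound and linearity in the symbol
  are settled once.\<close>

definition opsum :: "(nat \<Rightarrow> ell2 \<Rightarrow>\<^sub>L ell2) \<Rightarrow> (nat \<Rightarrow> complex) \<Rightarrow> ell2 \<Rightarrow>\<^sub>L ell2" where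
  "opsum F f = (\<Sum>n. cmulL (f n) o\<^sub>L F n)"

lemma opsum_term_le:
  assumes "norm (F n) \<le> 1"
  shows "norm (cmulL (f n) o\<^sub>L F n) \<le> norm (f n)"
proof -
  have "norm (cmulL (f n) o\<^sub>L F n) \<le> norm (cmulL (f n)) * norm (F n)"
    by (rule norm_blinfun_compose)
  also have "\<dots> \<le> norm (f n) * 1"
    by (intro mult_mono norm_cmulL_le assms) auto
  finally show ?thesis by simp
qed

context
  fixes F :: "nat \<Rightarrow> ell2 \<Rightarrow>\<^sub>L ell2"
  assumes F: "\<And>n. norm (F n) \<le> 1"
begin

lemma opsum_term: "norm (cmulL (f n) o\<^sub>L F n) \<le> norm (f n)"
  by (rule opsum_term_le) (rule F)

lemma summable_norm_opsum:
  "summable (\<lambda>n. norm (f n)) \<Longrightarrow> summable (\<lambda>n. norm (cmulL (f n) o\<^sub>L F n))"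
  by (rule summable_comparison_test'[where N=0 and g="\<lambda>n. norm (f n)"]) (auto intro: opsum_term)

lemma summable_opsum: "summable (\<lambda>n. norm (f n)) \<Longrightarrow> summable (\<lambda>n. cmulL (f n) o\<^sub>L F n)"
  by (rule summable_norm_cancel) (rule summable_norm_opsum)

lemma norm_opsum_le:
  assumes "summable (\<lambda>n. norm (f n))"
  shows "norm (opsum F f) \<le> (\<Sum>n. norm (f n))"
proof -
  have "norm (opsum F f) \<le> (\<Sum>n. norm (cmulL (f n) o\<^sub>L F n))"
    unfolding opsum_def by (rule summable_norm[OF summable_norm_opsum[OF assms]])
  also have "\<dots> \<le> (\<Sum>n. norm (f n))"
    by (rule suminf_le) (simp_all add: opsum_term summable_norm_opsum assms)
  finally show ?thesis .
qed

lemma opsum_sums: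
  assumes "summable (\<lambda>n. norm (f n))"
  shows "(\<lambda>n. f n *\<^sub>c blinfun_apply (F n) x) sums blinfun_apply (opsum F f) x"
proof -
  have "(\<lambda>n. blinfun_apply (cmulL (f n) o\<^sub>L F n) x) sums blinfun_apply (opsum F f) x"
    unfolding opsum_def
    by (rule bounded_linear.sums[OF blinfun.bounded_linear_left summable_sums[OF summable_opsum[OF assms]]])
  then show ?thesis by (simp add: cmulL.rep_eq)
qed

lemma opsum_add:
  assumes "summable (\<lambda>n. norm (f n))" "summable (\<lambda>n. norm (g n))"
  shows "opsum F (\<lambda>n. f n + g n) = opsum F f + opsum F g"
proof -
  have s: "summable (\<lambda>n. norm (f n + g n))"
    by (rule summable_comparison_test'[OF summable_add[OF assms], where N=0]) (auto intro: norm_triangle_ineq)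
  show ?thesis
  proof (rule blinfun_eqI)
    fix x
    have "(\<lambda>n. (f n + g n) *\<^sub>c blinfun_apply (F n) x) sums (blinfun_apply (opsum F f) x + blinfun_apply (opsum F g) x)"
      using sums_add[OF opsum_sums[OF assms(1)] opsum_sums[OF assms(2)]] by (simp add: cmul_distribs)
    from sums_unique2[OF opsum_sums[OF s] this]
    show "blinfun_apply (opsum F (\<lambda>n. f n + g n)) x = blinfun_apply (opsum F f + opsum F g) x"
      by (simp add: blinfun.bilinear_simps)
  qed
qed

lemma opsum_cmul:
  assumes "summable (\<lambda>n. norm (f n))"
  shows "opsum F (\<lambda>n. c * f n) = cmulL c o\<^sub>L opsum F f"
proof -
  have s: "summable (\<lambda>n. norm (c * f n))"
    using summable_mult[OF assms, of "norm c"] by (simp add: norm_mult)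
  show ?thesis
  proof (rule blinfun_eqI)
    fix x
    have "(\<lambda>n. (c * f n) *\<^sub>c blinfun_apply (F n) x) sums (c *\<^sub>c blinfun_apply (opsum F f) x)"
      using bounded_linear.sums[OF cmul.bounded_linear_right opsum_sums[OF assms]] by simp
    from sums_unique2[OF opsum_sums[OF s] this]
    show "blinfun_apply (opsum F (\<lambda>n. c * f n)) x = blinfun_apply (cmulL c o\<^sub>L opsum F f) x"
      by (simp add: cmulL.rep_eq)
  qed
qed

text \<open>Interchange of the two sums. For contractions that do not increase the Wiener norm this
  is the algebra property, which keeps u^2 and \<Pi>(|u|^2) among the admissible symbols.\<close>

lemma asum_opsum:
  assumes f: "summable (\<lambda>n. norm (f n))"
    and x: "\<And>n N. (\<Sum>k<N. norm (coef (blinfun_apply (F n) x) k)) \<le> C"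
  shows "asum (blinfun_apply (opsum F f) x)"
  unfolding asum_def
proof (rule summableI_nonneg_bounded)
  fix N
  let ?t = "\<lambda>n k. coef (f n *\<^sub>c blinfun_apply (F n) x) k"
  have bl: "bounded_linear (\<lambda>y. coef y k)" for k
    by (rule bounded_linear_intro[where K=1]) (auto simp: norm_coef_le)
  have s: "(\<lambda>n. ?t n k) sums coef (blinfun_apply (opsum F f) x) k" for k
    by (rule bounded_linear.sums[OF bl opsum_sums[OF f]])
  have le: "norm (?t n k) \<le> norm (f n) * norm x" for n k
  proof -
    have "norm (coef (blinfun_apply (F n) x) k) \<le> norm (blinfun_apply (F n) x)" by (rule norm_coef_le)
    also have "\<dots> \<le> norm (F n) * norm x" by (rule norm_blinfun)
    also have "\<dots> \<le> 1 * norm x" by (intro mult_right_mono F) auto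
    finally show ?thesis by (simp add: norm_mult mult_left_mono)
  qed
  have sn: "summable (\<lambda>n. norm (?t n k))" for k
    by (rule summable_comparison_test'[OF summable_mult2[OF f, of "norm x"], where N=0]) (use le in auto)
  have "(\<Sum>k<N. norm (coef (blinfun_apply (opsum F f) x) k)) \<le> (\<Sum>k<N. \<Sum>n. norm (?t n k))"
    by (rule sum_mono) (use summable_norm[OF sn] sums_unique[OF s] in simp)
  also have "\<dots> = (\<Sum>n. \<Sum>k<N. norm (?t n k))"
    by (rule suminf_sum[symmetric]) (rule sn)
  also have "\<dots> \<le> (\<Sum>n. norm (f n) * C)"
  proof (rule suminf_le)
    show "(\<Sum>k<N. norm (?t n k)) \<le> norm (f n) * C" for n
      using mult_left_mono[OF x[of n N], of "norm (f n)"] by (simp add: norm_mult sum_distrib_left)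
    show "summable (\<lambda>n. \<Sum>k<N. norm (?t n k))" by (intro summable_sum sn)
  qed (intro summable_mult2 f)
  finally show "(\<Sum>k<N. norm (coef (blinfun_apply (opsum F f) x) k)) \<le> (\<Sum>n. norm (f n) * C)" .
qed simp

end

lemma asum_add: "asum x \<Longrightarrow> asum y \<Longrightarrow> asum (x + y)"
  unfolding asum_def
  by (rule summable_comparison_test'[OF summable_add[of "\<lambda>n. norm (coef x n)" "\<lambda>n. norm (coef y n)"], where N=0])
    (auto intro: norm_triangle_ineq)

lemma asum_cmul: "asum x \<Longrightarrow> asum (c *\<^sub>c x)"
  unfolding asum_def by (simp add: norm_mult summable_mult)

lemma asum_shl: "asum x \<Longrightarrow> asum (shl x)"
  unfolding asum_def by (simp add: summable_Suc_iff[of "\<lambda>n. norm (coef x n)"])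

lemma asum_shl_pow: "asum x \<Longrightarrow> asum ((shl ^^ n) x)"
  by (induction n) (auto intro: asum_shl)

lift_definition shlL :: "nat \<Rightarrow> ell2 \<Rightarrow>\<^sub>L ell2" is "\<lambda>n. shl ^^ n" by (rule bounded_linear_shl_pow)
lift_definition shrL :: "nat \<Rightarrow> ell2 \<Rightarrow>\<^sub>L ell2" is "\<lambda>n. shr ^^ n" by (rule bounded_linear_shr_pow)
lift_definition flipL :: "nat \<Rightarrow> ell2 \<Rightarrow>\<^sub>L ell2" is flip by (rule bounded_linear_flip)

lemma norm_shlL: "norm (shlL n) \<le> 1" and norm_shrL: "norm (shrL n) \<le> 1"
  and norm_flipL: "norm (flipL n) \<le> 1"
  by (rule norm_blinfun_bound;
      simp add: shlL.rep_eq shrL.rep_eq flipL.rep_eq norm_shl_pow_le norm_flip_le)+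

text \<open>For a symbol \<open>u\<close> in the Wiener algebra these are \<open>T\<^sub>u\<close>, its adjoint, and the Hankel
  operator \<open>H\<^sub>u\<close>, and \<open>kank u\<close> is \<open>K\<^sub>u\<close>; \<open>shr\<close> is \<open>S\<close>, \<open>shl\<close> is \<open>S\<^sup>*\<close>, and \<open>flip n\<close> is the Hankel
  operator with symbol \<open>exp (i n x)\<close>.\<close>

definition toep :: "ell2 \<Rightarrow> ell2 \<Rightarrow>\<^sub>L ell2" where "toep u = opsum shrL (coef u)"
definition toepS :: "ell2 \<Rightarrow> ell2 \<Rightarrow>\<^sub>L ell2" where "toepS u = opsum shlL (\<lambda>n. cnj (coef u n))"
definition hank :: "ell2 \<Rightarrow> ell2 \<Rightarrow>\<^sub>L ell2" where "hank u = opsum flipL (coef u)"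
definition kank :: "ell2 \<Rightarrow> ell2 \<Rightarrow>\<^sub>L ell2" where "kank u = hank (shl u)"

section \<open>Toeplitz and Hankel operators: shift relations and adjoints\<close>

context
  fixes u assumes u: "asum u"
begin

lemma sn: "summable (\<lambda>n. norm (coef u n))" and snc: "summable (\<lambda>n. norm (cnj (coef u n)))"
  using u by (simp_all add: asum_def)

lemma toep_sums: "(\<lambda>n. coef u n *\<^sub>c (shr ^^ n) x) sums toep u x"
  using opsum_sums[OF norm_shrL sn, where x=x] by (simp add: toep_def shrL.rep_eq)
lemma toepS_sums: "(\<lambda>n. cnj (coef u n) *\<^sub>c (shl ^^ n) x) sums toepS u x"
  using opsum_sums[OF norm_shlL snc, where x=x] by (simp add: toepS_def shlL.rep_eq)
lemma hank_sums: "(\<lambda>n. coef u n *\<^sub>c flip n x) sums hank u x"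
  using opsum_sums[OF norm_flipL sn, where x=x] by (simp add: hank_def flipL.rep_eq)

lemma norm_toep_le: "norm (toep u) \<le> anorm u"
  using norm_opsum_le[OF norm_shrL sn] by (simp add: toep_def anorm_def)
lemma norm_toepS_le: "norm (toepS u) \<le> anorm u"
  using norm_opsum_le[OF norm_shlL snc] by (simp add: toepS_def anorm_def)
lemma norm_hank_le: "norm (hank u) \<le> anorm u"
  using norm_opsum_le[OF norm_flipL sn] by (simp add: hank_def anorm_def)

lemma toep_cmul [simp]: "toep u (c *\<^sub>c x) = c *\<^sub>c toep u x"
  using bounded_linear.sums[OF cmul.bounded_linear_right toep_sums[of x], of c] toep_sums[of "c *\<^sub>c x"]
  by (auto simp: mult.commute dest: sums_unique2)

lemma toepS_cmul [simp]: "toepS u (c *\<^sub>c x) = c *\<^sub>c toepS u x"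
  using bounded_linear.sums[OF cmul.bounded_linear_right toepS_sums[of x], of c] toepS_sums[of "c *\<^sub>c x"]
  by (auto simp: mult.commute dest: sums_unique2)

lemma hank_cmul [simp]: "hank u (c *\<^sub>c x) = cnj c *\<^sub>c hank u x"
  using bounded_linear.sums[OF cmul.bounded_linear_right hank_sums[of x], of "cnj c"] hank_sums[of "c *\<^sub>c x"]
  by (auto simp: mult.commute dest: sums_unique2)

lemma toep_shr: "toep u (shr x) = shr (toep u x)"
  using bounded_linear.sums[OF bounded_linear_shr toep_sums[of x]] toep_sums[of "shr x"]
  by (auto simp: shr_pow_shr dest: sums_unique2)

lemma toepS_shl: "toepS u (shl x) = shl (toepS u x)"
  using bounded_linear.sums[OF bounded_linear_shl toepS_sums[of x]] toepS_sums[of "shl x"]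
  by (auto simp: shl_pow_shl dest: sums_unique2)

lemma hank_shr: "hank u (shr x) = shl (hank u x)"
  using bounded_linear.sums[OF bounded_linear_shl hank_sums[of x]] hank_sums[of "shr x"]
  by (auto simp: shl_flip dest: sums_unique2)

lemma toep_basis_0 [simp]: "toep u (basis 0) = u"
  using toep_sums[of "basis 0"] truncation_tendsto[of u] LIMSEQ_unique
  unfolding sums_def by fastforce

lemma flip_basis_0 [simp]: "flip n (basis 0) = basis n"
  by (rule ell2_eqI) (auto simp: coef_flip coef_basis)

lemma hank_basis_0 [simp]: "hank u (basis 0) = u"
  using hank_sums[of "basis 0"] truncation_tendsto[of u] LIMSEQ_unique
  unfolding sums_def by fastforce

lemma cinner_toep: "cinner (toep u x) y = cinner x (toepS u y)"
  using bounded_linear.sums[OF cinner.bounded_linear_left toep_sums[of x], of y]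
    bounded_linear.sums[OF cinner.bounded_linear_right toepS_sums[of y], of x]
  by (auto simp: cinner_shr_pow_left dest: sums_unique2)

lemma cinner_hank: "cinner (hank u x) y = cinner (hank u y) x"
  using bounded_linear.sums[OF cinner.bounded_linear_left hank_sums[of x], of y]
    bounded_linear.sums[OF cinner.bounded_linear_left hank_sums[of y], of x]
  by (auto simp: cinner_flip[of _ y x] dest: sums_unique2)

end

text \<open>\<open>toep u\<close> commutes with \<open>shr\<close> exactly and with
  \<open>shl\<close> up to rank one; the defect comes from the constant term, which
  \<open>shl\<close> kills.\<close>

lemma shl_toep: "asum u \<Longrightarrow> shl (toep u x) = toep u (shl x) + coef x 0 *\<^sub>c shl u"
  by (subst shr_shl_add[of x]) (simp add: blinfun.add_right toep_shr)

lemma cinner_toepS: "asum u \<Longrightarrow> cinner (toepS u x) y = cinner x (toep u y)"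
  by (metis cinner_commute cinner_toep)

lemma toepS_shr: "asum u \<Longrightarrow> toepS u (shr x) = shr (toepS u x) + cinner x (shl u) *\<^sub>c basis 0"
proof -
  assume u: "asum u"
  have "coef (toepS u (shr x)) 0 = cinner (toepS u (shr x)) (basis 0)" by simp
  also have "\<dots> = cinner x (shl u)"
    by (simp only: cinner_toepS[OF u] toep_basis_0[OF u] cinner_shr_left)
  finally show ?thesis
    using shr_shl_add[of "toepS u (shr x)"] by (simp add: toepS_shl[OF u, symmetric])
qed

text \<open>An operator with the Hankel relation is determined by its symbol, the image of
  \<open>basis 0\<close>: the images of the other basis vectors are backward shifts of it.
  Identities between Hankel operators thus reduce to one vector.\<close>

lemma antilinear_eqI:
  assumes "bounded_linear X" "bounded_linear Y"
    and "\<And>c x. X (c *\<^sub>c x) = cnj c *\<^sub>c X x" "\<And>c x. Y (c *\<^sub>c x) = cnj c *\<^sub>c Y x"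
    and "\<And>x. X (shr x) = shl (X x)" "\<And>x. Y (shr x) = shl (Y x)"
    and "X (basis 0) = Y (basis 0)"
  shows "X = Y"
proof (rule bounded_linear_eq_on_basis[OF assms(1,2)])
  fix c m
  have "X (basis m) = Y (basis m)" for m
    by (induction m) (use assms(5-7) in \<open>simp_all flip: shr_basis\<close>)
  then show "X (c *\<^sub>c basis m) = Y (c *\<^sub>c basis m)" by (simp add: assms)
qed

lemma kank_shr: "asum u \<Longrightarrow> kank u (shr x) = shl (kank u x)"
  by (simp add: kank_def hank_shr asum_shl)

lemma kank_cmul [simp]: "asum u \<Longrightarrow> kank u (c *\<^sub>c x) = cnj c *\<^sub>c kank u x"
  by (simp add: kank_def asum_shl)

lemma kank_basis_0 [simp]: "asum u \<Longrightarrow> kank u (basis 0) = shl u"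
  by (simp add: kank_def asum_shl)

lemma cinner_kank: "asum u \<Longrightarrow> cinner (kank u x) y = cinner (kank u y) x"
  by (simp add: kank_def asum_shl cinner_hank[of _ x])

lemma cinner_kank_kank: "asum u \<Longrightarrow> cinner (kank u (kank u x)) y = cinner x (kank u (kank u y))"
  by (metis cinner_commute cinner_kank)

text \<open>Reconciles \<open>kank\<close>, defined by the symbol \<open>shl u\<close>, with the
  product of the Hankel operator and the shift that defines K_u.\<close>

lemma hank_shr_kank: "asum u \<Longrightarrow> hank u (shr x) = kank u x"
proof -
  assume u: "asum u"
  have "(\<lambda>x. hank u (shr x)) = kank u"
    by (rule antilinear_eqI[OF bounded_linear_compose[OF blinfun.bounded_linear_right bounded_linear_shr]
          blinfun.bounded_linear_right])
       (auto simp: u hank_shr kank_shr)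
  then show ?thesis by (simp add: fun_eq_iff)
qed

lemma hank_eq: "asum u \<Longrightarrow> hank u x = cnj (coef x 0) *\<^sub>c u + kank u (shl x)"
  by (subst shr_shl_add[of x]) (simp add: blinfun.add_right hank_shr_kank)

text \<open>The squares of H_u and K_u differ by the rank one operator of \<open>u\<close>, because
  the mean of \<open>hank u x\<close> is \<open>cinner u x\<close> by symmetry.\<close>

lemma hank_hank: "asum u \<Longrightarrow> hank u (hank u x) = kank u (kank u x) + cinner x u *\<^sub>c u"
proof -
  assume u: "asum u"
  have "coef (hank u x) 0 = cinner (hank u x) (basis 0)" by simp
  also have "\<dots> = cinner u x" by (simp only: cinner_hank[OF u, of x] hank_basis_0[OF u])
  finally show ?thesis
    by (subst hank_eq[OF u])
      (simp add: hank_shr[OF u, symmetric] hank_shr_kank[OF u] cinner_commute[of x u])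
qed

text \<open>Two descriptions of \<Pi>(|u|^2): both have n-th coefficient
  \<open>cinner ((shl ^^ n) u) u\<close>. The Toeplitz form suits the Lax pair, the Hankel form the
  eigenspace computations.\<close>

lemma toepS_self: "asum u \<Longrightarrow> toepS u u = hank u u"
proof -
  assume u: "asum u"
  show ?thesis
  proof (rule ell2_eqI)
    fix n
    have "coef (toepS u u) n = cinner (toepS u u) (basis n)" by simp
    also have "\<dots> = cinner u ((shr ^^ n) u)"
    proof -
      have "toep u (basis n) = (shr ^^ n) u"
        by (induction n) (use toep_shr[OF u] in \<open>simp_all add: u flip: shr_basis\<close>)
      then show ?thesis by (simp only: cinner_toepS[OF u])
    qed
    also have "\<dots> = cinner ((shl ^^ n) u) u"
      by (metis cinner_commute cinner_shr_pow_left)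
    also have "\<dots> = cinner (hank u (basis n)) u"
    proof -
      have "hank u (basis n) = (shl ^^ n) u"
        by (induction n) (use hank_shr[OF u] in \<open>simp_all add: u flip: shr_basis\<close>)
      then show ?thesis by simp
    qed
    also have "\<dots> = coef (hank u u) n" by (simp only: cinner_hank[OF u, of "basis n"] cinner_basis)
    finally show "coef (toepS u u) n = coef (hank u u) n" .
  qed
qed

lemma asum_sum_le: "asum x \<Longrightarrow> (\<Sum>k<N. norm (coef x k)) \<le> anorm x"
  unfolding asum_def anorm_def by (rule sum_le_suminf) auto

lemma asum_toep: "asum u \<Longrightarrow> asum x \<Longrightarrow> asum (toep u x)"
proof -
  assume u: "asum u" and x: "asum x"
  have "(\<Sum>k<N. norm (coef ((shr ^^ n) x) k)) \<le> anorm x" for n N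
  proof (induction n arbitrary: N)
    case 0
    then show ?case using asum_sum_le[OF x] by simp
  next
    case (Suc n)
    show ?case
    proof (cases N)
      case 0
      then show ?thesis using asum_sum_le[OF x, of 0] by simp
    next
      case (Suc N')
      then show ?thesis using Suc.IH[of N'] by (simp add: sum.lessThan_Suc_shift del: sum.lessThan_Suc)
    qed
  qed
  then show ?thesis
    unfolding toep_def by (intro asum_opsum[OF norm_shrL sn[OF u]]) (simp add: shrL.rep_eq)
qed

lemma asum_toepS: "asum u \<Longrightarrow> asum x \<Longrightarrow> asum (toepS u x)"
proof -
  assume u: "asum u" and x: "asum x"
  have "(\<Sum>k<N. norm (coef ((shl ^^ n) x) k)) \<le> anorm x" for n N
  proof -
    have "(\<Sum>k<N. norm (coef ((shl ^^ n) x) k)) = (\<Sum>k\<in>{n..<n+N}. norm (coef x k))"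
      using sum.shift_bounds_nat_ivl[of "\<lambda>k. norm (coef x k)" 0 n N]
      by (simp add: add.commute lessThan_atLeast0)
    also have "\<dots> \<le> (\<Sum>k<n+N. norm (coef x k))" by (intro sum_mono2) auto
    also have "\<dots> \<le> anorm x" by (rule asum_sum_le[OF x])
    finally show ?thesis .
  qed
  then show ?thesis
    unfolding toepS_def by (intro asum_opsum[OF norm_shlL snc[OF u]]) (simp add: shlL.rep_eq)
qed

text \<open>Reads the vector as \<open>toep x (basis 0)\<close> and uses the operator bound.\<close>

lemma norm_le_anorm: "asum x \<Longrightarrow> norm x \<le> anorm x"
proof -
  assume x: "asum x"
  have "norm (toep x (basis 0)) \<le> norm (toep x) * norm (basis 0)" by (rule norm_blinfun)
  also have "\<dots> \<le> anorm x * 1"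
  proof (intro mult_mono norm_toep_le[OF x])
    have "(norm (basis 0))\<^sup>2 = 1"
      using cinner_self_norm[of "basis 0"] by (simp add: coef_basis del: of_real_power)
    then show "norm (basis 0) \<le> 1" by (auto simp: power2_eq_1_iff)
    show "0 \<le> anorm x" using asum_sum_le[OF x, of 0] by simp
  qed auto
  finally show ?thesis by (simp add: x)
qed

text \<open>The difference of the two sides is selfadjoint, equals its own compression by the shift, and
  kills \<open>basis 0\<close>, so all its matrix entries vanish.\<close>

lemma toepS_toep: "asum u \<Longrightarrow> toepS u (toep u x) - toep u (toepS u x) = kank u (kank u x)"
proof -
  assume u: "asum u"
  define X where "X = (toepS u o\<^sub>L toep u) - (toep u o\<^sub>L toepS u) - (kank u o\<^sub>L kank u)"
  have X: "X x = toepS u (toep u x) - toep u (toepS u x) - kank u (kank u x)" for x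
    by (simp add: X_def blinfun.bilinear_simps)
  have Xc: "X (c *\<^sub>c x) = c *\<^sub>c X x" for c x
    by (simp add: X u cmul_distribs)
  have sa: "cinner (X x) y = cinner x (X y)" for x y
    by (simp add: X cinner_toep[OF u] cinner_toepS[OF u] cinner_kank_kank[OF u])
  have X0: "X (basis 0) = 0"
  proof -
    have "toepS u (basis 0) = cnj (coef u 0) *\<^sub>c basis 0"
    proof -
      have "(\<lambda>n. cnj (coef u n) *\<^sub>c (shl ^^ n) (basis 0)) = (\<lambda>n. if n = 0 then cnj (coef u n) *\<^sub>c basis 0 else 0)"
      proof
        fix n show "cnj (coef u n) *\<^sub>c (shl ^^ n) (basis 0) = (if n = 0 then cnj (coef u n) *\<^sub>c basis 0 else 0)"
        proof (cases n)
          case (Suc m)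
          have "(shl ^^ n) (basis 0) = 0" by (rule ell2_eqI) (simp add: Suc coef_basis)
          then show ?thesis using Suc by simp
        qed simp
      qed
      then show ?thesis
        using toepS_sums[OF u, of "basis 0"] sums_unique2[OF _ sums_single[of 0 "\<lambda>n. cnj (coef u n) *\<^sub>c basis 0"]] by simp
    qed
    then show ?thesis
      by (simp add: X u toepS_self hank_eq[OF u, of u])
  qed
  have step: "shl (X (shr x)) = X x" for x
  proof -
    have k: "coef (kank u x) 0 = cinner (shl u) x" for x
      by (metis cinner_basis cinner_kank[OF u] kank_basis_0[OF u])
    have "kank u (shl (kank u x)) = hank u (kank u x) - cnj (coef (kank u x) 0) *\<^sub>c u"
      by (simp add: hank_eq[OF u])
    \<comment> \<open>This rank one term cancels the one that \<open>toepS_shr\<close> contributes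
      to \<open>toep u (toepS u (shr x))\<close>.\<close>
    then have "shl (kank u (kank u (shr x))) = kank u (kank u x) - cinner x (shl u) *\<^sub>c shl u"
      by (simp add: kank_shr[OF u] k hank_shr[OF u, symmetric] hank_shr_kank[OF u] cinner_commute[of x "shl u"])
    then show ?thesis
      by (simp add: X toep_shr[OF u] toepS_shl[OF u, symmetric] toepS_shr[OF u] shl_toep[OF u] blinfun.bilinear_simps u)
  qed
  have entry: "cinner (X (basis m)) (basis l) = 0" for m l
  proof (induction m arbitrary: l)
    case 0 then show ?case by (simp add: X0)
  next
    case (Suc m)
    show ?case
    proof (cases l)
      case 0
      then show ?thesis by (simp only: sa X0) simp
    next
      case (Suc l')
      then show ?thesis using Suc.IH[of l'] step[of "basis m"]
        by (simp flip: cinner_shl_left shr_basis del: cinner_basis)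
    qed
  qed
  have "blinfun_apply X = (\<lambda>_. 0)"
    by (rule bounded_linear_eq_on_basis) (use entry in \<open>auto simp: Xc blinfun.bounded_linear_right intro!: ell2_eqI\<close>)
  then have "X x = 0" by (simp add: fun_eq_iff)
  then show ?thesis unfolding X by simp
qed

text \<open>Each right-hand side has the Hankel relation, so only symbols are compared. Both forms
  are kept because the factor 2J of the equation is shared equally between them in the Lax
  equation.\<close>

lemma kank_toepS_self: "asum u \<Longrightarrow> kank (toepS u u) x = toepS u (kank u x)"
  and kank_toepS_self': "asum u \<Longrightarrow> kank (toepS u u) x = kank u (toep u x)"
proof -
  assume u: "asum u"
  have w: "asum (toepS u u)" by (intro asum_toepS u)
  have "blinfun_apply (kank (toepS u u)) = (\<lambda>x. toepS u (kank u x))"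
    by (rule antilinear_eqI)
       (auto simp: u w kank_shr toepS_shl intro!: blinfun.bounded_linear_right
         bounded_linear_compose[OF blinfun.bounded_linear_right blinfun.bounded_linear_right])
  then show "kank (toepS u u) x = toepS u (kank u x)" by (simp add: fun_eq_iff)
  have "shl (toepS u u) = kank u u"
    by (simp add: u toepS_self hank_shr[symmetric] hank_shr_kank)
  then have "blinfun_apply (kank (toepS u u)) = (\<lambda>x. kank u (toep u x))"
    by (intro antilinear_eqI)
       (auto simp: u w kank_shr toep_shr intro!: blinfun.bounded_linear_right
         bounded_linear_compose[OF blinfun.bounded_linear_right blinfun.bounded_linear_right])
  then show "kank (toepS u u) x = kank u (toep u x)" by (simp add: fun_eq_iff)
qed

text \<open>The summands on the right have rank one defects from the Hankel relation, given by
  \<open>shl_toep\<close> and \<open>toepS_shr\<close>. These compensate each other, so the sum is a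
  Hankel operator and is determined by its symbol.\<close>

lemma kank_toep_self:
  assumes u: "asum u"
  shows "kank (toep u u) x = toep u (kank u x) + kank u (toepS u x)"
proof -
  have v: "asum (toep u u)" by (intro asum_toep u)
  have k: "coef (kank u x) 0 = cinner (shl u) x" for x
    by (metis cinner_basis cinner_kank[OF u] kank_basis_0[OF u])
  have t0: "toepS u (basis 0) = cnj (coef u 0) *\<^sub>c basis 0"
  proof (rule ell2_eqI)
    fix n
    have "coef (toepS u (basis 0)) n = cinner (toepS u (basis 0)) (basis n)" by simp
    also have "\<dots> = cnj (cinner (toep u (basis n)) (basis 0))"
      unfolding cinner_toepS[OF u] by (rule cinner_commute)
    also have "\<dots> = coef (cnj (coef u 0) *\<^sub>c basis 0) n"
      by (cases n) (simp_all add: u coef_basis toep_shr flip: shr_basis)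
    finally show "coef (toepS u (basis 0)) n = coef (cnj (coef u 0) *\<^sub>c basis 0) n" .
  qed
  have "blinfun_apply (kank (toep u u)) = (\<lambda>x. toep u (kank u x) + kank u (toepS u x))"
  proof (rule antilinear_eqI)
    show "bounded_linear (\<lambda>x. toep u (kank u x) + kank u (toepS u x))"
      by (intro bounded_linear_add bounded_linear_compose[OF blinfun.bounded_linear_right blinfun.bounded_linear_right])
    fix x
    show "toep u (kank u (shr x)) + kank u (toepS u (shr x)) = shl (toep u (kank u x) + kank u (toepS u x))"
      by (simp add: u kank_shr toepS_shr shl_toep blinfun.bilinear_simps k cinner_commute[of "shl u" x])
  qed (auto simp: u v kank_shr cmul_distribs t0 shl_toep blinfun.bounded_linear_right)
  then show ?thesis by (simp add: fun_eq_iff)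
qed

lemma toep_toep_self:
  assumes u: "asum u"
  shows "toep (toep u u) x = toep u (toep u x)"
proof -
  have v: "asum (toep u u)" by (intro asum_toep u)
  have "blinfun_apply (toep (toep u u)) = (\<lambda>x. toep u (toep u x))"
  proof (rule bounded_linear_eq_on_basis)
    fix c m
    have "toep (toep u u) (basis m) = toep u (toep u (basis m))"
      by (induction m) (simp_all add: u v toep_shr flip: shr_basis)
    then show "toep (toep u u) (c *\<^sub>c basis m) = toep u (toep u (c *\<^sub>c basis m))" by (simp add: u v)
  qed (intro blinfun.bounded_linear_right
         bounded_linear_compose[OF blinfun.bounded_linear_right blinfun.bounded_linear_right])+
  then show ?thesis by (simp add: fun_eq_iff)
qed

lemma toepS_toep_self:
  assumes u: "asum u"
  shows "toepS (toep u u) x = toepS u (toepS u x)"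
proof (rule ell2_eqI)
  have v: "asum (toep u u)" by (intro asum_toep u)
  fix n
  have "cinner (toepS (toep u u) x) (basis n) = cinner (toepS u (toepS u x)) (basis n)"
    by (simp only: cinner_toepS[OF u] cinner_toepS[OF v] toep_toep_self[OF u])
  then show "coef (toepS (toep u u) x) n = coef (toepS u (toepS u x)) n" by simp
qed

text \<open>Both vectors are the projection of \<open>u\<close> times the conjugate of
  \<open>w\<close>. The point is to trade the symbol \<open>w\<close> for the symbol
  \<open>u\<close>, to which \<open>hank_hank\<close> applies.\<close>

lemma toepS_swap:
  assumes "asum u" "asum w"
  shows "toepS w u = hank u w"
proof (rule ell2_eqI)
  fix n
  have t: "toep w (basis n) = (shr ^^ n) w"
    by (induction n) (use toep_shr[OF assms(2)] in \<open>simp_all add: assms flip: shr_basis\<close>)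
  have h: "hank u (basis n) = (shl ^^ n) u"
    by (induction n) (use hank_shr[OF assms(1)] in \<open>simp_all add: assms flip: shr_basis\<close>)
  have "cinner (toepS w u) (basis n) = cinner u ((shr ^^ n) w)"
    by (simp only: cinner_toepS[OF assms(2)] t)
  also have "\<dots> = cinner ((shl ^^ n) u) w"
    by (metis cinner_commute cinner_shr_pow_left)
  also have "\<dots> = cinner (hank u w) (basis n)"
    by (simp only: cinner_hank[OF assms(1), of w] h)
  finally show "coef (toepS w u) n = coef (hank u w) n" by simp
qed

text \<open>The commutator of \<open>shl\<close> with the square of K_u. Both corrections vanish for
  vectors orthogonal to \<open>u\<close> with zero mean, so \<open>shl\<close> keeps such
  eigenvectors in their eigenspace.\<close>

lemma kank_kank_shl:
  assumes u: "asum u"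
  shows "kank u (kank u (shl y)) = shl (kank u (kank u y)) + cinner y u *\<^sub>c shl u - coef y 0 *\<^sub>c kank u u"
proof -
  have "kank u (shl y) = hank u y - cnj (coef y 0) *\<^sub>c u" by (simp add: hank_eq[OF u])
  then have "kank u (kank u (shl y)) = kank u (hank u y) - coef y 0 *\<^sub>c kank u u"
    by (simp add: blinfun.diff_right u)
  moreover have "kank u (hank u y) = shl (hank u (hank u y))"
    by (simp add: hank_shr[OF u, symmetric] hank_shr_kank[OF u])
  ultimately show ?thesis by (simp add: hank_hank[OF u])
qed

section \<open>Linear differential equations in Banach spaces\<close>

lemma antiderivative_exists:
  fixes f :: "real \<Rightarrow> 'a::banach"
  assumes f: "continuous_on UNIV f"
  shows "\<exists>g. g 0 = 0 \<and> (\<forall>t. (g has_vector_derivative f t) (at t))"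
proof -
  \<comment> \<open>Two branches, since the integral over \<open>{0..t}\<close> with negative
    \<open>t\<close> is 0 rather than oriented.\<close>
  define g where "g t = (if 0 \<le> t then integral {0..t} f else - integral {t..0} f)" for t
  have int: "f integrable_on {a..b}" for a b
    using f by (intro integrable_continuous_real continuous_on_subset[OF f]) auto
  have "(g has_vector_derivative f t) (at t)" for t
  proof -
    define a where "a = min 0 t - 1"
    define b where "b = max 0 t + 1"
    have g: "g s = integral {a..s} f - integral {a..0} f" if "s \<in> {a<..<b}" for s
    proof (cases "0 \<le> s")
      case True
      then have "integral {a..0} f + integral {0..s} f = integral {a..s} f"
        using int by (intro Henstock_Kurzweil_Integration.integral_combine) (auto simp: a_def)
      then show ?thesis using True by (simp add: g_def algebra_simps)
    next
      case False
      then have "integral {a..s} f + integral {s..0} f = integral {a..0} f"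
        using int that by (intro Henstock_Kurzweil_Integration.integral_combine) (auto simp: a_def)
      then show ?thesis using False by (simp add: g_def algebra_simps)
    qed
    have t: "t \<in> {a<..<b}" by (auto simp: a_def b_def)
    have "((\<lambda>s. integral {a..s} f) has_vector_derivative f t) (at t within {a..b})"
      using t by (intro integral_has_vector_derivative continuous_on_subset[OF f]) simp_all
    then have "((\<lambda>s. integral {a..s} f) has_vector_derivative f t) (at t)"
      using t at_within_Icc_at[of a t b] by simp
    then have "((\<lambda>s. integral {a..s} f - integral {a..0} f) has_vector_derivative f t - 0) (at t)"
      by (intro has_vector_derivative_diff has_vector_derivative_const)
    then have "((\<lambda>s. integral {a..s} f - integral {a..0} f) has_vector_derivative f t) (at t)" by simp
    then show ?thesis
      by (rule has_vector_derivative_transform_within_open[OF _ open_greaterThanLessThan t])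
         (use g in auto)
  qed
  moreover have "g 0 = 0" by (simp add: g_def)
  ultimately show ?thesis by blast
qed

text \<open>One step of the factorial estimate for iterated integrals, on both sides of 0; negative
  times are reflected.\<close>

lemma norm_le_power_of_derivative:
  fixes g :: "real \<Rightarrow> 'a::real_normed_vector"
  assumes "g 0 = 0" and g: "\<And>t. (g has_vector_derivative f t) (at t)"
    and f: "\<And>s. \<bar>s\<bar> \<le> \<bar>t\<bar> \<Longrightarrow> norm (f s) \<le> C * \<bar>s\<bar> ^ n / fact n"
  shows "norm (g t) \<le> C * \<bar>t\<bar> ^ Suc n / fact (Suc n)"
proof -
  have pos: "norm (g t) \<le> C * t ^ Suc n / fact (Suc n)"
    if "g 0 = 0" "\<And>t. (g has_vector_derivative f t) (at t)" "0 < t"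
      "\<And>s. 0 \<le> s \<Longrightarrow> s \<le> t \<Longrightarrow> norm (f s) \<le> C * s ^ n / fact n"
    for g f :: "real \<Rightarrow> 'a" and t
  proof -
    let ?\<phi> = "\<lambda>s::real. C * s ^ Suc n / fact (Suc n)"
    have \<phi>: "(?\<phi> has_vector_derivative (C * x ^ n / fact n)) (at x)" for x
    proof -
      have "(?\<phi> has_real_derivative (C * (real (Suc n) * x ^ n) / fact (Suc n))) (at x)"
        using DERIV_cdivide[OF DERIV_cmult[OF DERIV_pow[of "Suc n" x UNIV], of C], of "fact (Suc n)"] by simp
      also have "C * (real (Suc n) * x ^ n) / fact (Suc n) = C * x ^ n / fact n"
        by (simp add: divide_simps del: of_nat_Suc)
      finally show ?thesis by (simp add: has_real_derivative_iff_has_vector_derivative)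
    qed
    have "norm (g t - g 0) \<le> ?\<phi> t - ?\<phi> 0"
    proof (rule differentiable_bound_general[OF \<open>0 < t\<close>])
      show "continuous_on {0..t} g"
        using that(2) by (intro continuous_on_vector_derivative[OF has_vector_derivative_at_within])
      show "continuous_on {0..t} ?\<phi>" by (intro continuous_intros) auto
    qed (use that \<phi> in auto)
    then show ?thesis using that by simp
  qed
  show ?thesis
  proof (cases "t = 0")
    case False
    show ?thesis
    proof (cases "0 < t")
      case True
      have "norm (g t) \<le> C * t ^ Suc n / fact (Suc n)"
      proof (rule pos[OF assms(1,2) True])
        fix s assume "0 \<le> s" "s \<le> t"
        then show "norm (f s) \<le> C * s ^ n / fact n" using f[of s] by simp
      qed
      then show ?thesis using True by simp
    next
      case False
      with \<open>t \<noteq> 0\<close> have t: "0 < - t" by simp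
      have "((\<lambda>s. g (- s)) has_vector_derivative - f (- s)) (at s)" for s
        using vector_diff_chain_at[OF has_vector_derivative_minus[OF has_vector_derivative_id] g, of s]
        by (simp add: o_def)
      then have "norm (g (- (- t))) \<le> C * (- t) ^ Suc n / fact (Suc n)"
      proof (rule pos[rotated, OF _ t])
        fix s assume "0 \<le> s" "s \<le> - t"
        then show "norm (- f (- s)) \<le> C * s ^ n / fact n" using f[of "- s"] by simp
      qed (simp add: assms(1))
      then show ?thesis using t by simp
    qed
  qed (simp add: assms)
qed

text \<open>The Picard iterates form a series of iterated integrals with factorial bounds on every
  compact interval. Linearity therefore gives a solution on the whole line at once, without gluing
  local ones.\<close>

theorem linear_ode_exists:
  fixes B :: "real \<Rightarrow> 'a::banach \<Rightarrow>\<^sub>L 'a"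
  assumes B: "continuous_on UNIV B"
  shows "\<exists>x. x 0 = x0 \<and> (\<forall>t. (x has_vector_derivative B t (x t)) (at t))"
proof -
  \<comment> \<open>Differentiability of \<open>f\<close> supplies continuity and is inherited by
    \<open>g\<close>, so the chosen map \<open>G\<close> can be iterated.\<close>
  have "\<exists>g. g 0 = 0 \<and> (\<forall>t. (g has_vector_derivative B t (f t)) (at t))"
    if "\<forall>t. (f has_vector_derivative f' t) (at t)" for f f'
  proof (rule antiderivative_exists)
    have "continuous_on UNIV f"
      using that by (intro continuous_on_vector_derivative) auto
    then show "continuous_on UNIV (\<lambda>t. B t (f t))" by (intro continuous_intros B)
  qed
  then have "\<forall>f. \<exists>g. (\<exists>f'. \<forall>t. (f has_vector_derivative f' t) (at t)) \<longrightarrow>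
      g 0 = 0 \<and> (\<forall>t. (g has_vector_derivative B t (f t)) (at t))" by meson
  then obtain G where G: "\<And>f. (\<exists>f'. \<forall>t. (f has_vector_derivative f' t) (at t)) \<Longrightarrow>
      G f 0 = 0 \<and> (\<forall>t. (G f has_vector_derivative B t (f t)) (at t))" by metis
  define p where "p n = (G ^^ n) (\<lambda>_. x0)" for n
  define q where "q n t = (case n of 0 \<Rightarrow> 0 | Suc m \<Rightarrow> B t (p m t))" for n t
  have ex: "\<exists>f'. \<forall>t. (p n has_vector_derivative f' t) (at t)" for n
  proof (induction n)
    case 0
    then show ?case by (auto simp: p_def intro!: exI[of _ "\<lambda>_. 0"])
  next
    case (Suc n)
    then show ?case using G[of "p n"] by (auto simp: p_def)
  qed
  have pS: "p (Suc n) 0 = 0" "(p (Suc n) has_vector_derivative B t (p n t)) (at t)" for n t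
    using G[OF ex[of n]] by (simp_all add: p_def)
  have pq: "(p n has_vector_derivative q n t) (at t)" for n t
    by (cases n) (use pS in \<open>auto simp: q_def p_def\<close>)
  have main: "\<exists>M. (\<forall>n t. \<bar>t\<bar> \<le> T \<longrightarrow> norm (p n t) \<le> norm x0 * (M * \<bar>t\<bar>) ^ n / fact n)
      \<and> 0 \<le> M \<and> (\<forall>t. \<bar>t\<bar> \<le> T \<longrightarrow> norm (B t) \<le> M)" for T
  proof -
    have "compact (B ` {-T..T})"
      by (intro compact_continuous_image continuous_on_subset[OF B]) auto
    then obtain M where M: "0 < M" "\<And>t. \<bar>t\<bar> \<le> T \<Longrightarrow> norm (B t) \<le> M"
      using compact_imp_bounded bounded_pos[of "B ` {-T..T}"] by (auto simp: abs_le_iff)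
    have "norm (p n t) \<le> norm x0 * M ^ n * \<bar>t\<bar> ^ n / fact n" if "\<bar>t\<bar> \<le> T" for n t
      using that
    proof (induction n arbitrary: t)
      case 0
      then show ?case by (simp add: p_def)
    next
      case (Suc n)
      show ?case
      proof (rule norm_le_power_of_derivative[OF pS])
        fix s assume s: "\<bar>s\<bar> \<le> \<bar>t\<bar>"
        have "norm (B s (p n s)) \<le> norm (B s) * norm (p n s)" by (rule norm_blinfun)
        also have "\<dots> \<le> M * (norm x0 * M ^ n * \<bar>s\<bar> ^ n / fact n)"
          using s Suc M by (intro mult_mono) auto
        finally show "norm (B s (p n s)) \<le> norm x0 * M ^ Suc n * \<bar>s\<bar> ^ n / fact n"
          by (simp add: mult_ac)
      qed
    qed
    then show ?thesis using M by (intro exI[of _ M]) (auto simp: power_mult_distrib mult_ac less_imp_le)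
  qed
  have sp: "summable (\<lambda>n. p n t)" for t
  proof -
    obtain M where M: "\<And>n s. \<bar>s\<bar> \<le> \<bar>t\<bar> \<Longrightarrow> norm (p n s) \<le> norm x0 * (M * \<bar>s\<bar>) ^ n / fact n"
      using main[of "\<bar>t\<bar>"] by blast
    have "summable (\<lambda>n. norm x0 * (inverse (fact n) * (M * \<bar>t\<bar>) ^ n))"
      by (intro summable_mult summable_exp)
    then show ?thesis
      by (rule summable_comparison_test'[where N=0]) (use M[of t] in \<open>auto simp: field_simps\<close>)
  qed
  define x where "x t = (\<Sum>n. p n t)" for t
  have sq: "(\<lambda>n. q n t) sums B t (x t)" for t
  proof -
    have "(\<lambda>n. B t (p n t)) sums B t (x t)"
      unfolding x_def by (intro bounded_linear.sums[OF blinfun.bounded_linear_right] summable_sums sp)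
    then have "(\<lambda>n. q (Suc n) t) sums (B t (x t) - q 0 t)" by (simp add: q_def)
    then show ?thesis by (subst (asm) sums_Suc_iff) simp
  qed
  have "(x has_vector_derivative B t (x t)) (at t)" for t
  proof -
    define T where "T = \<bar>t\<bar> + 1"
    obtain M where M: "\<And>n s. \<bar>s\<bar> \<le> T \<Longrightarrow> norm (p n s) \<le> norm x0 * (M * \<bar>s\<bar>) ^ n / fact n"
      "0 \<le> M" "\<And>s. \<bar>s\<bar> \<le> T \<Longrightarrow> norm (B s) \<le> M"
      using main[of T] by blast
    let ?c = "\<lambda>n. M * (norm x0 * (inverse (fact n) * (M * T) ^ n))"
    let ?b = "\<lambda>n. case n of 0 \<Rightarrow> 0 | Suc m \<Rightarrow> ?c m"
    have qb: "norm (q n s) \<le> ?b n" if "s \<in> ball (0::real) T" for n s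
    proof (cases n)
      case (Suc m)
      have s: "\<bar>s\<bar> \<le> T" using that by simp
      have "norm (q n s) \<le> norm (B s) * norm (p m s)" unfolding q_def Suc by (simp add: norm_blinfun)
      also have "\<dots> \<le> M * (norm x0 * (M * \<bar>s\<bar>) ^ m / fact m)"
        by (intro mult_mono M s) (use M in auto)
      also have "\<dots> \<le> M * (norm x0 * (M * T) ^ m / fact m)"
        using s M(2) by (intro mult_left_mono divide_right_mono power_mono) auto
      finally show ?thesis by (simp add: Suc field_simps)
    qed (simp add: q_def)
    have "summable ?c" by (intro summable_mult summable_exp)
    then have "summable ?b" by (subst summable_Suc_iff[symmetric]) simp
    then have "uniform_limit (ball 0 T) (\<lambda>n s. \<Sum>i<n. q i s) (\<lambda>s. suminf (\<lambda>i. q i s)) sequentially"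
      by (intro Weierstrass_m_test[where M = ?b] qb)
    then have ul: "uniform_limit (ball (0::real) T) (\<lambda>n s. \<Sum>i<n. q i s) (\<lambda>s. B s (x s)) sequentially"
      by (simp add: sums_unique[OF sq, symmetric])
    have t: "t \<in> ball (0::real) T" by (simp add: T_def)
    have "\<exists>g. \<forall>s\<in>ball (0::real) T. (\<lambda>n. p n s) sums g s \<and>
        (g has_derivative (\<lambda>h. h *\<^sub>R B s (x s))) (at s within ball (0::real) T)"
    proof (rule has_derivative_series[where f' = "\<lambda>n s h. h *\<^sub>R q n s" and x = t])
      show "(p n has_derivative (\<lambda>h. h *\<^sub>R q n s)) (at s within ball (0::real) T)" for n s
        using pq[of n s] unfolding has_vector_derivative_def by (rule has_derivative_at_withinI)
      show "\<forall>\<^sub>F n in sequentially. \<forall>s\<in>ball (0::real) T. \<forall>h::real.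
          norm ((\<Sum>i<n. h *\<^sub>R q i s) - h *\<^sub>R B s (x s)) \<le> e * norm h" if "e > 0" for e
        using uniform_limitD[OF ul that]
      proof eventually_elim
        case (elim n)
        show ?case
        proof (intro ballI allI)
          fix s h :: real assume "s \<in> ball (0::real) T"
          then have "norm ((\<Sum>i<n. q i s) - B s (x s)) \<le> e"
            using elim by (auto simp: dist_norm less_imp_le)
          then have "norm h * norm ((\<Sum>i<n. q i s) - B s (x s)) \<le> norm h * e"
            by (intro mult_left_mono) auto
          then show "norm ((\<Sum>i<n. h *\<^sub>R q i s) - h *\<^sub>R B s (x s)) \<le> e * norm h"
            by (simp flip: scaleR_sum_right scaleR_diff_right add: mult.commute)
        qed
      qed
      show "(\<lambda>n. p n t) sums x t" unfolding x_def by (rule summable_sums[OF sp])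
    qed (use t in auto)
    then obtain g where g: "\<And>s. s \<in> ball (0::real) T \<Longrightarrow> (\<lambda>n. p n s) sums g s"
      "(g has_derivative (\<lambda>h. h *\<^sub>R B t (x t))) (at t within ball (0::real) T)" using t by blast
    have "(g has_vector_derivative B t (x t)) (at t)"
      using g(2) unfolding has_vector_derivative_def at_within_open[OF t open_ball] .
    then show ?thesis
      by (rule has_vector_derivative_transform_within_open[OF _ open_ball t])
         (use g(1) in \<open>auto simp: x_def sums_iff\<close>)
  qed
  moreover have "x 0 = x0"
  proof -
    have "p n 0 = (if n = 0 then x0 else 0)" for n
      by (cases n) (use pS in \<open>auto simp: p_def\<close>)
    then show ?thesis
      unfolding x_def using sums_unique[OF sums_single[of 0 "\<lambda>_. x0"]] by simp
  qed
  ultimately show ?thesis by blast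
qed

section \<open>The Lax pair of the quadratic Szego equation\<close>

text \<open>Maps from symbols to operators are linear on absolutely summable vectors and bounded by
  \<open>anorm\<close>, but need not be bounded in the \<open>ell2\<close> norm. Their derivative is
  therefore read off from difference quotients in the Wiener norm.\<close>

lemma has_vector_derivative_anorm:
  fixes G :: "ell2 \<Rightarrow> 'b::real_normed_vector"
  assumes u: "\<And>t. asum (u t)" and v: "asum v"
    and lim: "((\<lambda>h. anorm ((1 / h) *\<^sub>R (u (t + h) - u t) - v)) \<longlongrightarrow> 0) (at 0)"
    and G: "\<And>x y. asum x \<Longrightarrow> asum y \<Longrightarrow> G (x + y) = G x + G y"
      "\<And>r x. asum x \<Longrightarrow> G (r *\<^sub>R x) = r *\<^sub>R G x"
      "\<And>x. asum x \<Longrightarrow> norm (G x) \<le> anorm x"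
  shows "((\<lambda>t. G (u t)) has_vector_derivative G v) (at t)"
  unfolding has_vector_derivative_def has_derivative_at
proof (intro conjI)
  show "bounded_linear (\<lambda>x. x *\<^sub>R G v)" by (rule bounded_linear_scaleR_left)
  have sc: "asum (r *\<^sub>R x)" if "asum x" for r x
    using asum_cmul[OF that] by (simp add: scaleR_cmul)
  have df: "asum (x - y) \<and> G (x - y) = G x - G y" if "asum x" "asum y" for x y
    using G(1)[OF that(1) sc[OF that(2), of "-1"]] G(2)[OF that(2), of "-1"]
      asum_add[OF that(1) sc[OF that(2), of "-1"]] by simp
  have eq: "norm (G (u (t + h)) - G (u t) - h *\<^sub>R G v) / norm h
      = norm (G ((1 / h) *\<^sub>R (u (t + h) - u t) - v))" if "h \<noteq> 0" for h
  proof -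
    let ?y = "u (t + h) - u t"
    have "G ((1 / h) *\<^sub>R ?y - v) = (1 / h) *\<^sub>R G ?y - G v"
      using df[OF sc[OF conjunct1[OF df[OF u u]]] v] G(2)[OF conjunct1[OF df[OF u u]]] by metis
    also have "G ?y = G (u (t + h)) - G (u t)" using df[OF u u] by blast
    finally have "G ((1 / h) *\<^sub>R ?y - v) = (1 / h) *\<^sub>R (G (u (t + h)) - G (u t) - h *\<^sub>R G v)"
      using that by (simp add: scaleR_diff_right)
    then show ?thesis by (simp add: divide_inverse mult.commute)
  qed
  show "(\<lambda>h. norm (G (u (t + h)) - G (u t) - h *\<^sub>R G v) / norm h) \<midarrow>0\<rightarrow> 0"
  proof (rule Lim_null_comparison[OF _ lim])
    have "norm (norm (G (u (t + h)) - G (u t) - h *\<^sub>R G v) / norm h)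
      \<le> anorm ((1 / h) *\<^sub>R (u (t + h) - u t) - v)" if "h \<noteq> 0" for h
      using G(3)[OF conjunct1[OF df[OF sc[OF conjunct1[OF df[OF u u]]] v]]] eq[OF that] by simp
    then show "\<forall>\<^sub>F h in at 0. norm (norm (G (u (t + h)) - G (u t) - h *\<^sub>R G v) / norm h)
      \<le> anorm ((1 / h) *\<^sub>R (u (t + h) - u t) - v)"
      by (auto simp: eventually_at intro!: exI[of _ 1])
  qed
qed

lemma toep_add: "asum x \<Longrightarrow> asum y \<Longrightarrow> toep (x + y) = toep x + toep y"
  and toepS_add: "asum x \<Longrightarrow> asum y \<Longrightarrow> toepS (x + y) = toepS x + toepS y"
  and hank_add: "asum x \<Longrightarrow> asum y \<Longrightarrow> hank (x + y) = hank x + hank y"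
  using opsum_add[OF norm_shrL sn[of x] sn[of y]] opsum_add[OF norm_shlL snc[of x] snc[of y]]
    opsum_add[OF norm_flipL sn[of x] sn[of y]]
  by (simp_all add: toep_def toepS_def hank_def plus_ell2.rep_eq)

lemma toep_cmul_symbol: "asum x \<Longrightarrow> toep (c *\<^sub>c x) y = c *\<^sub>c toep x y"
  and toepS_cmul_symbol: "asum x \<Longrightarrow> toepS (c *\<^sub>c x) y = cnj c *\<^sub>c toepS x y"
  and hank_cmul_symbol: "asum x \<Longrightarrow> hank (c *\<^sub>c x) y = c *\<^sub>c hank x y"
  using opsum_cmul[OF norm_shrL sn[of x], where c=c] opsum_cmul[OF norm_shlL snc[of x], where c="cnj c"]
    opsum_cmul[OF norm_flipL sn[of x], where c=c]
  by (simp_all add: toep_def toepS_def hank_def cmulL.rep_eq cmul.rep_eq)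

lemma toep_scaleR_symbol: "asum x \<Longrightarrow> toep (r *\<^sub>R x) = r *\<^sub>R toep x"
  and toepS_scaleR_symbol: "asum x \<Longrightarrow> toepS (r *\<^sub>R x) = r *\<^sub>R toepS x"
  and hank_scaleR_symbol: "asum x \<Longrightarrow> hank (r *\<^sub>R x) = r *\<^sub>R hank x"
  by (auto intro!: blinfun_eqI simp: scaleR_cmul toep_cmul_symbol toepS_cmul_symbol hank_cmul_symbol
      blinfun.scaleR_left simp del: cmul_scaleR)

lemma kank_add: "asum x \<Longrightarrow> asum y \<Longrightarrow> kank (x + y) = kank x + kank y"
  and kank_scaleR_symbol: "asum x \<Longrightarrow> kank (r *\<^sub>R x) = r *\<^sub>R kank x"
  and kank_cmul_symbol: "asum x \<Longrightarrow> kank (c *\<^sub>c x) y = c *\<^sub>c kank x y"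
  by (simp_all add: kank_def hank_add asum_shl hank_scaleR_symbol hank_cmul_symbol)

lemma anorm_shl_le: "asum x \<Longrightarrow> anorm (shl x) \<le> anorm x"
  unfolding anorm_def asum_def using suminf_split_head[of "\<lambda>n. norm (coef x n)"] by simp

lemma norm_kank_le: "asum x \<Longrightarrow> norm (kank x) \<le> anorm (shl x)"
  unfolding kank_def by (intro norm_hank_le asum_shl)

lemma has_vector_derivative_const_imp_eq:
  fixes f :: "real \<Rightarrow> 'a::real_normed_vector"
  assumes "\<And>t. (f has_vector_derivative 0) (at t)"
  shows "f s = f t"
proof -
  obtain c where "\<And>x. f x = c"
    using has_vector_derivative_zero_constant[of UNIV f] assms by (auto intro: has_vector_derivative_at_within)
  then show ?thesis by simp
qed

text \<open>The equation in coordinates: \<open>toep\<close> of \<open>u t\<close> at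
  \<open>u t\<close> is the square of u, \<open>toepS\<close> is \<Pi>(|u|^2), and the pairing of
  the former with \<open>u t\<close> is J(u). The derivative is taken in the Wiener norm, which
  makes the operators with symbol \<open>u t\<close> differentiable in \<open>t\<close>.\<close>

locale szego_flow =
  fixes u u' :: "real \<Rightarrow> ell2"
  assumes asum_u: "asum (u t)" and asum_u': "asum (u' t)"
    and deriv: "((\<lambda>h. anorm ((1 / h) *\<^sub>R (u (t + h) - u t) - u' t)) \<longlongrightarrow> 0) (at 0)"
    and eq: "\<i> *\<^sub>c u' t = (2 * cinner (toep (u t) (u t)) (u t)) *\<^sub>c toepS (u t) (u t)
      + cnj (cinner (toep (u t) (u t)) (u t)) *\<^sub>c toep (u t) (u t)"
begin

definition J :: "real \<Rightarrow> complex" where "J t = cinner (toep (u t) (u t)) (u t)"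
definition w :: "real \<Rightarrow> ell2" where "w t = toepS (u t) (u t)"
definition K :: "real \<Rightarrow> ell2 \<Rightarrow>\<^sub>L ell2" where "K t = kank (u t)"
definition A :: "real \<Rightarrow> ell2 \<Rightarrow>\<^sub>L ell2" where
  "A t = (cmulL (J t) o\<^sub>L toepS (u t)) + (cmulL (cnj (J t)) o\<^sub>L toep (u t))"

lemma A_apply: "A t x = J t *\<^sub>c toepS (u t) x + cnj (J t) *\<^sub>c toep (u t) x"
  by (simp add: A_def blinfun.bilinear_simps cmulL.rep_eq)

lemma A_cmul [simp]: "A t (c *\<^sub>c x) = c *\<^sub>c A t x"
  by (simp add: A_apply asum_u cmul_distribs mult.commute)

lemma K_cmul [simp]: "K t (c *\<^sub>c x) = cnj c *\<^sub>c K t x"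
  by (simp add: K_def asum_u)

lemma cinner_A: "cinner (A t x) y = cinner x (A t y)"
  by (simp add: A_apply cinner_toep[OF asum_u] cinner_toepS[OF asum_u])

lemma cinner_K: "cinner (K t x) y = cinner (K t y) x"
  unfolding K_def by (rule cinner_kank[OF asum_u])

lemma cinner_K_K: "cinner (K t (K t x)) y = cinner x (K t (K t y))"
  unfolding K_def by (rule cinner_kank_kank[OF asum_u])

lemma J_eq: "J t = cinner (u t) (w t)"
  by (simp add: J_def w_def cinner_toep asum_u)

text \<open>The defect stems from the \<open>toep\<close> part of \<open>A\<close>. Its factor
  \<open>coef x 0\<close> is what later lets \<open>shl\<close> be propagated along vectors of zero
  mean.\<close>

lemma shl_A: "shl (A t x) = A t (shl x) + (cnj (J t) * coef x 0) *\<^sub>c shl (u t)"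
  by (simp add: A_apply toepS_shl[OF asum_u] shl_toep[OF asum_u] cmul_distribs)

text \<open>Half of the term 2J\<Pi>(|u|^2) is absorbed by \<open>A\<close>; the remaining half is
  the source through which \<beta> drives \<alpha>.\<close>

lemma u'_eq: "u' t = (- \<i>) *\<^sub>c (A t (u t) + J t *\<^sub>c w t)"
proof -
  have "u' t = (- \<i>) *\<^sub>c \<i> *\<^sub>c u' t" by simp
  also have "\<i> *\<^sub>c u' t = A t (u t) + J t *\<^sub>c w t"
    unfolding eq A_apply w_def J_def by (rule ell2_eqI) (simp add: algebra_simps)
  finally show ?thesis .
qed

lemma u_deriv: "(u has_vector_derivative (- \<i>) *\<^sub>c (A t (u t) + J t *\<^sub>c w t)) (at t)"
  using has_vector_derivative_anorm[OF asum_u asum_u' deriv, of "\<lambda>x. x"]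
  by (simp add: norm_le_anorm u'_eq)

lemma toep_deriv: "((\<lambda>t. toep (u t)) has_vector_derivative toep (u' t)) (at t)"
  by (rule has_vector_derivative_anorm[OF asum_u asum_u' deriv])
     (simp_all add: toep_add toep_scaleR_symbol norm_toep_le)

lemma toepS_deriv: "((\<lambda>t. toepS (u t)) has_vector_derivative toepS (u' t)) (at t)"
  by (rule has_vector_derivative_anorm[OF asum_u asum_u' deriv])
     (simp_all add: toepS_add toepS_scaleR_symbol norm_toepS_le)

lemma K_deriv: "(K has_vector_derivative kank (u' t)) (at t)"
  unfolding K_def
  by (rule has_vector_derivative_anorm[OF asum_u asum_u' deriv])
     (use norm_kank_le anorm_shl_le in \<open>auto simp: kank_add kank_scaleR_symbol intro: order_trans\<close>)

lemma blinfun_deriv: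
  assumes "(F has_vector_derivative F') (at t)" "(f has_vector_derivative f') (at t)"
  shows "((\<lambda>t. blinfun_apply (F t) (f t)) has_vector_derivative F t f' + F' (f t)) (at t)"
  using bounded_bilinear.has_vector_derivative[OF bounded_bilinear_blinfun_apply assms] .

lemma cinner_deriv:
  assumes "(f has_vector_derivative f') (at t)" "(g has_vector_derivative g') (at t)"
  shows "((\<lambda>t. cinner (f t) (g t)) has_vector_derivative cinner (f t) g' + cinner f' (g t)) (at t)"
  using bounded_bilinear.has_vector_derivative[OF bounded_bilinear_cinner assms] .

lemma continuous_on_J: "continuous_on UNIV J"
proof (rule continuous_on_vector_derivative)
  show "(J has_vector_derivative cinner (toep (u t) (u t)) ((- \<i>) *\<^sub>c (A t (u t) + J t *\<^sub>c w t)) +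
      cinner (toep (u t) ((- \<i>) *\<^sub>c (A t (u t) + J t *\<^sub>c w t)) + toep (u' t) (u t)) (u t)) (at t within UNIV)" for t
    unfolding J_def[abs_def]
    by (intro cinner_deriv blinfun_deriv toep_deriv u_deriv[unfolded J_def])
qed

lemma continuous_on_A: "continuous_on UNIV A"
  unfolding A_def[abs_def]
  by (intro continuous_intros bounded_linear.continuous_on[OF bounded_linear_cmulL]
      bounded_bilinear.continuous_on[OF bounded_bilinear_blinfun_compose] continuous_on_J
      bounded_linear.continuous_on[OF bounded_linear_cnj]
      continuous_on_vector_derivative[OF toepS_deriv] continuous_on_vector_derivative[OF toep_deriv])

text \<open>The Lax equation. The plus sign is a commutator in disguise: \<open>K t\<close> is
  antilinear, so moving the factor \<open>- \<i>\<close> through it changes its sign.\<close>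

lemma kank_u': "kank (u' t) x = (- \<i>) *\<^sub>c (A t (K t x) + K t (A t x))"
proof -
  have t1: "asum (toep (u t) (u t))" and t2: "asum (toepS (u t) (u t))"
    by (intro asum_toep asum_toepS asum_u)+
  have "u' t = (- \<i> * (2 * J t)) *\<^sub>c toepS (u t) (u t) + (- \<i> * cnj (J t)) *\<^sub>c toep (u t) (u t)"
    unfolding u'_eq w_def A_apply by (rule ell2_eqI) (simp add: algebra_simps)
  then have "kank (u' t) x = (- \<i> * (2 * J t)) *\<^sub>c kank (toepS (u t) (u t)) x
      + (- \<i> * cnj (J t)) *\<^sub>c kank (toep (u t) (u t)) x"
    by (simp only: kank_add asum_cmul t1 t2 kank_cmul_symbol blinfun.add_left)
  also have "(- \<i> * (2 * J t)) *\<^sub>c kank (toepS (u t) (u t)) x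
      = (- \<i> * J t) *\<^sub>c toepS (u t) (K t x) + (- \<i> * J t) *\<^sub>c K t (toep (u t) x)"
  proof -
    have "(- \<i> * (2 * J t)) *\<^sub>c z = (- \<i> * J t) *\<^sub>c z + (- \<i> * J t) *\<^sub>c z" for z
      by (rule ell2_eqI) simp
    also have "(- \<i> * J t) *\<^sub>c kank (toepS (u t) (u t)) x + (- \<i> * J t) *\<^sub>c kank (toepS (u t) (u t)) x
        = (- \<i> * J t) *\<^sub>c toepS (u t) (K t x) + (- \<i> * J t) *\<^sub>c K t (toep (u t) x)"
      unfolding K_def
      by (rule arg_cong2[where f = "(+)"])
        (use kank_toepS_self[OF asum_u, of t x] kank_toepS_self'[OF asum_u, of t x] in simp_all)
    finally show ?thesis .
  qed
  also have "kank (toep (u t) (u t)) x = toep (u t) (K t x) + K t (toepS (u t) x)"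
    by (simp add: kank_toep_self asum_u K_def)
  finally show ?thesis
    by (simp add: A_apply blinfun.bilinear_simps cmul_distribs)
qed

text \<open>The term \<open>toepS (w t) (u t)\<close> enters twice and contributes K^2 u and Q u
  with factor 2 each; the commutator identity \<open>toepS_toep\<close> takes back one K^2 u. This
  is the origin of the weights \<sigma>^2 and 2Q in the conserved quantity.\<close>

lemma w_deriv: "(w has_vector_derivative
    (- \<i>) *\<^sub>c A t (w t) + (\<i> * cnj (J t)) *\<^sub>c (K t (K t (u t)) + (2 * (norm (u t))\<^sup>2) *\<^sub>R u t)) (at t)"
proof -
  let ?u = "u t" and ?v = "toep (u t) (u t)"
  have v: "asum ?v" and w: "asum (w t)" unfolding w_def by (intro asum_toep asum_toepS asum_u)+
  have u': "u' t = (- \<i> * (2 * J t)) *\<^sub>c w t + (- \<i> * cnj (J t)) *\<^sub>c ?v"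
    unfolding u'_eq w_def A_apply by (rule ell2_eqI) (simp add: algebra_simps)
  have "(w has_vector_derivative toepS ?u (u' t) + toepS (u' t) ?u) (at t)"
    unfolding w_def[abs_def] using u_deriv[of t]
    by (intro blinfun_deriv toepS_deriv) (simp add: u'_eq w_def)
  moreover have "toepS (u' t) ?u = (\<i> * (2 * cnj (J t))) *\<^sub>c toepS (w t) ?u + (\<i> * J t) *\<^sub>c toepS ?v ?u"
    unfolding u' toepS_add[OF asum_cmul[OF w] asum_cmul[OF v]] blinfun.add_left
      toepS_cmul_symbol[OF w] toepS_cmul_symbol[OF v] by simp
  moreover have "toepS ?v ?u = toepS ?u (w t)"
    by (simp add: toepS_toep_self asum_u w_def)
  moreover have "toepS (w t) ?u = K t (K t ?u) + ((norm ?u)\<^sup>2) *\<^sub>R ?u"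
  proof -
    have "toepS (w t) ?u = hank ?u (hank ?u ?u)"
      using toepS_swap[OF asum_u w] by (simp add: w_def toepS_self asum_u)
    then show ?thesis by (simp add: hank_hank[OF asum_u] K_def cinner_self_norm scaleR_cmul)
  qed
  moreover have "toepS ?u ?v = toep ?u (w t) + K t (K t ?u)"
    using toepS_toep[OF asum_u, of t ?u] by (simp add: w_def K_def algebra_simps)
  ultimately show ?thesis
    by (simp add: u' A_apply blinfun.bilinear_simps asum_u)
      (elim back_subst[where P = "\<lambda>x. (w has_vector_derivative x) (at t)"],
       rule ell2_eqI, simp add: algebra_simps scaleR_conv_of_real)
qed

section \<open>The unitary propagator\<close>

definition lax :: "(real \<Rightarrow> ell2) \<Rightarrow> bool" where
  "lax f \<longleftrightarrow> (\<forall>t. (f has_vector_derivative (- \<i>) *\<^sub>c A t (f t)) (at t))"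

text \<open>Solutions are started at an arbitrary time \<open>s\<close>, which gives surjectivity of
  \<open>U t\<close>.\<close>

lemma lax_exists: "\<exists>f. f s = x \<and> lax f"
proof -
  have "\<exists>f. f 0 = x \<and> (\<forall>t. (f has_vector_derivative (cmulL (- \<i>) o\<^sub>L A (t + s)) (f t)) (at t))"
    by (intro linear_ode_exists bounded_bilinear.continuous_on[OF bounded_bilinear_blinfun_compose]
        continuous_on_const continuous_on_compose2[OF continuous_on_A] continuous_intros) auto
  then obtain f where f: "f 0 = x" "\<And>t. (f has_vector_derivative (- \<i>) *\<^sub>c A (t + s) (f t)) (at t)"
    by (auto simp: cmulL.rep_eq)
  have "((\<lambda>t. f (t - s)) has_vector_derivative (- \<i>) *\<^sub>c A t (f (t - s))) (at t)" for t
  proof -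
    have "((\<lambda>t. t - s) has_vector_derivative 1) (at t)"
      by (auto intro!: derivative_eq_intros)
    from vector_diff_chain_at[OF this f(2)[of "t - s"]] show ?thesis by (simp add: o_def)
  qed
  then show ?thesis using f(1) by (intro exI[of _ "\<lambda>t. f (t - s)"]) (simp add: lax_def)
qed

lemma lax_cinner: "lax f \<Longrightarrow> lax g \<Longrightarrow> cinner (f s) (g s) = cinner (f t) (g t)"
proof (rule has_vector_derivative_const_imp_eq[where f = "\<lambda>t. cinner (f t) (g t)"])
  fix t assume fg: "lax f" "lax g"
  show "((\<lambda>t. cinner (f t) (g t)) has_vector_derivative 0) (at t)"
    using cinner_deriv[OF fg[unfolded lax_def, rule_format]] by (simp add: cinner_A)
qed

lemma lax_norm: "lax f \<Longrightarrow> norm (f s) = norm (f t)"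
  using lax_cinner[of f f s t] by (simp add: cinner_self_norm del: of_real_power)

lemma lax_add: "lax f \<Longrightarrow> lax g \<Longrightarrow> lax (\<lambda>t. f t + g t)"
  unfolding lax_def
proof
  fix t assume fg: "\<forall>t. (f has_vector_derivative - \<i> *\<^sub>c A t (f t)) (at t)"
    "\<forall>t. (g has_vector_derivative - \<i> *\<^sub>c A t (g t)) (at t)"
  show "((\<lambda>t. f t + g t) has_vector_derivative - \<i> *\<^sub>c A t (f t + g t)) (at t)"
    using has_vector_derivative_add[OF fg(1)[rule_format, of t] fg(2)[rule_format, of t]]
    by (simp add: blinfun.add_right cmul_distribs)
qed

lemma lax_cmul: "lax f \<Longrightarrow> lax (\<lambda>t. c *\<^sub>c f t)"
  unfolding lax_def using bounded_linear.has_vector_derivative[OF cmul.bounded_linear_right]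
  by (fastforce simp: mult.commute)

text \<open>Uniqueness comes from conservation of the norm, applied to the difference of two
  solutions.\<close>

lemma lax_unique:
  assumes "lax f" "lax g" "f s = g s"
  shows "f t = g t"
proof -
  have "lax (\<lambda>t. f t + (-1) *\<^sub>c g t)" by (intro lax_add lax_cmul assms)
  from lax_norm[OF this, where s = s and t = t] show ?thesis by (simp add: assms(3))
qed

text \<open>By antilinearity the two terms with \<open>K t (A t (f t))\<close> cancel. Hence the
  propagator conjugates \<open>K 0\<close> into \<open>K t\<close>.\<close>

lemma lax_K:
  assumes "lax f" shows "lax (\<lambda>t. K t (f t))"
  unfolding lax_def
proof
  fix t
  show "((\<lambda>t. K t (f t)) has_vector_derivative (- \<i>) *\<^sub>c A t (K t (f t))) (at t)"
    using blinfun_deriv[OF K_deriv assms[unfolded lax_def, rule_format], of t]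
    by (simp add: kank_u' cmul_distribs blinfun.minus_right)
qed

definition U :: "real \<Rightarrow> ell2 \<Rightarrow> ell2" where "U t x = (SOME f. f 0 = x \<and> lax f) t"

lemma U_0 [simp]: "U 0 x = x" and lax_U: "lax (\<lambda>t. U t x)"
  using someI_ex[OF lax_exists[of 0 x]] by (simp_all add: U_def[abs_def])

lemma U_eqI: "lax f \<Longrightarrow> U t (f 0) = f t"
  by (rule lax_unique[OF lax_U, of f 0]) auto

lemma U_add: "U t (x + y) = U t x + U t y"
  using U_eqI[OF lax_add[OF lax_U lax_U]] by simp

lemma U_cmul: "U t (c *\<^sub>c x) = c *\<^sub>c U t x"
  using U_eqI[OF lax_cmul[OF lax_U]] by simp

lemma U_K: "U t (K 0 x) = K t (U t x)"
  using U_eqI[OF lax_K[OF lax_U]] by simp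

lemma cinner_U: "cinner (U t x) (U t y) = cinner x y"
  using lax_cinner[OF lax_U lax_U, where s = t and t = 0] by simp

lemma norm_U: "norm (U t x) = norm x"
  using lax_norm[OF lax_U, where s = t and t = 0] by simp

lemma U_surj: "\<exists>x. U t x = y"
  using lax_exists[of t y] U_eqI by metis

lemma norm_u_const: "norm (u s) = norm (u t)"
proof -
  have "cinner (u s) (u s) = cinner (u t) (u t)"
  proof (rule has_vector_derivative_const_imp_eq[where f = "\<lambda>t. cinner (u t) (u t)"])
    fix t
    have "cinner (w t) (u t) = cnj (J t)" by (subst cinner_commute) (simp add: J_eq)
    then show "((\<lambda>t. cinner (u t) (u t)) has_vector_derivative 0) (at t)"
      using cinner_deriv[OF u_deriv[of t] u_deriv[of t]] by (simp add: cinner_A J_eq[symmetric] algebra_simps)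
  qed
  then show ?thesis by (simp add: cinner_self_norm del: of_real_power)
qed

end

section \<open>Finite-dimensional subspaces\<close>

interpretation ell2c: vector_space "(*\<^sub>c)"
  by standard (simp_all add: cmul_distribs)

definition orthonormal :: "ell2 set \<Rightarrow> bool" where
  "orthonormal C \<longleftrightarrow> (\<forall>x\<in>C. \<forall>y\<in>C. cinner x y = (if x = y then 1 else 0))"

definition proj :: "ell2 set \<Rightarrow> ell2 \<Rightarrow> ell2" where
  "proj C x = (\<Sum>c\<in>C. cinner x c *\<^sub>c c)"

lemma proj_in_span: "proj C x \<in> ell2c.span C"
  unfolding proj_def by (intro ell2c.span_sum ell2c.span_scale ell2c.span_base)

lemma cinner_sum_left: "cinner (sum f S) y = (\<Sum>i\<in>S. cinner (f i) y)"
  by (rule cinner.sum_left)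

lemma cinner_proj_base:
  assumes "finite C" "orthonormal C" "c \<in> C"
  shows "cinner (proj C x) c = cinner x c"
proof -
  have "cinner (proj C x) c = (\<Sum>b\<in>C. cinner x b * cinner b c)"
    by (simp add: proj_def cinner_sum_left)
  also have "\<dots> = (\<Sum>b\<in>C. if b = c then cinner x c else 0)"
    using assms by (intro sum.cong) (auto simp: orthonormal_def)
  finally show ?thesis using assms by simp
qed

lemma cinner_span_eq_0:
  assumes "\<And>c. c \<in> C \<Longrightarrow> cinner x c = 0" "y \<in> ell2c.span C"
  shows "cinner x y = 0"
  using assms(2)
proof (induction rule: ell2c.span_induct)
  case base
  then show ?case by (auto simp: ell2c.subspace_def)
qed (rule assms(1))

lemma cinner_diff_proj:
  assumes "finite C" "orthonormal C" "y \<in> ell2c.span C"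
  shows "cinner (x - proj C x) y = 0"
  by (rule cinner_span_eq_0[OF _ assms(3)]) (simp add: cinner_proj_base assms)

lemma proj_eq:
  assumes "finite C" "orthonormal C" "x \<in> ell2c.span C"
  shows "proj C x = x"
proof -
  have "x - proj C x \<in> ell2c.span C" by (intro ell2c.span_diff assms proj_in_span)
  from cinner_diff_proj[OF assms(1,2) this, of x] have "norm (x - proj C x) = 0"
    unfolding cinner_self_norm by simp
  then show ?thesis by simp
qed

lemma orthonormal_insert_exists:
  assumes "finite C" "orthonormal C"
  shows "\<exists>D. finite D \<and> orthonormal D \<and> ell2c.span (insert a C) = ell2c.span D"
proof (cases "a \<in> ell2c.span C")
  case True
  then show ?thesis using assms ell2c.span_redundant by metis
next
  case False
  define r where "r = a - proj C a"
  have r0: "r \<noteq> 0" using False proj_in_span[of C a] by (auto simp: r_def)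
  define e where "e = of_real (1 / norm r) *\<^sub>c r"
  have orth: "cinner e c = 0" if "c \<in> C" for c
    using that by (simp add: e_def r_def cinner_proj_base assms)
  have "cinner e e = 1"
    using r0 by (simp add: e_def cinner_self_norm power2_eq_square norm_divide)
  then have "orthonormal (insert e C)"
    using assms(2) orth by (auto simp: orthonormal_def cinner_eq_0_commute[of _ e])
  moreover have "ell2c.span (insert a C) = ell2c.span (insert e C)"
  proof -
    have sub: "ell2c.span C \<subseteq> ell2c.span (insert e C)" "ell2c.span C \<subseteq> ell2c.span (insert a C)"
      by (intro ell2c.span_mono subset_insertI)+
    then have p: "proj C a \<in> ell2c.span (insert e C)" "proj C a \<in> ell2c.span (insert a C)"
      using proj_in_span by blast+
    have "of_real (norm r) *\<^sub>c e = r" using r0 by (simp add: e_def)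
    then have "a = of_real (norm r) *\<^sub>c e + proj C a" unfolding r_def by simp
    then have "a \<in> ell2c.span (insert e C)"
      using ell2c.span_add[OF ell2c.span_scale[OF ell2c.span_base[OF insertI1]] p(1)] by metis
    moreover have "e \<in> ell2c.span (insert a C)"
      unfolding e_def r_def
      by (intro ell2c.span_scale ell2c.span_diff p) (simp add: ell2c.span_base)
    ultimately show ?thesis
      unfolding ell2c.span_eq using sub ell2c.span_superset[of C] by blast
  qed
  ultimately show ?thesis using assms(1) by blast
qed

lemma orthonormal_basis_exists:
  assumes "finite B"
  shows "\<exists>C. finite C \<and> orthonormal C \<and> ell2c.span C = ell2c.span B"
  using assms
proof (induction B)
  case empty
  then show ?case by (intro exI[of _ "{}"]) (simp add: orthonormal_def)
next
  case (insert a B)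
  then obtain C where C: "finite C" "orthonormal C" "ell2c.span C = ell2c.span B" by blast
  obtain D where "finite D" "orthonormal D" "ell2c.span (insert a C) = ell2c.span D"
    using orthonormal_insert_exists[OF C(1,2)] by blast
  moreover have "ell2c.span (insert a C) = ell2c.span (insert a B)"
    using C(3) by (simp add: ell2c.span_insert)
  ultimately show ?case by metis
qed

lemma subspace_orthonormal_basis:
  assumes "ell2c.subspace V" "V \<subseteq> ell2c.span B" "finite B"
  shows "\<exists>C. finite C \<and> orthonormal C \<and> ell2c.span C = V"
proof -
  obtain B' where B': "B' \<subseteq> V" "\<not> ell2c.dependent B'" "V \<subseteq> ell2c.span B'"
    using ell2c.maximal_independent_subset by blast
  have "finite B'" using ell2c.independent_span_bound[OF assms(3) B'(2)] B' assms by auto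
  moreover have "ell2c.span B' = V"
    using B' ell2c.span_minimal[OF B'(1) assms(1)] by auto
  ultimately show ?thesis using orthonormal_basis_exists by metis
qed

lemma finite_bounded_subsequence:
  fixes f :: "'i \<Rightarrow> nat \<Rightarrow> complex"
  assumes "finite I" "\<And>i. i \<in> I \<Longrightarrow> bounded (range (f i))"
  shows "\<exists>r. strict_mono (r :: nat \<Rightarrow> nat) \<and> (\<forall>i\<in>I. convergent (f i \<circ> r))"
  using assms
proof (induction I)
  case empty
  then show ?case by (intro exI[of _ id]) (simp add: strict_mono_def)
next
  case (insert i I)
  then obtain r :: "nat \<Rightarrow> nat" where r: "strict_mono r" "\<forall>i\<in>I. convergent (f i \<circ> r)" by (metis insertI2)
  have "bounded (range (f i \<circ> r))"
    by (rule bounded_subset[OF insert.prems]) auto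
  then obtain l s where s: "strict_mono (s :: nat \<Rightarrow> nat)" "(f i \<circ> r \<circ> s) \<longlonglongrightarrow> l"
    using bounded_imp_convergent_subsequence by blast
  have "convergent (f j \<circ> (r \<circ> s))" if "j \<in> insert i I" for j
    using that s r convergent_subseq_convergent[of "f j \<circ> r" s]
    by (auto simp: convergent_def o_assoc)
  then show ?case using strict_mono_o[OF r(1) s(1)] by blast
qed

lemma span_bounded_subsequence:
  assumes C: "finite C" "orthonormal C" and x: "\<And>n. x n \<in> ell2c.span C" "\<And>n. norm (x n) \<le> b"
  shows "\<exists>r l. strict_mono (r :: nat \<Rightarrow> nat) \<and> (\<lambda>n. x (r n)) \<longlonglongrightarrow> l \<and> l \<in> ell2c.span C"
proof -
  have "norm (cinner (x n) c) \<le> b * norm c" for n c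
    by (rule order_trans[OF norm_cinner_le mult_right_mono[OF x(2)]]) auto
  then have "bounded (range (\<lambda>n. cinner (x n) c))" for c
    by (auto simp: bounded_iff)
  then obtain r where r: "strict_mono (r :: nat \<Rightarrow> nat)"
    "\<forall>c\<in>C. convergent ((\<lambda>n. cinner (x n) c) \<circ> r)"
    using finite_bounded_subsequence[OF C(1), of "\<lambda>c n. cinner (x n) c"] by blast
  then obtain l where l: "\<And>c. c \<in> C \<Longrightarrow> (\<lambda>n. cinner (x (r n)) c) \<longlonglongrightarrow> l c"
    unfolding convergent_def o_def by metis
  have "(\<lambda>n. proj C (x (r n))) \<longlonglongrightarrow> (\<Sum>c\<in>C. l c *\<^sub>c c)"
    unfolding proj_def by (intro tendsto_sum bounded_linear.tendsto[OF cmul.bounded_linear_left] l)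
  then have "(\<lambda>n. x (r n)) \<longlonglongrightarrow> (\<Sum>c\<in>C. l c *\<^sub>c c)"
    by (simp add: proj_eq[OF C x(1)])
  moreover have "(\<Sum>c\<in>C. l c *\<^sub>c c) \<in> ell2c.span C"
    by (intro ell2c.span_sum ell2c.span_scale ell2c.span_base)
  ultimately show ?thesis using r(1) by blast
qed

section \<open>Eigenvectors of linear maps on finite-dimensional subspaces\<close>

definition clinear_map :: "(ell2 \<Rightarrow> ell2) \<Rightarrow> bool" where
  "clinear_map T \<longleftrightarrow> (\<forall>x y. T (x + y) = T x + T y) \<and> (\<forall>c x. T (c *\<^sub>c x) = c *\<^sub>c T x)"

lemma clinear_mapD:
  assumes "clinear_map T"
  shows "T (x + y) = T x + T y" "T (c *\<^sub>c x) = c *\<^sub>c T x" "T 0 = 0" "T (- x) = - T x"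
    "T (x - y) = T x - T y"
proof -
  show a: "T (x + y) = T x + T y" and c: "T (c *\<^sub>c x) = c *\<^sub>c T x" for x y c
    using assms by (auto simp: clinear_map_def)
  show "T 0 = 0" using c[of 0 0] by simp
  show m: "T (- x) = - T x" for x using c[of "-1" x] by simp
  show "T (x - y) = T x - T y" using a[of x "- y"] m[of y] by simp
qed

lemma clinear_map_funpow: "clinear_map T \<Longrightarrow> clinear_map (T ^^ n)"
  by (induction n) (auto simp: clinear_map_def)

lemma clinear_map_sum: "clinear_map T \<Longrightarrow> T (sum f S) = (\<Sum>i\<in>S. T (f i))"
  by (induction S rule: infinite_finite_induct) (auto simp: clinear_mapD)

text \<open>The vector p(T) v, evaluated by Horner's scheme.\<close>

definition poly_apply :: "(ell2 \<Rightarrow> ell2) \<Rightarrow> complex poly \<Rightarrow> ell2 \<Rightarrow> ell2" where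
  "poly_apply T p v = fold_coeffs (\<lambda>a y. a *\<^sub>c v + T y) p 0"

lemma poly_apply_pCons:
  assumes "clinear_map T"
  shows "poly_apply T (pCons a p) v = a *\<^sub>c v + T (poly_apply T p v)"
  by (cases "a = 0 \<and> p = 0") (auto simp: poly_apply_def clinear_mapD[OF assms])

lemma poly_apply_0 [simp]: "poly_apply T 0 v = 0"
  by (simp add: poly_apply_def)

lemma poly_apply_add:
  assumes T: "clinear_map T"
  shows "poly_apply T (p + q) v = poly_apply T p v + poly_apply T q v"
  by (induction p q rule: poly_induct2)
    (simp_all add: poly_apply_pCons[OF T] clinear_mapD[OF T] cmul_distribs)

lemma poly_apply_smult:
  assumes T: "clinear_map T"
  shows "poly_apply T (smult c p) v = c *\<^sub>c poly_apply T p v"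
  by (induction p) (simp_all add: poly_apply_pCons[OF T] clinear_mapD[OF T] cmul_distribs)

lemma poly_apply_monom:
  assumes T: "clinear_map T"
  shows "poly_apply T (monom c n) v = c *\<^sub>c (T ^^ n) v"
  by (induction n) (simp_all add: monom_0 monom_Suc poly_apply_pCons[OF T] clinear_mapD[OF T])

lemma poly_apply_sum:
  assumes T: "clinear_map T"
  shows "poly_apply T (sum f S) v = (\<Sum>i\<in>S. poly_apply T (f i) v)"
  by (induction S rule: infinite_finite_induct) (simp_all add: poly_apply_add[OF T])

lemma annihilating_poly_exists:
  assumes T: "clinear_map T" and V: "\<And>x. x \<in> V \<Longrightarrow> T x \<in> V" "V \<subseteq> ell2c.span C" "finite C"
    and v: "v \<in> V"
  shows "\<exists>p. p \<noteq> 0 \<and> poly_apply T p v = 0"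
proof -
  define f where "f i = (T ^^ i) v" for i
  have f: "f i \<in> V" for i unfolding f_def by (induction i) (auto intro: V v)
  \<comment> \<open>Dependence is a notion for sets of vectors, so a repetition among the iterates
    is a separate case; otherwise there are \<open>card C + 1\<close> distinct ones.\<close>
  show ?thesis
  proof (cases "inj_on f {..card C}")
    case False
    then obtain i j where ij: "f i = f j" "i \<noteq> j" by (auto simp: inj_on_def)
    have "coeff (monom 1 i + monom (-1::complex) j) i = 1" using ij by simp
    then have "monom 1 i + monom (-1::complex) j \<noteq> 0" by (metis coeff_0 zero_neq_one)
    moreover have "poly_apply T (monom 1 i + monom (-1) j) v = 0"
      using ij by (simp add: poly_apply_add[OF T] poly_apply_monom[OF T] f_def)
    ultimately show ?thesis by blast
  next
    case True
    let ?S = "f ` {..card C}"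
    have "card ?S > card C" using True by (simp add: card_image)
    then have "ell2c.dependent ?S"
      using ell2c.independent_span_bound[OF V(3), of ?S] f V(2) by force
    then obtain g where g: "\<exists>x\<in>?S. g x \<noteq> 0" "(\<Sum>x\<in>?S. g x *\<^sub>c x) = 0"
      by (subst (asm) ell2c.dependent_finite) auto
    define p where "p = (\<Sum>i\<le>card C. monom (g (f i)) i)"
    have "poly_apply T p v = (\<Sum>i\<le>card C. g (f i) *\<^sub>c f i)"
      by (simp add: p_def poly_apply_sum[OF T] poly_apply_monom[OF T] f_def)
    also have "\<dots> = 0" using g(2) True by (simp add: sum.reindex)
    finally have "poly_apply T p v = 0" .
    moreover from g(1) obtain i where i: "i \<le> card C" "g (f i) \<noteq> 0" by auto
    have "coeff p i = g (f i)" using i by (simp add: p_def coeff_sum)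
    with i have "p \<noteq> 0" by auto
    ultimately show ?thesis by blast
  qed
qed

text \<open>An annihilating polynomial of \<open>v\<close> of least degree has a root
  \<open>a\<close>; the cofactor applied to \<open>v\<close> is nonzero by minimality and is an
  eigenvector for \<open>a\<close>.\<close>

lemma eigenvector_exists:
  assumes T: "clinear_map T" and V: "ell2c.subspace V" "\<And>x. x \<in> V \<Longrightarrow> T x \<in> V"
      "V \<subseteq> ell2c.span C" "finite C"
    and v: "v \<in> V" "v \<noteq> 0"
  shows "\<exists>h\<in>V. h \<noteq> 0 \<and> (\<exists>a. T h = a *\<^sub>c h)"
proof -
  define P where "P n \<longleftrightarrow> (\<exists>p. p \<noteq> 0 \<and> degree p = n \<and> poly_apply T p v = 0)" for n
  obtain p0 where "p0 \<noteq> 0" "poly_apply T p0 v = 0"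
    using annihilating_poly_exists[OF T V(2-4) v(1)] by blast
  then have "P (degree p0)" by (auto simp: P_def)
  define n where "n = (LEAST n. P n)"
  have "P n" unfolding n_def by (rule LeastI) fact
  then obtain p where p: "p \<noteq> 0" "degree p = n" "poly_apply T p v = 0" by (auto simp: P_def)
  have "n \<noteq> 0"
  proof
    assume "n = 0"
    then obtain c where c: "p = [:c:]" using p(2) degree_eq_zeroE by blast
    then have "c *\<^sub>c v = 0" using p(3) by (simp add: poly_apply_pCons[OF T] clinear_mapD[OF T])
    then have "norm c * norm v = 0" by (metis norm_cmul norm_zero)
    then show False using p(1) v(2) c by simp
  qed
  then have "\<not> constant (poly p)" using p(2) by (simp add: constant_degree)
  then obtain a where "poly p a = 0" using fundamental_theorem_of_algebra by blast
  then obtain q where q: "p = [:- a, 1:] * q" by (metis dvdE poly_eq_0_iff_dvd)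
  have pq: "p = pCons 0 q + smult (- a) q" by (simp add: q)
  have q0: "q \<noteq> 0" using p(1) q by auto
  then have "degree q < n" using p(2) degree_mult_eq[of "[:- a, 1:]" q] by (simp add: q)
  then have "\<not> P (degree q)" unfolding n_def by (rule not_less_Least)
  then have nz: "poly_apply T q v \<noteq> 0" using q0 by (auto simp: P_def)
  have "T (poly_apply T q v) = a *\<^sub>c poly_apply T q v"
    using p(3) unfolding pq poly_apply_add[OF T] poly_apply_pCons[OF T] poly_apply_smult[OF T] by simp
  moreover have "poly_apply T q v \<in> V"
    by (induction q)
      (auto simp: poly_apply_pCons[OF T] intro!: V(2) ell2c.subspace_add[OF V(1)]
        ell2c.subspace_scale[OF V(1)] ell2c.subspace_0[OF V(1)] v(1))
  ultimately show ?thesis using nz by blast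
qed

text \<open>The norm defect of a contraction is a nonnegative quadratic form, and by the
  parallelogram law its zeros form a subspace.\<close>

lemma norm_defect_subspace:
  assumes M: "clinear_map M" and W: "ell2c.subspace W" "\<And>x. x \<in> W \<Longrightarrow> norm (M x) \<le> norm x"
  shows "ell2c.subspace {x \<in> W. norm (M x) = norm x}"
proof (rule ell2c.subspaceI)
  show "0 \<in> {x \<in> W. norm (M x) = norm x}"
    using ell2c.subspace_0[OF W(1)] by (simp add: clinear_mapD[OF M])
next
  fix c x assume "x \<in> {x \<in> W. norm (M x) = norm x}"
  then show "c *\<^sub>c x \<in> {x \<in> W. norm (M x) = norm x}"
    using ell2c.subspace_scale[OF W(1)] by (simp add: clinear_mapD[OF M])
next
  fix x y assume x: "x \<in> {x \<in> W. norm (M x) = norm x}" and y: "y \<in> {x \<in> W. norm (M x) = norm x}"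
  have par: "(norm (a + b))\<^sup>2 + (norm (a - b))\<^sup>2 = 2 * (norm a)\<^sup>2 + 2 * (norm b)\<^sup>2" for a b :: ell2
    by (simp add: power2_norm_eq_inner inner_add_left inner_add_right inner_diff_left inner_diff_right)
  have in_W: "x + y \<in> W" "x - y \<in> W"
    using x y ell2c.subspace_add[OF W(1)] ell2c.subspace_diff[OF W(1)] by auto
  have "(norm (M (x - y)))\<^sup>2 \<le> (norm (x - y))\<^sup>2" using W(2)[OF in_W(2)] by (intro power_mono) auto
  moreover have "(norm (M (x + y)))\<^sup>2 \<le> (norm (x + y))\<^sup>2" using W(2)[OF in_W(1)] by (intro power_mono) auto
  moreover have "(norm (M (x + y)))\<^sup>2 + (norm (M (x - y)))\<^sup>2 = (norm (x + y))\<^sup>2 + (norm (x - y))\<^sup>2"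
    using par[of "M x" "M y"] par[of x y] x y by (simp add: clinear_mapD[OF M])
  ultimately have "(norm (M (x + y)))\<^sup>2 = (norm (x + y))\<^sup>2" by linarith
  then show "x + y \<in> {x \<in> W. norm (M x) = norm x}" using in_W by simp
qed

text \<open>By finite dimension the contractions converge along a subsequence to a contraction
  \<open>N\<close>. Vectors whose n-th iterate under \<open>M n\<close> stays above 1/2 yield an
  orbit of \<open>N\<close> that does not tend to 0, and a limit point of this orbit keeps its norm
  under all powers of \<open>N\<close>. Such vectors form an invariant subspace, on which every
  eigenvalue is unimodular.\<close>

lemma contraction_sequence_eigenvector:
  fixes M :: "nat \<Rightarrow> ell2 \<Rightarrow> ell2"
  assumes C: "finite C" "orthonormal C"
    and M: "\<And>n. clinear_map (M n)" "\<And>n x. x \<in> ell2c.span C \<Longrightarrow> M n x \<in> ell2c.span C"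
      "\<And>n x. norm (M n x) \<le> norm x"
    and large: "\<And>n. \<exists>x\<in>ell2c.span C. norm x \<le> 1 \<and> norm ((M n ^^ n) x) > 1/2"
  shows "\<exists>r a h. strict_mono (r :: nat \<Rightarrow> nat) \<and> norm a = 1 \<and> h \<in> ell2c.span C \<and> h \<noteq> 0
    \<and> (\<lambda>n. M (r n) h) \<longlonglongrightarrow> a *\<^sub>c h"
proof -
  let ?W = "ell2c.span C"
  obtain x where x: "\<And>n. x n \<in> ?W" "\<And>n. norm (x n) \<le> 1" "\<And>n. norm ((M n ^^ n) (x n)) > 1/2"
    using large by metis
  obtain r1 x0 where r1: "strict_mono (r1 :: nat \<Rightarrow> nat)" "(\<lambda>n. x (r1 n)) \<longlonglongrightarrow> x0" "x0 \<in> ?W"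
    using span_bounded_subsequence[OF C, of x 1, OF x(1,2)] by blast
  have "norm (cinner (M (r1 n) c) c') \<le> norm c * norm c'" for n c c'
    by (rule order_trans[OF norm_cinner_le mult_right_mono[OF M(3)]]) auto
  then have "bounded (range (\<lambda>n. cinner (M (r1 n) c) c'))" for c c'
    by (auto simp: bounded_iff)
  \<comment> \<open>Convergence of finitely many matrix entries is convergence of the operators on
    the span.\<close>
  then obtain r2 where r2: "strict_mono (r2 :: nat \<Rightarrow> nat)"
    "\<forall>p\<in>C \<times> C. convergent ((\<lambda>n. cinner (M (r1 n) (fst p)) (snd p)) \<circ> r2)"
    using finite_bounded_subsequence[of "C \<times> C" "\<lambda>p n. cinner (M (r1 n) (fst p)) (snd p)"] C(1) by auto
  define r where "r = r1 \<circ> r2"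
  have r: "strict_mono r" unfolding r_def by (intro strict_mono_o r1 r2)
  from r2(2) obtain m where m: "\<And>c c'. c \<in> C \<Longrightarrow> c' \<in> C \<Longrightarrow> (\<lambda>n. cinner (M (r n) c) c') \<longlonglongrightarrow> m (c, c')"
    unfolding convergent_def o_def r_def by (fastforce dest!: bchoice)
  have x0: "(\<lambda>n. x (r n)) \<longlonglongrightarrow> x0"
    using LIMSEQ_subseq_LIMSEQ[OF r1(2) r2(1)] by (simp add: r_def o_def)
  define d where "d c = (\<Sum>c'\<in>C. m (c, c') *\<^sub>c c')" for c
  define N where "N y = (\<Sum>c\<in>C. cinner y c *\<^sub>c d c)" for y
  have N: "clinear_map N"
    unfolding clinear_map_def N_def
    by (simp add: cmul_distribs sum.distrib ell2c.scale_sum_right)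
  have N_in: "N y \<in> ?W" for y
    unfolding N_def d_def by (intro ell2c.span_sum ell2c.span_scale ell2c.span_base)
  have lim_c: "(\<lambda>n. M (r n) c) \<longlonglongrightarrow> d c" if "c \<in> C" for c
  proof -
    have "(\<lambda>n. proj C (M (r n) c)) \<longlonglongrightarrow> d c"
      unfolding proj_def d_def
      by (intro tendsto_sum bounded_linear.tendsto[OF cmul.bounded_linear_left] m that)
    then show ?thesis by (simp add: proj_eq[OF C M(2)] ell2c.span_base that)
  qed
  have lim: "(\<lambda>n. M (r n) y) \<longlonglongrightarrow> N y" if "y \<in> ?W" for y
  proof -
    have "(\<lambda>n. \<Sum>c\<in>C. cinner y c *\<^sub>c M (r n) c) \<longlonglongrightarrow> N y"
      unfolding N_def by (intro tendsto_sum bounded_linear.tendsto[OF cmul.bounded_linear_right] lim_c)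
    moreover have "M (r n) y = (\<Sum>c\<in>C. cinner y c *\<^sub>c M (r n) c)" for n
      by (subst proj_eq[OF C that, symmetric])
        (simp add: proj_def clinear_map_sum[OF M(1)] clinear_mapD[OF M(1)])
    ultimately show ?thesis by simp
  qed
  have N_le: "norm (N y) \<le> norm y" if "y \<in> ?W" for y
    by (rule LIMSEQ_le_const2[OF tendsto_norm[OF lim[OF that]]]) (use M(3) in auto)
  have lim_seq: "(\<lambda>n. M (r n) (y n)) \<longlonglongrightarrow> N y0"
    if "(\<lambda>n. y n) \<longlonglongrightarrow> y0" "y0 \<in> ?W" for y y0
  proof -
    have "(\<lambda>n. M (r n) (y n - y0)) \<longlonglongrightarrow> 0"
      by (rule Lim_null_comparison[OF _ tendsto_norm_zero[OF LIM_zero[OF that(1)]]])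
        (use M(3) in auto)
    from tendsto_add[OF this lim[OF that(2)]] show ?thesis
      by (simp add: clinear_mapD[OF M(1)])
  qed
  have Npow_in: "(N ^^ j) y \<in> ?W" if "y \<in> ?W" for j y
    using that by (cases j) (auto intro: N_in)
  have Npow_le: "norm ((N ^^ j) y) \<le> norm y" if "y \<in> ?W" for j y
    by (induction j) (auto intro: order_trans[OF N_le[OF Npow_in[OF that]]])
  have lim_pow: "(\<lambda>n. (M (r n) ^^ j) (x (r n))) \<longlonglongrightarrow> (N ^^ j) x0" for j
  proof (induction j)
    case (Suc j)
    from lim_seq[OF Suc Npow_in[OF r1(3)]] show ?case by simp
  qed (simp add: x0)
  have Mpow_le: "norm ((M n ^^ (j + i)) y) \<le> norm ((M n ^^ i) y)" for n i j y
    by (induction j) (auto intro: order_trans[OF M(3)])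
  \<comment> \<open>For fixed \<open>j\<close> the exponent \<open>r n\<close> eventually exceeds
    \<open>j\<close>, and the further iterates of a contraction can only shrink the
    \<open>j\<close>-th one.\<close>
  have half: "1/2 \<le> norm ((N ^^ j) x0)" for j
  proof (rule LIMSEQ_le_const[OF tendsto_norm[OF lim_pow]])
    have "1/2 \<le> norm ((M (r n) ^^ j) (x (r n)))" if "j \<le> n" for n
    proof -
      have "j \<le> r n" using that seq_suble[OF r, of n] by simp
      then have "norm ((M (r n) ^^ (r n)) (x (r n))) \<le> norm ((M (r n) ^^ j) (x (r n)))"
        using Mpow_le[where j = "r n - j" and i = j] by simp
      then show ?thesis using x(3)[of "r n"] by simp
    qed
    then show "\<exists>K. \<forall>n\<ge>K. 1/2 \<le> norm ((M (r n) ^^ j) (x (r n)))" by blast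
  qed
  have "decseq (\<lambda>j. norm ((N ^^ j) x0))"
    by (rule decseq_SucI) (use N_le Npow_in r1(3) in auto)
  then obtain l where l: "(\<lambda>j. norm ((N ^^ j) x0)) \<longlonglongrightarrow> l"
    using decseq_convergent[of _ 0] by (metis norm_ge_zero)
  have "1/2 \<le> l" by (rule LIMSEQ_le_const[OF l]) (use half in auto)
  \<comment> \<open>The orbit norms decrease to \<open>l\<close>, so a limit point of the orbit has
    norm \<open>l\<close>, and so have all its iterates.\<close>
  obtain s g where s: "strict_mono (s :: nat \<Rightarrow> nat)" "(\<lambda>n. (N ^^ (s n)) x0) \<longlonglongrightarrow> g" "g \<in> ?W"
    using span_bounded_subsequence[OF C, of "\<lambda>n. (N ^^ n) x0" "norm x0"] Npow_in Npow_le r1(3) by blast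
  have norm_g: "norm ((N ^^ k) g) = l" for k
  proof (rule LIMSEQ_unique)
    have "(\<lambda>n. (N ^^ k) ((N ^^ (s n)) x0 - g)) \<longlonglongrightarrow> 0"
      by (rule Lim_null_comparison[OF _ tendsto_norm_zero[OF LIM_zero[OF s(2)]]])
        (use Npow_le ell2c.span_diff[OF Npow_in[OF r1(3)] s(3)] in auto)
    from tendsto_add[OF this tendsto_const[of "(N ^^ k) g"]]
    show "(\<lambda>n. norm ((N ^^ k) ((N ^^ (s n)) x0))) \<longlonglongrightarrow> norm ((N ^^ k) g)"
      by (intro tendsto_norm) (simp add: clinear_mapD[OF clinear_map_funpow[OF N]])
    have "strict_mono (\<lambda>n. k + s n)" using s(1) by (auto simp: strict_mono_def)
    from LIMSEQ_subseq_LIMSEQ[OF l this]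
    show "(\<lambda>n. norm ((N ^^ k) ((N ^^ (s n)) x0))) \<longlonglongrightarrow> l" by (simp add: o_def funpow_add)
  qed
  let ?G = "{y \<in> ?W. \<forall>k. norm ((N ^^ k) y) = norm y}"
  have G: "?G = \<Inter> (range (\<lambda>k. {y \<in> ?W. norm ((N ^^ k) y) = norm y}))" by auto
  have "ell2c.subspace ?G"
    unfolding G by (intro ell2c.subspace_Inter ballI)
      (auto intro!: norm_defect_subspace clinear_map_funpow N Npow_le)
  moreover have "N y \<in> ?G" if "y \<in> ?G" for y
  proof -
    have "norm ((N ^^ k) (N y)) = norm (N y)" for k
    proof -
      have "norm ((N ^^ Suc k) y) = norm y" "norm ((N ^^ Suc 0) y) = norm y" using that by blast+
      then show ?thesis by (simp add: funpow_swap1)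
    qed
    then show ?thesis using N_in by simp
  qed
  moreover have "g \<in> ?G" using s(3) norm_g norm_g[of 0] by simp
  moreover have "g \<noteq> 0" using norm_g[of 0] \<open>1/2 \<le> l\<close> by auto
  ultimately obtain h a where h: "h \<in> ?G" "h \<noteq> 0" "N h = a *\<^sub>c h"
    using eigenvector_exists[OF N, of ?G C g] C(1) by blast
  have "norm ((N ^^ 1) h) = norm h" using h(1) by blast
  then have "norm (N h) = norm h" by simp
  then have "norm a = 1" using h by simp
  then show ?thesis using r h lim[of h] by (metis (mono_tags, lifting) mem_Collect_eq)
qed

section \<open>Eigenspaces of the squared shifted Hankel operator\<close>

text \<open>By symmetry of the Hankel operator, the pairing with \<Pi>(|u|^2) involves
  \<open>h\<close> through its mean and \<open>shl h\<close> alone, the two things under control for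
  an approximate eigenvector of \<open>shl\<close>.\<close>

lemma cinner_w:
  assumes u: "asum u"
  shows "cinner (toepS u u) h = cnj (coef h 0) * of_real ((norm u)\<^sup>2) + cinner (kank u (shl h)) u"
proof -
  have "cinner (toepS u u) h = cinner (hank u h) u"
    by (simp only: toepS_self[OF u] cinner_hank[OF u, of u])
  then show ?thesis by (simp add: hank_eq[OF u, of h] cinner_self_norm)
qed

context
  fixes u :: ell2 and \<mu> :: real
  assumes u: "asum u" and \<mu>: "\<mu> \<noteq> 0"
begin

abbreviation "eig \<equiv> {h. kank u (kank u h) = of_real \<mu> *\<^sub>c h}"

lemma eig_add: "h \<in> eig \<Longrightarrow> k \<in> eig \<Longrightarrow> a *\<^sub>c h + b *\<^sub>c k \<in> eig"
  by (simp add: blinfun.add_right u cmul_distribs mult.commute)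

lemma eig_kank: "h \<in> eig \<Longrightarrow> kank u h \<in> eig"
  by (simp add: u)

text \<open>Pairing \<open>kank_kank_shl\<close> with \<open>kank u c\<close> eliminates the squares
  of K_u by selfadjointness; what is left is the product of \<open>coef h 0\<close>, \<mu> and
  \<open>cinner c u\<close>.\<close>

lemma eig_coef_0_aux:
  assumes h: "h \<in> eig" "cinner h u = 0" and c: "c \<in> eig" "cinner c u \<noteq> 0"
  shows "coef h 0 = 0"
proof -
  have "cinner (kank u (kank u (shl h))) (kank u c)
      = of_real \<mu> * cinner (shl h) (kank u c) - coef h 0 * cinner (kank u u) (kank u c)"
    using h by (simp add: kank_kank_shl[OF u])
  moreover have "cinner (kank u (kank u (shl h))) (kank u c) = of_real \<mu> * cinner (shl h) (kank u c)"
    unfolding cinner_kank_kank[OF u] using eig_kank[OF c(1)] by simp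
  moreover have "cinner (kank u u) (kank u c) = of_real \<mu> * cinner c u"
    using cinner_kank[OF u, of u "kank u c"] c(1) by simp
  ultimately show ?thesis using c(2) \<mu> by simp
qed

lemma eig_shl:
  assumes "h \<in> eig" "cinner h u = 0" "coef h 0 = 0"
  shows "shl h \<in> eig"
  using assms by (simp add: kank_kank_shl[OF u])

text \<open>For such \<open>y\<close> the vector \<open>g\<close> is both the image of
  \<open>y\<close> under H_u and an element of the eigenspace. The squares of H_u and K_u then agree
  on \<open>g\<close>, so their rank one difference forces \<open>cinner g u = 0\<close>; by
  \<open>cinner_w\<close> this is the pairing of \<open>y\<close> with \<Pi>(|u|^2), up to
  conjugation.\<close>

lemma eig_orth_w:
  assumes y: "y \<in> eig" "cinner y u = 0" and c: "c \<in> eig" "cinner c u \<noteq> 0"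
  shows "cinner y (toepS u u) = 0"
proof -
  have y0: "coef y 0 = 0" by (rule eig_coef_0_aux[OF assms])
  define g where "g = kank u (shl y)"
  have g: "g \<in> eig" unfolding g_def by (rule eig_kank[OF eig_shl[OF y y0]])
  have hy: "hank u y = g" by (simp add: hank_eq[OF u, of y] y0 g_def)
  have "hank u g = of_real \<mu> *\<^sub>c y"
    using hank_hank[OF u, of y] y by (simp add: hy)
  then have "hank u (hank u g) = of_real \<mu> *\<^sub>c g" by (simp add: u hy)
  then have "cinner g u *\<^sub>c u = 0" using hank_hank[OF u, of g] g by simp
  then have "norm (cinner g u) * norm u = 0" by (metis norm_cmul norm_zero)
  moreover have "u \<noteq> 0" using c(2) by auto
  ultimately have "cinner g u = 0" by simp
  then have "cinner (toepS u u) y = 0" by (simp add: cinner_w[OF u] y0 flip: g_def)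
  then show ?thesis by (simp add: cinner_eq_0_commute)
qed

text \<open>Parallelism of the projections of \<open>u\<close> and \<Pi>(|u|^2) in determinant form:
  \<open>eig_orth_w\<close> is applied to the combination of \<open>h\<close> and \<open>c\<close>
  that is orthogonal to \<open>u\<close>.\<close>

lemma eig_wedge:
  assumes h: "h \<in> eig" and c: "c \<in> eig"
  shows "cinner h u * cinner c (toepS u u) = cinner c u * cinner h (toepS u u)"
proof (cases "cinner h u = 0 \<and> cinner c u = 0")
  case False
  define y where "y = cinner c u *\<^sub>c h + (- cinner h u) *\<^sub>c c"
  have "y \<in> eig" unfolding y_def by (intro eig_add h c)
  moreover have "cinner y u = 0" by (simp add: y_def)
  ultimately have "cinner y (toepS u u) = 0"
    using False eig_orth_w[of y h] eig_orth_w[of y c] h c by blast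
  then show ?thesis by (simp add: y_def)
qed simp

text \<open>If the whole eigenspace is orthogonal to \<open>u\<close>, then
  \<open>eig_coef_0_aux\<close> says nothing. In that case a combination \<open>y\<close> of
  \<open>h\<close> and the witness \<open>x\<close> with zero mean stays in the eigenspace under
  \<open>shl\<close> and \<open>kank\<close>, which makes it orthogonal to \<Pi>(|u|^2), while
  \<open>x\<close> is not.\<close>

lemma eig_coef_0:
  assumes h: "h \<in> eig" "cinner h u = 0" "cinner h (toepS u u) = 0"
    and x: "x \<in> eig" "cinner x u \<noteq> 0 \<or> cinner x (toepS u u) \<noteq> 0"
  shows "coef h 0 = 0"
proof (cases "\<exists>c\<in>eig. cinner c u \<noteq> 0")
  case True
  then show ?thesis using eig_coef_0_aux[OF h(1,2)] by blast
next
  case False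
  define y where "y = coef x 0 *\<^sub>c h + (- coef h 0) *\<^sub>c x"
  have y: "y \<in> eig" unfolding y_def by (intro eig_add h x)
  have yu: "cinner y u = 0" using False y by blast
  have y0: "coef y 0 = 0" by (simp add: y_def)
  have "cinner (kank u (shl y)) u = 0"
    using False eig_kank[OF eig_shl[OF y yu y0]] by blast
  then have "cinner (toepS u u) y = 0" by (simp add: cinner_w[OF u] y0)
  then have "cinner y (toepS u u) = 0" by (simp add: cinner_eq_0_commute)
  then have "coef h 0 * cinner x (toepS u u) = 0" using h(3) by (simp add: y_def)
  then show ?thesis using x False by auto
qed

end

section \<open>Boundedness and unboundedness of trajectories\<close>

lemma shl_hank_shl: "asum v \<Longrightarrow> hank (shl v) x = shl (hank v x)"
  using hank_shr_kank[of v x] hank_shr[of v x] by (simp add: kank_def)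

lemma shl_pow_hank: "asum v \<Longrightarrow> (shl ^^ n) (hank v x) = hank ((shl ^^ n) v) x"
  by (induction n) (simp_all add: shl_hank_shl asum_shl_pow)

section \<open>Decay under the backward shift\<close>

context szego_flow
begin

text \<open>No Sobolev exponent occurs here; this is what links boundedness in one space
  \<open>Hs_plus s\<close> to boundedness in the others.\<close>

definition uniform_decay :: "nat \<Rightarrow> real \<Rightarrow> bool" where
  "uniform_decay p t \<longleftrightarrow> (\<forall>h\<in>range (K t). norm ((shl ^^ p) h) \<le> norm h / 2)"

lemma shl_range_K: "h \<in> range (K t) \<Longrightarrow> shl h \<in> range (K t)"
proof (erule rangeE)
  fix x assume "h = K t x"
  then have "shl h = K t (shr x)" by (simp add: K_def kank_shr asum_u)
  then show ?thesis by (rule range_eqI)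
qed

lemma shl_pow_range_K: "h \<in> range (K t) \<Longrightarrow> (shl ^^ n) h \<in> range (K t)"
  by (induction n) (auto intro: shl_range_K)

lemma shl_u_range: "shl (u t) \<in> range (K t)"
  by (rule range_eqI[of _ _ "basis 0"]) (simp add: K_def asum_u)

text \<open>\<open>shl (u t)\<close> lies in the shift invariant space \<open>range (K t)\<close>,
  so the halving can be iterated \<open>n div p\<close> times. The zeroth coefficient of
  \<open>u t\<close> is not reached in this way, hence the index \<open>Suc n\<close>.\<close>

lemma coef_u_decay:
  assumes "uniform_decay p t" "0 < p"
  shows "norm (coef (u t) (Suc n)) \<le> (1/2) ^ (n div p) * norm (u t)"
proof -
  have pow: "norm ((shl ^^ (p * k)) h) \<le> (1/2) ^ k * norm h" if "h \<in> range (K t)" for h k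
  proof (induction k)
    case (Suc k)
    have "norm ((shl ^^ (p * Suc k)) h) = norm ((shl ^^ p) ((shl ^^ (p * k)) h))"
      by (simp add: funpow_add)
    also have "\<dots> \<le> norm ((shl ^^ (p * k)) h) / 2"
      using assms(1)[unfolded uniform_decay_def] shl_pow_range_K[OF that] by blast
    finally show ?case using Suc by simp
  qed simp
  have "norm (coef (u t) (Suc n)) = norm (coef ((shl ^^ (n mod p)) ((shl ^^ (p * (n div p))) (shl (u t)))) 0)"
    by (simp add: add.commute)
  also have "\<dots> \<le> norm ((shl ^^ (p * (n div p))) (shl (u t)))"
    by (rule order_trans[OF norm_coef_le norm_shl_pow_le])
  also have "\<dots> \<le> (1/2) ^ (n div p) * norm (shl (u t))" by (rule pow[OF shl_u_range])
  also have "\<dots> \<le> (1/2) ^ (n div p) * norm (u t)" by (intro mult_left_mono norm_shl_le) auto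
  finally show ?thesis .
qed

lemma U_inj: "U t x = U t y \<Longrightarrow> x = y"
proof -
  assume "U t x = U t y"
  then have "U t (x + (-1) *\<^sub>c y) = 0" by (simp only: U_add U_cmul) simp
  then show ?thesis using norm_U[of t "x + (-1) *\<^sub>c y"] by simp
qed

lemma norm_K_le: "norm (K t y) \<le> norm (K 0) * norm y"
  by (metis U_K U_surj norm_U norm_blinfun)

lemma subspace_range_K: "ell2c.subspace (range (K t))"
proof (rule ell2c.subspaceI)
  show "0 \<in> range (K t)" using blinfun.zero_right[of "K t"] by (rule range_eqI[OF sym])
  show "x + y \<in> range (K t)" if xy: "x \<in> range (K t)" "y \<in> range (K t)" for x y
  proof -
    obtain a b where "x = K t a" "y = K t b" using xy by blast
    then have "x + y = K t (a + b)" by (simp add: blinfun.add_right)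
    then show ?thesis by (rule range_eqI)
  qed
  show "c *\<^sub>c x \<in> range (K t)" if x: "x \<in> range (K t)" for c x
  proof -
    obtain y where "x = K t y" using x by blast
    then have "c *\<^sub>c x = K t (cnj c *\<^sub>c y)" by simp
    then show ?thesis by (rule range_eqI)
  qed
qed

end

locale finite_rank_flow = szego_flow +
  fixes B :: "ell2 set"
  assumes finite_B: "finite B" and range_K0: "range (K 0) \<subseteq> ell2c.span B"
begin

lemma basis_range_K0: "\<exists>C. finite C \<and> orthonormal C \<and> ell2c.span C = range (K 0)"
  by (rule subspace_orthonormal_basis[OF subspace_range_K range_K0 finite_B])

text \<open>\<open>K 0\<close> has a bounded right inverse on its finite-dimensional range, and
  unitary conjugation carries it to every \<open>t\<close> with the same constant.\<close>

lemma bounded_preimages: "\<exists>D\<ge>0. \<forall>t. \<forall>h\<in>range (K t). \<exists>g. h = K t g \<and> norm g \<le> D * norm h"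
proof -
  obtain C where C: "finite C" "orthonormal C" "ell2c.span C = range (K 0)"
    using basis_range_K0 by blast
  have "\<forall>c\<in>C. \<exists>y. c = K 0 y" using C(3) ell2c.span_base by (metis rangeE)
  then obtain y where y: "\<And>c. c \<in> C \<Longrightarrow> c = K 0 (y c)" by metis
  define D where "D = (\<Sum>c\<in>C. norm c * norm (y c))"
  have pre: "\<exists>g. x = K 0 g \<and> norm g \<le> D * norm x" if x: "x \<in> range (K 0)" for x
  proof -
    define g where "g = (\<Sum>c\<in>C. cnj (cinner x c) *\<^sub>c y c)"
    have "K 0 g = (\<Sum>c\<in>C. cinner x c *\<^sub>c c)"
      unfolding g_def blinfun.sum_right by (intro sum.cong) (auto simp flip: y)
    also have "\<dots> = x" using proj_eq[OF C(1,2), of x] x C(3) by (simp add: proj_def)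
    finally have "x = K 0 g" by simp
    moreover have "norm g \<le> (\<Sum>c\<in>C. norm x * norm c * norm (y c))"
      unfolding g_def
      by (rule order_trans[OF norm_sum sum_mono]) (simp add: mult_right_mono norm_cinner_le)
    ultimately show ?thesis by (auto simp: D_def sum_distrib_right sum_distrib_left mult_ac)
  qed
  have "\<exists>g. h = K t g \<and> norm g \<le> D * norm h" if h: "h \<in> range (K t)" for t h
  proof -
    obtain z' where "h = K t z'" using h by blast
    moreover obtain z where "U t z = z'" using U_surj by blast
    ultimately have z: "h = K t (U t z)" by simp
    obtain g where g: "K 0 z = K 0 g" "norm g \<le> D * norm (K 0 z)" using pre by blast
    have "h = K t (U t g)" using z g(1) by (simp flip: U_K)
    moreover have "norm (U t g) \<le> D * norm h" using g z by (simp add: norm_U flip: U_K)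
    ultimately show ?thesis by blast
  qed
  moreover have "0 \<le> D" unfolding D_def by (intro sum_nonneg) auto
  ultimately show ?thesis by blast
qed

text \<open>Powers of \<open>shl\<close> act on \<open>kank\<close> through the symbol, so on
  \<open>range (K t)\<close> they are controlled by the Wiener norm of a tail of \<open>u t\<close>
  and the norm of a preimage.\<close>

lemma uniform_decay_of_tails:
  "\<exists>\<delta>>0. \<forall>t p. anorm ((shl ^^ p) (u t)) \<le> \<delta> \<longrightarrow> uniform_decay p t"
proof -
  obtain D where D: "D \<ge> 0" "\<And>t h. h \<in> range (K t) \<Longrightarrow> \<exists>g. h = K t g \<and> norm g \<le> D * norm h"
    using bounded_preimages by blast
  \<comment> \<open>The factor 2 is for the halving; \<open>D + 1\<close> keeps the denominator
    positive when \<open>D\<close> is 0.\<close>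
  have "uniform_decay p t" if p: "anorm ((shl ^^ p) (u t)) \<le> 1 / (2 * (D + 1))" for p t
    unfolding uniform_decay_def
  proof
    fix h assume "h \<in> range (K t)"
    then obtain g where g: "h = K t g" "norm g \<le> D * norm h" using D(2) by blast
    have "(shl ^^ p) h = hank ((shl ^^ p) (shl (u t))) g"
      unfolding g(1) K_def kank_def by (rule shl_pow_hank[OF asum_shl[OF asum_u]])
    also have "\<dots> = kank ((shl ^^ p) (u t)) g" by (simp add: kank_def shl_pow_shl)
    finally have "norm ((shl ^^ p) h) \<le> norm (kank ((shl ^^ p) (u t))) * norm g"
      by (simp add: norm_blinfun)
    also have "\<dots> \<le> 1 / (2 * (D + 1)) * (D * norm h)"
      using order_trans[OF order_trans[OF norm_kank_le anorm_shl_le] p] g(2) asum_u D(1)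
      by (intro mult_mono) (auto intro: asum_shl_pow)
    also have "\<dots> = D / (D + 1) * (norm h / 2)" using D(1) by (simp add: field_simps)
    also have "\<dots> \<le> 1 * (norm h / 2)" using D(1) by (intro mult_right_mono) auto
    finally show "norm ((shl ^^ p) h) \<le> norm h / 2" by simp
  qed
  then show ?thesis using D(1) by (intro exI[of _ "1 / (2 * (D + 1))"]) auto
qed

end

section \<open>The conserved quadratic form on an eigenspace\<close>

context szego_flow
begin

definition \<alpha> :: "ell2 \<Rightarrow> real \<Rightarrow> complex" where "\<alpha> c t = cinner (u t) (U t c)"
definition \<beta> :: "ell2 \<Rightarrow> real \<Rightarrow> complex" where "\<beta> c t = cinner (w t) (U t c)"
text \<open>The counterpart of \<open>ell\<close> with pairings against one vector \<open>c\<close>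
  in place of norms of projections. The term \<open>(norm (u 0))\<^sup>2\<close> is Q, which the
  flow conserves.\<close>

definition ellc :: "real \<Rightarrow> ell2 \<Rightarrow> real \<Rightarrow> real" where
  "ellc \<mu> c t = (\<mu> + 2 * (norm (u 0))\<^sup>2) * (norm (\<alpha> c t))\<^sup>2 - (norm (\<beta> c t))\<^sup>2"
definition E :: "real \<Rightarrow> ell2 set" where
  "E \<mu> = {h. K 0 (K 0 h) = of_real \<mu> *\<^sub>c h}"

lemma U_eig: "h \<in> E \<mu> \<Longrightarrow> K t (K t (U t h)) = of_real \<mu> *\<^sub>c U t h"
  by (simp add: E_def U_cmul flip: U_K)

lemma U_eig': "h \<in> E \<mu> \<Longrightarrow> U t h \<in> {h. kank (u t) (kank (u t) h) = of_real \<mu> *\<^sub>c h}"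
  using U_eig by (simp add: K_def)

lemma U_deriv: "((\<lambda>t. U t c) has_vector_derivative (- \<i>) *\<^sub>c A t (U t c)) (at t)"
  using lax_U by (simp add: lax_def)

lemma \<alpha>_deriv: "(\<alpha> c has_vector_derivative - \<i> * J t * \<beta> c t) (at t)"
  unfolding \<alpha>_def[abs_def] \<beta>_def
  using cinner_deriv[OF u_deriv[of t] U_deriv[of c t]]
  by (simp add: cinner_A algebra_simps)

lemma \<beta>_deriv:
  assumes c: "c \<in> E \<mu>"
  shows "(\<beta> c has_vector_derivative \<i> * cnj (J t) * of_real (\<mu> + 2 * (norm (u 0))\<^sup>2) * \<alpha> c t) (at t)"
proof -
  have "cinner (K t (K t (u t))) (U t c) = of_real \<mu> * cinner (u t) (U t c)"
    using U_eig[OF c, of t] by (simp add: cinner_K_K)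
  then show ?thesis
    unfolding \<alpha>_def \<beta>_def[abs_def]
    using cinner_deriv[OF w_deriv[of t] U_deriv[of c t]] norm_u_const[of t 0]
    by (simp add: cinner_A algebra_simps scaleR_cmul del: cmul_scaleR)
qed

text \<open>The cross terms cancel because the two coefficients of the system for \<alpha> and
  \<beta> are conjugate to each other up to the real factor \<mu> + 2Q.\<close>

lemma ellc_const:
  assumes c: "c \<in> E \<mu>"
  shows "ellc \<mu> c s = ellc \<mu> c t"
proof -
  let ?m = "complex_of_real (\<mu> + 2 * (norm (u 0))\<^sup>2)"
  \<comment> \<open>Products with conjugates in place of squared norms, so that the product rule
    applies in the complex numbers.\<close>
  let ?f = "\<lambda>t. ?m * (\<alpha> c t * cnj (\<alpha> c t)) - \<beta> c t * cnj (\<beta> c t)"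
  have f: "?f t = of_real (ellc \<mu> c t)" for t
    by (simp add: ellc_def complex_norm_square[symmetric] del: of_real_power flip: of_real_power)
  have "?f s = ?f t"
  proof (rule has_vector_derivative_const_imp_eq[where f = ?f])
    fix t
    have cn: "((\<lambda>t. cnj (g t)) has_vector_derivative cnj g') (at t)"
      if "(g has_vector_derivative g') (at t)" for g g'
      using bounded_linear.has_vector_derivative[OF bounded_linear_cnj that] .
    note d = has_vector_derivative_diff[OF has_vector_derivative_mult_right[OF
        has_vector_derivative_mult[OF \<alpha>_deriv[of c t] cn[OF \<alpha>_deriv[of c t]]], of ?m]
        has_vector_derivative_mult[OF \<beta>_deriv[OF c, of t] cn[OF \<beta>_deriv[OF c, of t]]]]
    show "(?f has_vector_derivative 0) (at t)"
      using d by (simp add: algebra_simps)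
  qed
  then show ?thesis unfolding f by (simp only: of_real_eq_iff)
qed

text \<open>By \<open>eig_wedge\<close>, \<open>(\<alpha> c, \<beta> c)\<close> is proportional to \<open>(\<alpha> h, \<beta> h)\<close>, so a nonzero pair with \<open>ellc\<close>
  equal to zero would annihilate \<open>ellc\<close> on the whole eigenspace.\<close>

lemma orthogonal_to_u_and_w:
  assumes \<mu>: "0 < \<mu>" and h: "h \<in> E \<mu>" "ellc \<mu> h 0 = 0" and c: "c \<in> E \<mu>" "ellc \<mu> c 0 \<noteq> 0"
  shows "\<alpha> h t = 0 \<and> \<beta> h t = 0"
proof (rule ccontr)
  assume nz: "\<not> (\<alpha> h t = 0 \<and> \<beta> h t = 0)"
  let ?m = "\<mu> + 2 * (norm (u 0))\<^sup>2"
  have m: "0 < ?m" using \<mu> by (simp add: add_pos_nonneg)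
  have eh: "?m * (norm (\<alpha> h t))\<^sup>2 = (norm (\<beta> h t))\<^sup>2"
    using ellc_const[OF h(1), of t 0] h(2) by (simp add: ellc_def)
  with nz m have a: "\<alpha> h t \<noteq> 0" by auto
  have "cinner (U t h) (u t) * cinner (U t c) (w t) = cinner (U t c) (u t) * cinner (U t h) (w t)"
    unfolding w_def using \<mu> by (intro eig_wedge[OF asum_u _ U_eig'[OF h(1)] U_eig'[OF c(1)]]) simp
  then have "cnj (\<alpha> h t) * cnj (\<beta> c t) = cnj (\<alpha> c t) * cnj (\<beta> h t)"
    unfolding \<alpha>_def \<beta>_def by (simp flip: cinner_commute)
  then have "norm (\<alpha> h t) * norm (\<beta> c t) = norm (\<alpha> c t) * norm (\<beta> h t)"
    by (metis complex_mod_cnj norm_mult)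
  then have "(norm (\<alpha> h t))\<^sup>2 * (norm (\<beta> c t))\<^sup>2 = (norm (\<alpha> c t))\<^sup>2 * (norm (\<beta> h t))\<^sup>2"
    by (metis power_mult_distrib)
  also have "\<dots> = (norm (\<alpha> h t))\<^sup>2 * (?m * (norm (\<alpha> c t))\<^sup>2)" by (simp flip: eh)
  finally have "(norm (\<beta> c t))\<^sup>2 = ?m * (norm (\<alpha> c t))\<^sup>2" using a by simp
  then have "ellc \<mu> c t = 0" by (simp add: ellc_def)
  then show False using c ellc_const[OF c(1), of t 0] by simp
qed

text \<open>Orthogonality to \<open>u\<close> and \<Pi>(|u|^2) at all times feeds
  \<open>eig_coef_0\<close>, with \<open>c\<close> as the witness at every time because its
  conserved form is nonzero. Zero mean at all times removes the defect in \<open>shl_A\<close>, so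
  \<open>shl (U t h)\<close> solves the Lax equation.\<close>

lemma shl_U_commute:
  assumes \<mu>: "0 < \<mu>" and h: "h \<in> E \<mu>" "ellc \<mu> h 0 = 0" and c: "c \<in> E \<mu>" "ellc \<mu> c 0 \<noteq> 0"
  shows "shl (U t h) = U t (shl h)"
proof -
  have 0: "coef (U t h) 0 = 0" for t
  proof (rule eig_coef_0[OF asum_u[of t] _ U_eig'[OF h(1)] _ _ U_eig'[OF c(1)]])
    show "cinner (U t h) (u t) = 0" "cinner (U t h) (toepS (u t) (u t)) = 0"
      using orthogonal_to_u_and_w[OF assms, of t]
      by (simp_all add: \<alpha>_def \<beta>_def w_def cinner_eq_0_commute)
    have "ellc \<mu> c t \<noteq> 0" using c(2) ellc_const[OF c(1), of t 0] by simp
    then show "cinner (U t c) (u t) \<noteq> 0 \<or> cinner (U t c) (toepS (u t) (u t)) \<noteq> 0"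
      by (auto simp: ellc_def \<alpha>_def \<beta>_def w_def cinner_eq_0_commute[of "U t c"])
  qed (use \<mu> in simp)
  have "lax (\<lambda>t. shl (U t h))"
    unfolding lax_def
  proof
    fix t
    show "((\<lambda>t. shl (U t h)) has_vector_derivative - \<i> *\<^sub>c A t (shl (U t h))) (at t)"
      using bounded_linear.has_vector_derivative[OF bounded_linear_shl U_deriv, of h t]
      by (simp add: shl_A 0)
  qed
  from U_eqI[OF this, of t] show ?thesis by simp
qed

end

section \<open>Loss of compactness along the flow\<close>

context finite_rank_flow
begin

theorem ellc_eq_0_of_no_uniform_decay:
  assumes no: "\<not> (\<exists>p>0. \<forall>t. uniform_decay p t)"
  shows "\<exists>\<mu>>0. (\<exists>h\<in>E \<mu>. h \<noteq> 0) \<and> (\<forall>c\<in>E \<mu>. ellc \<mu> c 0 = 0)"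
proof -
  obtain C where C: "finite C" "orthonormal C" "ell2c.span C = range (K 0)"
    using basis_range_K0 by blast
  let ?W = "range (K 0)"
  \<comment> \<open>The failure of decay is used at \<open>Suc n\<close>, since the exponent must be
    positive; the surplus power is dropped again by contractivity.\<close>
  have "\<exists>t. \<exists>h\<in>range (K t). norm h / 2 < norm ((shl ^^ Suc n) h)" for n
    using no zero_less_Suc[of n] unfolding uniform_decay_def not_le[symmetric] by blast
  then obtain T where T: "\<And>n. \<exists>h\<in>range (K (T n)). norm h / 2 < norm ((shl ^^ Suc n) h)" by metis
  define M where "M n x = (SOME y. U (T n) y = shl (U (T n) x))" for n x
  have UM: "U (T n) (M n x) = shl (U (T n) x)" for n x
    unfolding M_def by (rule someI_ex) (rule U_surj)
  have UMpow: "U (T n) ((M n ^^ j) x) = (shl ^^ j) (U (T n) x)" for n j x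
    by (induction j) (simp_all add: UM)
  have M_lin: "clinear_map (M n)" for n
    unfolding clinear_map_def
    by (intro conjI allI; rule U_inj[of "T n"]) (simp_all add: UM U_add U_cmul)
  have M_norm: "norm (M n x) \<le> norm x" for n x
    by (metis UM norm_U norm_shl_le)
  \<comment> \<open>The conjugated shift preserves the range because \<open>shl\<close> after
    \<open>K\<close> is \<open>K\<close> after \<open>shr\<close>.\<close>
  have M_K: "M n (K 0 x) \<in> ?W" for n x
  proof -
    obtain z where z: "U (T n) z = shr (U (T n) x)" using U_surj by blast
    have "U (T n) (M n (K 0 x)) = K (T n) (shr (U (T n) x))"
      by (simp only: UM U_K) (simp add: K_def kank_shr asum_u)
    also have "\<dots> = U (T n) (K 0 z)" by (simp add: U_K z)
    finally show ?thesis using U_inj by blast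
  qed
  have large: "\<exists>x\<in>ell2c.span C. norm x \<le> 1 \<and> norm ((M n ^^ n) x) > 1/2" for n
  proof -
    obtain z where z: "norm (K (T n) z) / 2 < norm ((shl ^^ Suc n) (K (T n) z))" using T[of n] by blast
    obtain y where y: "U (T n) y = z" using U_surj by blast
    define h where "h = K 0 y"
    have Uh: "U (T n) h = K (T n) z" by (simp add: h_def U_K y)
    have "norm h / 2 < norm ((M n ^^ Suc n) h)"
      using z by (metis Uh UMpow norm_U)
    also have "\<dots> \<le> norm ((M n ^^ n) h)" by (simp add: M_norm)
    finally have lt: "norm h / 2 < norm ((M n ^^ n) h)" .
    have h0: "h \<noteq> 0"
      using lt clinear_mapD(3)[OF clinear_map_funpow[OF M_lin]] by auto
    define x where "x = of_real (1 / norm h) *\<^sub>c h"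
    have "x \<in> ?W" unfolding x_def h_def
      by (intro ell2c.subspace_scale[OF subspace_range_K]) auto
    moreover have "norm x = 1" using h0 by (simp add: x_def norm_divide)
    moreover have "norm ((M n ^^ n) x) > 1/2"
    proof -
      have "norm ((M n ^^ n) x) = norm ((M n ^^ n) h) / norm h"
        unfolding x_def clinear_mapD(2)[OF clinear_map_funpow[OF M_lin]] by (simp add: norm_divide)
      then show ?thesis using lt h0 by (simp add: less_divide_eq)
    qed
    ultimately show ?thesis unfolding C(3) by (intro bexI[of _ x]) simp_all
  qed
  have "M n x \<in> ell2c.span C" if "x \<in> ell2c.span C" for n x
    using that M_K unfolding C(3) by blast
  from contraction_sequence_eigenvector[OF C(1,2) M_lin this M_norm large]
  obtain r a h where r: "strict_mono (r :: nat \<Rightarrow> nat)" and a: "norm a = 1"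
    and h: "h \<in> ?W" "h \<noteq> 0" "(\<lambda>n. M (r n) h) \<longlonglongrightarrow> a *\<^sub>c h"
    unfolding C(3) by blast
  have aa: "a * cnj a = 1" using a complex_norm_square[of a] by simp
  define \<tau> where "\<tau> n = T (r n)" for n
  define N where "N n = M (r n)" for n
  have UN: "U (\<tau> n) (N n x) = shl (U (\<tau> n) x)" for n x
    by (simp add: N_def \<tau>_def UM)
  \<comment> \<open>All vectors with the limiting eigenvalue \<open>a\<close>, rather than
    \<open>h\<close> alone: this subspace turns out to be invariant under \<open>K 0\<close>, so it
    contains an eigenvector of the square of \<open>K 0\<close>.\<close>
  define X where "X = {x \<in> ?W. (\<lambda>n. N n x) \<longlonglongrightarrow> a *\<^sub>c x}"
  have X_sub: "ell2c.subspace X"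
  proof (rule ell2c.subspaceI)
    show "0 \<in> X"
      using ell2c.subspace_0[OF subspace_range_K] by (simp add: X_def N_def clinear_mapD(3)[OF M_lin])
    show "x + y \<in> X" if "x \<in> X" "y \<in> X" for x y
      using that ell2c.subspace_add[OF subspace_range_K]
      by (auto simp: X_def N_def clinear_mapD(1)[OF M_lin] cmul_distribs intro: tendsto_add)
    show "c *\<^sub>c x \<in> X" if "x \<in> X" for c x
    proof -
      have "(\<lambda>n. c *\<^sub>c N n x) \<longlonglongrightarrow> c *\<^sub>c a *\<^sub>c x"
        using that by (intro bounded_linear.tendsto[OF cmul.bounded_linear_right]) (simp add: X_def)
      then show ?thesis using that ell2c.subspace_scale[OF subspace_range_K]
        by (auto simp: X_def N_def clinear_mapD(2)[OF M_lin] mult.commute)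
    qed
  qed
  \<comment> \<open>Unimodularity of \<open>a\<close> makes the norm lost under \<open>shl\<close>
    tend to 0.\<close>
  have coef0: "(\<lambda>n. coef (U (\<tau> n) x) 0) \<longlonglongrightarrow> 0" if x: "x \<in> X" for x
  proof -
    have "(norm (coef (U (\<tau> n) x) 0))\<^sup>2 = (norm x)\<^sup>2 - (norm (N n x))\<^sup>2" for n
      using norm_shl_sq[of "U (\<tau> n) x"] by (simp add: norm_U flip: UN)
    moreover have "(\<lambda>n. (norm x)\<^sup>2 - (norm (N n x))\<^sup>2) \<longlonglongrightarrow> (norm x)\<^sup>2 - (norm (a *\<^sub>c x))\<^sup>2"
      using x by (intro tendsto_intros) (simp add: X_def)
    ultimately have "(\<lambda>n. (norm (coef (U (\<tau> n) x) 0))\<^sup>2) \<longlonglongrightarrow> 0" using a by simp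
    from tendsto_real_sqrt[OF this] have "(\<lambda>n. norm (coef (U (\<tau> n) x) 0)) \<longlonglongrightarrow> 0" by simp
    then show ?thesis by (rule tendsto_norm_zero_cancel)
  qed
  \<comment> \<open>\<open>shr\<close> is isometric and adjoint to \<open>shl\<close>, so an
    approximate eigenvector of \<open>shl\<close> for \<open>a\<close> is one of \<open>shr\<close>
    for \<open>cnj a\<close>. Applying the antilinear \<open>K\<close> returns to \<open>shl\<close>
    and to \<open>a\<close>.\<close>
  have X_K: "K 0 x \<in> X" if x: "x \<in> X" for x
  proof -
    let ?f = "\<lambda>n. U (\<tau> n) x"
    let ?d = "\<lambda>n. shr (?f n) - cnj a *\<^sub>c ?f n"
    have s1: "(norm (?d n))\<^sup>2 = 2 * (norm x)\<^sup>2 - 2 * Re (a * cinner x (N n x))" for n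
    proof -
      have e1: "cinner (shr (?f n)) (?f n) = cinner x (N n x)"
        by (simp add: cinner_shr_left cinner_U flip: UN)
      then have e2: "cinner (?f n) (shr (?f n)) = cnj (cinner x (N n x))"
        by (subst cinner_commute) simp
      have e3: "cinner (shr (?f n)) (shr (?f n)) = of_real ((norm x)\<^sup>2)"
        "cinner (?f n) (?f n) = of_real ((norm x)\<^sup>2)"
        by (simp_all only: cinner_self_norm norm_shr norm_U)
      have e4: "cinner (?d n) (?d n) = cinner (shr (?f n)) (shr (?f n)) - a * cinner (shr (?f n)) (?f n)
          - cnj a * cinner (?f n) (shr (?f n)) + a * cnj a * cinner (?f n) (?f n)"
        by (simp add: algebra_simps)
      have "Re (cinner (?d n) (?d n)) = 2 * (norm x)\<^sup>2 - 2 * Re (a * cinner x (N n x))"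
        unfolding e4 e1 e2 e3 aa by simp
      then show ?thesis unfolding cinner_self_norm Re_complex_of_real .
    qed
    have s2: "(\<lambda>n. 2 * (norm x)\<^sup>2 - 2 * Re (a * cinner x (N n x)))
        \<longlonglongrightarrow> 2 * (norm x)\<^sup>2 - 2 * Re (a * cinner x (a *\<^sub>c x))"
      using x by (intro tendsto_intros cinner.tendsto) (simp add: X_def)
    have s3: "Re (a * cinner x (a *\<^sub>c x)) = (norm x)\<^sup>2"
      by (simp add: aa cinner_self_norm flip: mult.assoc del: of_real_power)
    from s2[unfolded s3] have "(\<lambda>n. (norm (?d n))\<^sup>2) \<longlonglongrightarrow> 0"
      unfolding s1 diff_self .
    from tendsto_real_sqrt[OF this] have d: "(\<lambda>n. norm (?d n)) \<longlonglongrightarrow> 0" by simp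
    have "(\<lambda>n. N n (K 0 x) - a *\<^sub>c K 0 x) \<longlonglongrightarrow> 0"
    proof (rule Lim_null_comparison[OF always_eventually tendsto_mult_right_zero[OF d, of "norm (K 0)"]], rule allI)
      fix n
      have "U (\<tau> n) (N n (K 0 x) + (- a) *\<^sub>c K 0 x) = K (\<tau> n) (?d n)"
        by (simp only: U_add U_cmul UN U_K blinfun.diff_right K_cmul complex_cnj_cnj)
          (simp add: K_def kank_shr asum_u)
      then show "norm (N n (K 0 x) - a *\<^sub>c K 0 x) \<le> norm (K 0) * norm (?d n)"
        using norm_K_le[of "\<tau> n" "?d n"] norm_U[of "\<tau> n" "N n (K 0 x) + (- a) *\<^sub>c K 0 x"] by simp
    qed
    then show ?thesis using x by (simp add: X_def LIM_zero_iff)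
  qed
  have K_N: "(\<lambda>n. K 0 (N n x - a *\<^sub>c x)) \<longlonglongrightarrow> 0" if x: "x \<in> X" for x
  proof -
    have "(\<lambda>n. N n x - a *\<^sub>c x) \<longlonglongrightarrow> 0" using x by (simp add: X_def LIM_zero_iff)
    from bounded_linear.tendsto[OF blinfun.bounded_linear_right this, of "K 0"]
    show ?thesis by (simp add: blinfun.zero_right)
  qed
  have K_N_eq: "K (\<tau> n) (shl (U (\<tau> n) x)) = cnj a *\<^sub>c U (\<tau> n) (K 0 x) + U (\<tau> n) (K 0 (N n x - a *\<^sub>c x))" for n x
    by (simp add: blinfun.diff_right flip: UN U_K U_cmul U_add)
  \<comment> \<open>Let f be the moved vector \<open>U (\<tau> n) x\<close>. Up to a term with the
    mean of f, its pairing with \<open>u\<close> is that of \<open>shl f\<close> with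
    \<open>shl u\<close>, which is \<open>K\<close> of the constant 1. Symmetry of \<open>K\<close>
    turns this into the mean of \<open>K (shl f)\<close>, close to \<open>cnj a\<close> times the
    mean of \<open>K f\<close>; the latter tends to 0 because \<open>K 0 x\<close> belongs to
    \<open>X\<close> again.\<close>
  have alpha0: "(\<lambda>n. cinner (u (\<tau> n)) (U (\<tau> n) x)) \<longlonglongrightarrow> 0" if x: "x \<in> X" for x
  proof -
    have eq: "cinner (u (\<tau> n)) (U (\<tau> n) x) = cnj a * coef (U (\<tau> n) (K 0 x)) 0
        + coef (U (\<tau> n) (K 0 (N n x - a *\<^sub>c x))) 0 + coef (u (\<tau> n)) 0 * cnj (coef (U (\<tau> n) x) 0)" for n
    proof -
      have "cinner (u (\<tau> n)) (U (\<tau> n) x) = cinner (shl (u (\<tau> n))) (shl (U (\<tau> n) x))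
          + coef (u (\<tau> n)) 0 * cnj (coef (U (\<tau> n) x) 0)"
        by (subst shr_shl_add[of "u (\<tau> n)"])
          (simp add: cinner_shr_left cinner_commute[of "basis 0"] del: cinner_basis, simp)
      moreover have "cinner (shl (u (\<tau> n))) (shl (U (\<tau> n) x))
          = cinner (K (\<tau> n) (shl (U (\<tau> n) x))) (basis 0)"
        by (subst cinner_K) (simp add: K_def asum_u)
      ultimately show ?thesis by (simp only: K_N_eq) simp
    qed
    have t1: "(\<lambda>n. cnj a * coef (U (\<tau> n) (K 0 x)) 0) \<longlonglongrightarrow> 0"
      by (rule tendsto_mult_right_zero[OF coef0[OF X_K[OF x]]])
    have t2: "(\<lambda>n. coef (U (\<tau> n) (K 0 (N n x - a *\<^sub>c x))) 0) \<longlonglongrightarrow> 0"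
    proof (rule Lim_null_comparison[OF always_eventually tendsto_norm_zero[OF K_N[OF x]]], rule allI)
      show "norm (coef (U (\<tau> n) (K 0 (N n x - a *\<^sub>c x))) 0) \<le> norm (K 0 (N n x - a *\<^sub>c x))" for n
        using norm_coef_le[of "U (\<tau> n) (K 0 (N n x - a *\<^sub>c x))" 0] by (simp add: norm_U)
    qed
    have t3: "(\<lambda>n. coef (u (\<tau> n)) 0 * cnj (coef (U (\<tau> n) x) 0)) \<longlonglongrightarrow> 0"
    proof (rule Lim_null_comparison[OF always_eventually
          tendsto_mult_right_zero[OF tendsto_norm_zero[OF coef0[OF x]], of "norm (u 0)"]], rule allI)
      show "norm (coef (u (\<tau> n)) 0 * cnj (coef (U (\<tau> n) x) 0)) \<le> norm (u 0) * norm (coef (U (\<tau> n) x) 0)" for n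
        using norm_coef_le[of "u (\<tau> n)" 0] norm_u_const[of "\<tau> n" 0] by (simp add: norm_mult mult_right_mono)
    qed
    from tendsto_add[OF tendsto_add[OF t1 t2] t3] show ?thesis by (simp add: eq)
  qed
  \<comment> \<open>By \<open>cinner_w\<close> this reduces to the mean and to the pairing of
    \<open>u\<close> with the moved vector \<open>K 0 x\<close>, which tends to 0 by
    \<open>alpha0\<close>.\<close>
  have beta0: "(\<lambda>n. cinner (w (\<tau> n)) (U (\<tau> n) x)) \<longlonglongrightarrow> 0" if x: "x \<in> X" for x
  proof -
    have eq: "cinner (w (\<tau> n)) (U (\<tau> n) x) = of_real ((norm (u 0))\<^sup>2) * cnj (coef (U (\<tau> n) x) 0)
        + cnj a * cnj (cinner (u (\<tau> n)) (U (\<tau> n) (K 0 x)))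
        + cinner (U (\<tau> n) (K 0 (N n x - a *\<^sub>c x))) (u (\<tau> n))" for n
    proof -
      have "cinner (w (\<tau> n)) (U (\<tau> n) x) = cnj (coef (U (\<tau> n) x) 0) * of_real ((norm (u (\<tau> n)))\<^sup>2)
          + cinner (K (\<tau> n) (shl (U (\<tau> n) x))) (u (\<tau> n))"
        unfolding w_def K_def by (rule cinner_w[OF asum_u])
      then show ?thesis
        by (simp only: K_N_eq cinner.add_left cinner_cmul_left norm_u_const[of "\<tau> n" 0]
            cinner_commute[of "U (\<tau> n) (K 0 x)"] add.assoc mult.commute)
    qed
    have t1: "(\<lambda>n. of_real ((norm (u 0))\<^sup>2) * cnj (coef (U (\<tau> n) x) 0)) \<longlonglongrightarrow> 0"
      using tendsto_cnj[OF coef0[OF x]] by (intro tendsto_mult_right_zero) simp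
    have t2: "(\<lambda>n. cnj a * cnj (cinner (u (\<tau> n)) (U (\<tau> n) (K 0 x)))) \<longlonglongrightarrow> 0"
      using tendsto_cnj[OF alpha0[OF X_K[OF x]]] by (intro tendsto_mult_right_zero) simp
    have t3: "(\<lambda>n. cinner (U (\<tau> n) (K 0 (N n x - a *\<^sub>c x))) (u (\<tau> n))) \<longlonglongrightarrow> 0"
    proof (rule Lim_null_comparison[OF always_eventually
          tendsto_mult_left_zero[OF tendsto_norm_zero[OF K_N[OF x]], of "norm (u 0)"]], rule allI)
      show "norm (cinner (U (\<tau> n) (K 0 (N n x - a *\<^sub>c x))) (u (\<tau> n))) \<le> norm (K 0 (N n x - a *\<^sub>c x)) * norm (u 0)" for n
        using norm_cinner_le[of "U (\<tau> n) (K 0 (N n x - a *\<^sub>c x))" "u (\<tau> n)"] norm_u_const[of "\<tau> n" 0]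
        by (simp add: norm_U)
    qed
    from tendsto_add[OF tendsto_add[OF t1 t2] t3] show ?thesis by (simp add: eq)
  qed
  have "clinear_map (\<lambda>x. K 0 (K 0 x))"
    by (simp add: clinear_map_def blinfun.add_right)
  moreover have "h \<in> X" using h by (simp add: X_def N_def)
  ultimately obtain x \<nu> where x: "x \<in> X" "x \<noteq> 0" "K 0 (K 0 x) = \<nu> *\<^sub>c x"
    using eigenvector_exists[of "\<lambda>x. K 0 (K 0 x)" X C h] X_sub X_K h(2) C by (auto simp: X_def)
  \<comment> \<open>As a quotient of squared norms the eigenvalue is visibly real and nonnegative;
    it is positive because \<open>K 0\<close> is symmetric and \<open>x\<close> lies in its
    range.\<close>
  define \<mu> where "\<mu> = (norm (K 0 x))\<^sup>2 / (norm x)\<^sup>2"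
  have "\<nu> * of_real ((norm x)\<^sup>2) = of_real ((norm (K 0 x))\<^sup>2)"
    using cinner_K[of 0 "K 0 x" x] x(3) by (simp add: cinner_self_norm del: of_real_power)
  then have \<nu>: "\<nu> = of_real \<mu>"
    using x(2) by (simp add: \<mu>_def field_simps)
  have "K 0 x \<noteq> 0"
  proof
    assume 0: "K 0 x = 0"
    obtain y where "x = K 0 y" using x(1) by (auto simp: X_def)
    then have "cinner x x = 0" using cinner_K[of 0 y x] 0 by simp
    then show False using x(2) by (simp add: cinner_self_norm)
  qed
  then have \<mu>: "0 < \<mu>" using x(2) by (simp add: \<mu>_def)
  have xE: "x \<in> E \<mu>" using x(3) by (simp add: E_def \<nu>)
  have "(\<lambda>n. ellc \<mu> x (\<tau> n)) \<longlonglongrightarrow> (\<mu> + 2 * (norm (u 0))\<^sup>2) * (norm (0::complex))\<^sup>2 - (norm (0::complex))\<^sup>2"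
    unfolding ellc_def \<alpha>_def \<beta>_def by (intro tendsto_intros alpha0 beta0 x(1))
  moreover have "(\<lambda>n. ellc \<mu> x (\<tau> n)) = (\<lambda>n. ellc \<mu> x 0)"
    by (rule ext) (rule ellc_const[OF xE])
  ultimately have "(\<lambda>n::nat. ellc \<mu> x 0) \<longlonglongrightarrow> 0" by simp
  then have x0: "ellc \<mu> x 0 = 0" by (simp add: LIMSEQ_const_iff)
  have "ellc \<mu> c 0 = 0" if c: "c \<in> E \<mu>" for c
  proof (rule ccontr)
    assume nz: "ellc \<mu> c 0 \<noteq> 0"
    \<comment> \<open>The conjugated shift of \<open>x\<close> no longer depends on
      \<open>n\<close>, so the approximate eigenvector relation becomes exact.\<close>
    have "N n x = shl x" for n
    proof (rule U_inj[of "\<tau> n"])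
      show "U (\<tau> n) (N n x) = U (\<tau> n) (shl x)"
        by (simp add: UN shl_U_commute[OF \<mu> xE x0 c nz])
    qed
    then have "(\<lambda>n::nat. shl x) \<longlonglongrightarrow> a *\<^sub>c x" using x(1) by (simp add: X_def)
    then have shx: "shl x = a *\<^sub>c x" by (simp add: LIMSEQ_const_iff)
    have "norm ((shl ^^ n) x) = norm x" for n
    proof -
      have "(shl ^^ n) x = a ^ n *\<^sub>c x"
        by (induction n) (simp_all add: shx mult.commute)
      then show ?thesis by (simp add: norm_power a)
    qed
    then have "(\<lambda>n::nat. norm x) \<longlonglongrightarrow> 0" using norm_shl_pow_tendsto[of x] by simp
    then show False using x(2) by (simp add: LIMSEQ_const_iff)
  qed
  then show ?thesis using \<mu> xE x(2) by blast
qed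

end

section \<open>Fourier series on the circle\<close>

interpretation circle: finite_measure circle_measure
  by standard (simp add: emeasure_circle_measure_UNIV)

abbreviation "measC f \<equiv> f \<in> borel_measurable (circle_measure :: real measure)"
abbreviation "intC f \<equiv> integral\<^sup>L circle_measure f"

lemma circle_measure_density:
  "circle_measure = density lborel (\<lambda>x. ennreal (indicator {0..<2 * pi} x / (2 * pi)))"
  unfolding circle_measure_def uniform_measure_def
  by (intro density_cong AE_I2) (auto simp: indicator_def ennreal_divide_numeral divide_ennreal[symmetric])

lemma AE_circle: "AE x in circle_measure. x \<in> {0..<2 * pi}"
  unfolding circle_measure_density by (subst AE_density) (auto simp: indicator_def)

lemma integral_circle_measure:
  fixes f :: "real \<Rightarrow> complex"
  assumes "f \<in> borel_measurable borel"
  shows "intC f = (\<integral>x. (indicator {0..<2 * pi} x / (2 * pi)) *\<^sub>R f x \<partial>lborel)"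
  unfolding circle_measure_density by (rule integral_density) (use assms in \<open>auto simp: indicator_def\<close>)

lemma measurable_cis [measurable]: "(\<lambda>x. cis (c * x)) \<in> borel_measurable borel"
  by (intro borel_measurable_continuous_onI continuous_intros)

lemma measurable_cis_circle [measurable]: "measC (\<lambda>x. cis (c * x))"
  using measurable_cis by (simp add: measurable_def sets_circle_measure)

lemma intC_cis: "intC (\<lambda>x. cis (of_int n * x)) = (if n = 0 then 1 else 0)"
proof (cases "n = 0")
  case True
  have "measure circle_measure UNIV = 1"
    by (simp add: measure_def emeasure_circle_measure_UNIV)
  then show ?thesis using True by simp
next
  case False
  define F where "F x = cis (of_int n * x) / (\<i> * of_int n)" for x
  have F: "(F has_vector_derivative cis (of_int n * x)) (at x within S)" for x S
  proof -
    have "((\<lambda>x. exp (\<i> * of_int n * of_real x) / (\<i> * of_int n)) has_vector_derivative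
        exp (\<i> * of_int n * of_real x)) (at x within S)"
      using False by (auto intro!: derivative_eq_intros has_vector_derivative_real_field
          simp: divide_simps)
    then show ?thesis by (simp add: F_def[abs_def] cis_conv_exp mult.assoc)
  qed
  have "intC (\<lambda>x. cis (of_int n * x)) = (\<integral>x. (indicator {0..<2 * pi} x / (2 * pi)) *\<^sub>R cis (of_int n * x) \<partial>lborel)"
    by (rule integral_circle_measure) measurable
  \<comment> \<open>The half-open interval is closed at a null point, to apply the fundamental
    theorem of calculus.\<close>
  also have "\<dots> = (\<integral>x. (1 / (2 * pi)) *\<^sub>R (indicator {0..2 * pi} x *\<^sub>R cis (of_int n * x)) \<partial>lborel)"
  proof (rule integral_cong_AE)
    have "AE x in lborel. x \<noteq> 2 * pi" by (rule AE_lborel_singleton)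
    then show "AE x in lborel. (indicator {0..<2 * pi} x / (2 * pi)) *\<^sub>R cis (of_int n * x)
        = (1 / (2 * pi)) *\<^sub>R (indicator {0..2 * pi} x *\<^sub>R cis (of_int n * x))"
      by eventually_elim (auto simp: indicator_def)
  qed measurable
  also have "\<dots> = (1 / (2 * pi)) *\<^sub>R (F (2 * pi) - F 0)"
    unfolding integral_scaleR_right
    by (subst integral_FTC_atLeastAtMost[of 0 "2 * pi" F]) (auto intro!: F continuous_intros)
  also have "F (2 * pi) - F 0 = 0"
    using cis_multiple_2pi[of "of_int n"] by (simp add: F_def mult.commute)
  finally show ?thesis using False by simp
qed

definition sqC :: "(real \<Rightarrow> complex) \<Rightarrow> bool" where
  "sqC f \<longleftrightarrow> measC f \<and> integrable circle_measure (\<lambda>x. (norm (f x))\<^sup>2)"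

lemma sqC_measD [dest, measurable_dest]: "sqC f \<Longrightarrow> measC f" by (simp add: sqC_def)

lemma sqC_integrable_mult:
  assumes "sqC f" "sqC g"
  shows "integrable circle_measure (\<lambda>x. f x * g x)"
proof (rule Bochner_Integration.integrable_bound)
  show "integrable circle_measure (\<lambda>x. (norm (f x))\<^sup>2 + (norm (g x))\<^sup>2)"
    using assms by (auto simp: sqC_def)
  show "AE x in circle_measure. norm (f x * g x) \<le> norm ((norm (f x))\<^sup>2 + (norm (g x))\<^sup>2)"
  proof (rule AE_I2)
    fix x
    show "norm (f x * g x) \<le> norm ((norm (f x))\<^sup>2 + (norm (g x))\<^sup>2)"
      using sum_squares_bound[of "norm (f x)" "norm (g x)"]
        mult_nonneg_nonneg[OF norm_ge_zero[of "f x"] norm_ge_zero[of "g x"]]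
      unfolding norm_mult real_norm_def by linarith
  qed
qed (use assms in \<open>auto dest!: sqC_measD\<close>)

lemma sqC_bounded: "measC f \<Longrightarrow> (\<And>x. norm (f x) \<le> B) \<Longrightarrow> sqC f"
  unfolding sqC_def
proof (intro conjI circle.integrable_const_bound[where B = "B\<^sup>2"] AE_I2)
  fix x assume "\<And>x. norm (f x) \<le> B"
  then have "(norm (f x))\<^sup>2 \<le> B\<^sup>2" by (intro power_mono) auto
  then show "norm ((norm (f x))\<^sup>2) \<le> B\<^sup>2" by simp
qed auto

lemma sqC_cis: "sqC (\<lambda>x. cis (c * x))"
  by (rule sqC_bounded[where B = 1]) auto

lemma sqC_mult_bounded:
  assumes f: "sqC f" and g: "measC g" "\<And>x. norm (g x) \<le> B"
  shows "sqC (\<lambda>x. g x * f x)"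
  unfolding sqC_def
proof
  show "measC (\<lambda>x. g x * f x)" using f g by measurable
  show "integrable circle_measure (\<lambda>x. (norm (g x * f x))\<^sup>2)"
  proof (rule Bochner_Integration.integrable_bound)
    show "integrable circle_measure (\<lambda>x. B\<^sup>2 * (norm (f x))\<^sup>2)"
      using f by (auto simp: sqC_def)
    show "AE x in circle_measure. norm ((norm (g x * f x))\<^sup>2) \<le> norm (B\<^sup>2 * (norm (f x))\<^sup>2)"
    proof (rule AE_I2)
      fix x
      have "(norm (g x))\<^sup>2 \<le> B\<^sup>2" by (intro power_mono g) auto
      then show "norm ((norm (g x * f x))\<^sup>2) \<le> norm (B\<^sup>2 * (norm (f x))\<^sup>2)"
        by (simp add: norm_mult power_mult_distrib mult_right_mono)
    qed
  qed (use f g in measurable)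
qed

lemma sqC_add:
  assumes "sqC f" "sqC g"
  shows "sqC (\<lambda>x. f x + g x)"
  unfolding sqC_def
proof
  show "measC (\<lambda>x. f x + g x)" using assms by measurable
  show "integrable circle_measure (\<lambda>x. (norm (f x + g x))\<^sup>2)"
  proof (rule Bochner_Integration.integrable_bound)
    show "integrable circle_measure (\<lambda>x. 2 * (norm (f x))\<^sup>2 + 2 * (norm (g x))\<^sup>2)"
      using assms by (auto simp: sqC_def)
    show "AE x in circle_measure. norm ((norm (f x + g x))\<^sup>2) \<le> norm (2 * (norm (f x))\<^sup>2 + 2 * (norm (g x))\<^sup>2)"
    proof (rule AE_I2)
      fix x
      have "(norm (f x + g x))\<^sup>2 \<le> (norm (f x) + norm (g x))\<^sup>2"
        by (intro power_mono norm_triangle_ineq) auto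
      also have "\<dots> \<le> 2 * (norm (f x))\<^sup>2 + 2 * (norm (g x))\<^sup>2"
        using sum_squares_bound[of "norm (f x)" "norm (g x)"] by (simp add: power2_sum)
      finally show "norm ((norm (f x + g x))\<^sup>2) \<le> norm (2 * (norm (f x))\<^sup>2 + 2 * (norm (g x))\<^sup>2)" by simp
    qed
  qed (use assms in measurable)
qed

lemma sqC_scale: "sqC f \<Longrightarrow> sqC (\<lambda>x. c * f x)"
  by (rule sqC_mult_bounded[where B = "norm c"]) auto

lemma sqC_integrable: "sqC f \<Longrightarrow> integrable circle_measure f"
  using sqC_integrable_mult[OF sqC_bounded[of "\<lambda>_. 1" 1]] by simp

lemma integral_norm_mult_le:
  assumes f: "sqC f" and g: "sqC g"
  shows "(\<integral>x. norm (f x) * norm (g x) \<partial>circle_measure)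
    \<le> sqrt (\<integral>x. (norm (f x))\<^sup>2 \<partial>circle_measure) * sqrt (\<integral>x. (norm (g x))\<^sup>2 \<partial>circle_measure)"
proof -
  have zero: "(\<integral>x. norm (f x) * norm (g x) \<partial>circle_measure) = 0"
    if f: "sqC f" "(\<integral>x. (norm (f x))\<^sup>2 \<partial>circle_measure) = 0" for f g :: "real \<Rightarrow> complex"
  proof -
    have "AE x in circle_measure. (norm (f x))\<^sup>2 = 0"
      using f by (subst integral_nonneg_eq_0_iff_AE[symmetric]) (auto simp: sqC_def)
    then have "AE x in circle_measure. norm (f x) * norm (g x) = 0" by eventually_elim auto
    then show ?thesis by (rule integral_eq_zero_AE)
  qed
  define a where "a = sqrt (\<integral>x. (norm (f x))\<^sup>2 \<partial>circle_measure)"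
  define b where "b = sqrt (\<integral>x. (norm (g x))\<^sup>2 \<partial>circle_measure)"
  have a2: "(\<integral>x. (norm (f x))\<^sup>2 \<partial>circle_measure) = a\<^sup>2" and b2: "(\<integral>x. (norm (g x))\<^sup>2 \<partial>circle_measure) = b\<^sup>2"
    by (simp_all add: a_def b_def)
  have ab: "0 \<le> a" "0 \<le> b" by (simp_all add: a_def b_def)
  show ?thesis
  proof (cases "a = 0 \<or> b = 0")
    case True
    then have "(\<integral>x. norm (f x) * norm (g x) \<partial>circle_measure) = 0"
      using zero[OF f, of g] zero[OF g, of f] a2 b2 by (auto simp: mult.commute)
    then show ?thesis by simp
  next
    case False
    with ab have pos: "0 < a" "0 < b" by auto
    \<comment> \<open>The inequality of arithmetic and geometric means, with weights that equalise
      the two terms after integration.\<close>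
    have "(\<integral>x. norm (f x) * norm (g x) \<partial>circle_measure)
        \<le> (\<integral>x. (b / (2 * a)) * (norm (f x))\<^sup>2 + (a / (2 * b)) * (norm (g x))\<^sup>2 \<partial>circle_measure)"
    proof (rule integral_mono)
      show "integrable circle_measure (\<lambda>x. norm (f x) * norm (g x))"
        using integrable_norm[OF sqC_integrable_mult[OF f g]] by (simp add: norm_mult)
      show "integrable circle_measure (\<lambda>x. (b / (2 * a)) * (norm (f x))\<^sup>2 + (a / (2 * b)) * (norm (g x))\<^sup>2)"
        using f g by (auto simp: sqC_def)
      fix x
      have "0 \<le> (b * norm (f x) - a * norm (g x))\<^sup>2 / (2 * a * b)" using pos by simp
      also have "\<dots> = (b / (2 * a)) * (norm (f x))\<^sup>2 + (a / (2 * b)) * (norm (g x))\<^sup>2 - norm (f x) * norm (g x)"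
        using pos by (simp add: field_simps power2_eq_square)
      finally show "norm (f x) * norm (g x) \<le> (b / (2 * a)) * (norm (f x))\<^sup>2 + (a / (2 * b)) * (norm (g x))\<^sup>2" by simp
    qed
    also have "\<dots> = (b / (2 * a)) * a\<^sup>2 + (a / (2 * b)) * b\<^sup>2"
      using f g by (simp add: sqC_def a2 b2)
    also have "\<dots> = a * b" using pos by (simp add: field_simps power2_eq_square)
    finally show ?thesis by (simp add: a_def b_def)
  qed
qed

subsection \<open>Completeness of the trigonometric system\<close>

inductive trig_poly :: "(real \<Rightarrow> complex) \<Rightarrow> bool" where
  monomial: "trig_poly (\<lambda>x. c * cis (of_int n * x))"
| add: "trig_poly f \<Longrightarrow> trig_poly g \<Longrightarrow> trig_poly (\<lambda>x. f x + g x)"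

lemma trig_poly_mult_monomial: "trig_poly f \<Longrightarrow> trig_poly (\<lambda>x. c * cis (of_int n * x) * f x)"
proof (induction rule: trig_poly.induct)
  case (monomial d m)
  have eq: "(\<lambda>x. c * cis (of_int n * x) * (d * cis (of_int m * x))) = (\<lambda>x. (c * d) * cis (of_int (n + m) * x))"
    by (auto simp: cis_mult[symmetric] algebra_simps)
  show ?case unfolding eq by (rule trig_poly.monomial)
next
  case (add f g)
  show ?case unfolding ring_distribs(1) by (rule trig_poly.add[OF add.IH])
qed

lemma trig_poly_mult: "trig_poly f \<Longrightarrow> trig_poly g \<Longrightarrow> trig_poly (\<lambda>x. f x * g x)"
proof (induction rule: trig_poly.induct)
  case (monomial c n)
  then show ?case by (rule trig_poly_mult_monomial)
next
  case (add f g')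
  show ?case unfolding ring_distribs(2) by (rule trig_poly.add[OF add.IH(1,2)[OF add.prems]])
qed

text \<open>The real and imaginary parts of \<open>cis x\<close> are combinations of the frequencies
  1 and -1, so polynomials on the plane restrict to trigonometric polynomials. This connects the
  real Stone-Weierstrass theorem with Fourier coefficients.\<close>

lemma trig_poly_real_polynomial:
  "real_polynomial_function p \<Longrightarrow> trig_poly (\<lambda>x. of_real (p (cis x)))"
proof (induction rule: real_polynomial_function.induct)
  case (linear f)
  interpret bounded_linear f by fact
  have fz: "f z = Re z * f 1 + Im z * f \<i>" for z
  proof -
    have "f z = f (Re z *\<^sub>R 1 + Im z *\<^sub>R \<i>)"
      by (rule arg_cong[where f = f]) (simp add: complex_eq_iff)
    then show ?thesis by (simp only: add scaleR real_scaleR_def)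
  qed
  have eq: "(\<lambda>x. complex_of_real (f (cis x)))
      = (\<lambda>x. (f 1 / 2 - \<i> * f \<i> / 2) * cis (of_int 1 * x) + (f 1 / 2 + \<i> * f \<i> / 2) * cis (of_int (-1) * x))"
    by (rule ext, subst fz) (simp add: complex_eq_iff)
  show ?case unfolding eq by (rule trig_poly.add[OF trig_poly.monomial trig_poly.monomial])
next
  case (const c)
  then show ?case using trig_poly.monomial[of "of_real c" 0] by simp
next
  case (add f g)
  show ?case unfolding of_real_add by (rule trig_poly.add[OF add.IH])
next
  case (mult f g)
  show ?case unfolding of_real_mult by (rule trig_poly_mult[OF mult.IH])
qed

lemma integrable_mult_bounded:
  fixes f g :: "real \<Rightarrow> complex"
  assumes f: "integrable circle_measure f" and g: "measC g" "\<And>x. norm (g x) \<le> B"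
  shows "integrable circle_measure (\<lambda>x. f x * g x)"
proof (rule Bochner_Integration.integrable_bound)
  show "integrable circle_measure (\<lambda>x. B * norm (f x))" using f by auto
  have "norm (f x * g x) \<le> norm (B * norm (f x))" for x
  proof -
    have "norm (f x * g x) \<le> B * norm (f x)"
      using mult_right_mono[OF g(2)[of x] norm_ge_zero[of "f x"]] by (simp add: norm_mult mult.commute)
    then show ?thesis by simp
  qed
  then show "AE x in circle_measure. norm (f x * g x) \<le> norm (B * norm (f x))" by simp
qed (use f g in measurable)

context
  fixes f :: "real \<Rightarrow> complex"
  assumes f: "integrable circle_measure f"
    and coeffs: "\<And>n::int. intC (\<lambda>x. f x * cis (of_int n * x)) = 0"
begin

lemma f_meas [measurable]: "measC f" using f by auto

lemma integral_trig_poly: "trig_poly g \<Longrightarrow> integrable circle_measure (\<lambda>x. f x * g x) \<and> intC (\<lambda>x. f x * g x) = 0"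
proof (induction rule: trig_poly.induct)
  case (monomial c n)
  have "integrable circle_measure (\<lambda>x. f x * cis (of_int n * x))"
    by (rule integrable_mult_bounded[OF f, where B = 1]) auto
  then have "integrable circle_measure (\<lambda>x. c * (f x * cis (of_int n * x)))"
    "intC (\<lambda>x. c * (f x * cis (of_int n * x))) = 0"
    using coeffs[of n] by (auto simp del: integrable_mult_left_iff)
  then show ?case by (simp add: mult_ac)
next
  case (add g h)
  then show ?case by (simp add: ring_distribs)
qed

lemma integral_continuous:
  fixes \<phi> :: "complex \<Rightarrow> real"
  assumes \<phi>: "continuous_on UNIV \<phi>"
  shows "intC (\<lambda>x. f x * of_real (\<phi> (cis x))) = 0"
proof -
  have m: "measC (\<lambda>x. complex_of_real (g (cis x)))" if "continuous_on UNIV g" for g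
  proof -
    have "(\<lambda>x. complex_of_real (g (cis x))) \<in> borel_measurable borel"
      by (intro borel_measurable_continuous_onI continuous_intros continuous_on_compose2[OF that]) auto
    then show ?thesis by (simp add: measurable_def sets_circle_measure)
  qed
  let ?I = "\<integral>x. norm (f x) \<partial>circle_measure"
  have le: "norm (intC (\<lambda>x. f x * of_real (\<phi> (cis x)))) \<le> e * ?I" if e: "0 < e" for e
  proof -
    have "compact (sphere (0::complex) 1)" by simp
    from Stone_Weierstrass_real_polynomial_function[OF this continuous_on_subset[OF \<phi> subset_UNIV] e]
    obtain p where p: "real_polynomial_function p" "\<And>z. z \<in> sphere 0 1 \<Longrightarrow> \<bar>\<phi> z - p z\<bar> < e" by blast
    have p': "\<bar>\<phi> (cis x) - p (cis x)\<bar> \<le> e" for x using p(2)[of "cis x"] by simp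
    have pc: "continuous_on UNIV p"
      using p(1) by (simp add: real_polynomial_function_eq continuous_on_polymonial_function)
    let ?d = "\<lambda>x. f x * of_real (\<phi> (cis x) - p (cis x))"
    have d: "integrable circle_measure ?d"
    proof (rule integrable_mult_bounded[OF f])
      show "measC (\<lambda>x. complex_of_real (\<phi> (cis x) - p (cis x)))"
        unfolding of_real_diff by (intro borel_measurable_diff m \<phi> pc)
      show "norm (complex_of_real (\<phi> (cis x) - p (cis x))) \<le> e" for x
        using p'[of x] by (simp add: norm_of_real del: of_real_diff)
    qed
    note tp = integral_trig_poly[OF trig_poly_real_polynomial[OF p(1)]]
    have "intC (\<lambda>x. f x * of_real (\<phi> (cis x))) = intC (\<lambda>x. ?d x + f x * of_real (p (cis x)))"
      by (simp add: algebra_simps)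
    also have "\<dots> = intC ?d" using d tp by (simp add: Bochner_Integration.integral_add del: of_real_diff)
    also have "norm \<dots> \<le> (\<integral>x. norm (?d x) \<partial>circle_measure)" by (rule integral_norm_bound)
    also have "\<dots> \<le> (\<integral>x. e * norm (f x) \<partial>circle_measure)"
    proof (rule integral_mono)
      show "norm (?d x) \<le> e * norm (f x)" for x
        using mult_right_mono[OF p'[of x] norm_ge_zero[of "f x"]]
        by (simp add: norm_mult mult.commute norm_of_real del: of_real_diff)
    qed (use d f in \<open>auto simp del: of_real_diff\<close>)
    finally show ?thesis by simp
  qed
  have "norm (intC (\<lambda>x. f x * of_real (\<phi> (cis x)))) \<le> 0"
  proof (rule field_le_epsilon)
    fix e :: real assume "0 < e"
    then have "norm (intC (\<lambda>x. f x * of_real (\<phi> (cis x)))) \<le> e / (?I + 1) * ?I"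
      by (intro le divide_pos_pos add_nonneg_pos) auto
    also have "\<dots> \<le> e"
    proof -
      have "e / (i + 1) * i \<le> e" if "0 \<le> i" for i :: real
        using that \<open>0 < e\<close> by (simp add: field_simps)
      from this[of ?I] show ?thesis by simp
    qed
    finally show "norm (intC (\<lambda>x. f x * of_real (\<phi> (cis x)))) \<le> 0 + e" by simp
  qed
  then show ?thesis by simp
qed

lemma Arg2pi_cis: "x \<in> {0..<2 * pi} \<Longrightarrow> Arg2pi (cis x) = x"
  by (rule Arg2pi_unique[of 1]) (simp_all add: cis_conv_exp)

text \<open>The indicator of the arc is a limit of continuous functions of the distance to it. The
  strict bound on \<open>b\<close> ensures that no point of the fundamental domain outside the
  interval is mapped into the arc.\<close>

lemma integral_Icc:
  assumes ab: "0 \<le> a" "b < 2 * pi"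
  shows "intC (\<lambda>x. f x * indicator {a..b} x) = 0"
proof (cases "a \<le> b")
  case True
  define C where "C = cis ` {a..b}"
  have C: "compact C" "C \<noteq> {}"
    using True by (auto simp: C_def intro!: compact_continuous_image continuous_intros)
  define \<phi> where "\<phi> n z = max 0 (1 - real n * infdist z C)" for n z
  have \<phi>: "continuous_on UNIV (\<phi> n)" for n
    unfolding \<phi>_def by (intro continuous_intros)
  have \<phi>_le: "\<bar>\<phi> n z\<bar> \<le> 1" for n z
    using mult_nonneg_nonneg[OF of_nat_0_le_iff infdist_nonneg, of n z C] by (simp add: \<phi>_def)
  have [measurable]: "measC (\<lambda>x. complex_of_real (\<phi> n (cis x)))" for n
  proof -
    have "(\<lambda>x. complex_of_real (\<phi> n (cis x))) \<in> borel_measurable borel"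
      by (intro borel_measurable_continuous_onI continuous_intros continuous_on_compose2[OF \<phi>]) auto
    then show ?thesis by (simp add: measurable_def sets_circle_measure)
  qed
  have "(\<lambda>n. intC (\<lambda>x. f x * of_real (\<phi> n (cis x)))) \<longlonglongrightarrow> intC (\<lambda>x. f x * indicator {a..b} x)"
  proof (rule integral_dominated_convergence[where w = "\<lambda>x. norm (f x)"])
    show "AE x in circle_measure. (\<lambda>n. f x * of_real (\<phi> n (cis x))) \<longlonglongrightarrow> f x * indicator {a..b} x"
      using AE_circle
    proof eventually_elim
      case (elim x)
      have "(\<lambda>n. \<phi> n (cis x)) \<longlonglongrightarrow> indicator {a..b} x"
      proof (cases "x \<in> {a..b}")
        case True
        then have "cis x \<in> C" by (simp add: C_def)
        then show ?thesis using True by (simp add: \<phi>_def)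
      next
        case False
        have "cis x \<notin> C"
        proof
          assume "cis x \<in> C"
          then obtain y where y: "y \<in> {a..b}" "cis x = cis y" by (auto simp: C_def)
          then have "y \<in> {0..<2 * pi}" using ab by auto
          from Arg2pi_cis[OF this] have "y = x"
            by (simp only: y(2)[symmetric] Arg2pi_cis[OF elim])
          then show False using y(1) False by blast
        qed
        then have d: "0 < infdist (cis x) C"
          using C by (intro infdist_pos_not_in_closed compact_imp_closed) auto
        obtain m where m: "1 < real m * infdist (cis x) C" using reals_Archimedean3[OF d] by blast
        have "\<phi> n (cis x) = 0" if "m \<le> n" for n
        proof -
          have "real m * infdist (cis x) C \<le> real n * infdist (cis x) C"
            using that d by (intro mult_right_mono) auto
          then show ?thesis using m by (simp add: \<phi>_def)
        qed
        then have "\<forall>\<^sub>F n in sequentially. \<phi> n (cis x) = 0"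
          unfolding eventually_sequentially by (intro exI[of _ m]) simp
        then show ?thesis using False by (simp add: tendsto_eventually)
      qed
      then have "(\<lambda>n. complex_of_real (\<phi> n (cis x))) \<longlonglongrightarrow> complex_of_real (indicator {a..b} x)"
        by (rule tendsto_of_real)
      also have "complex_of_real (indicator {a..b} x) = indicator {a..b} x" by (simp add: indicator_def)
      finally show ?case by (intro tendsto_mult tendsto_const)
    qed
    show "AE x in circle_measure. norm (f x * of_real (\<phi> n (cis x))) \<le> norm (f x)" for n
    proof (rule AE_I2)
      show "norm (f x * of_real (\<phi> n (cis x))) \<le> norm (f x)" for x
        using mult_left_mono[OF \<phi>_le[of n "cis x"] norm_ge_zero[of "f x"]] by (simp add: norm_mult)
    qed
  qed (use f in \<open>auto simp: sets_circle_measure\<close>)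
  then have "(\<lambda>n::nat. 0) \<longlonglongrightarrow> intC (\<lambda>x. f x * indicator {a..b} x)"
    by (simp add: integral_continuous[OF \<phi>])
  then show ?thesis by (simp add: LIMSEQ_const_iff)
qed simp

lemma integral_Ioi: "intC (\<lambda>x. f x * indicator {a<..} x) = 0"
proof -
  define I where "I n = {max 0 (a + 1 / real (Suc n))..2 * pi - 1 / real (Suc n)}" for n
  have "(\<lambda>n. intC (\<lambda>x. f x * indicator (I n) x)) \<longlonglongrightarrow> intC (\<lambda>x. f x * indicator {a<..} x)"
  proof (rule integral_dominated_convergence[where w = "\<lambda>x. norm (f x)"])
    show "AE x in circle_measure. (\<lambda>n. f x * indicator (I n) x) \<longlonglongrightarrow> f x * indicator {a<..} x"
      using AE_circle
    proof eventually_elim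
      case (elim x)
      have inv: "(\<lambda>n. 1 / real (Suc n)) \<longlonglongrightarrow> 0"
        using LIMSEQ_inverse_real_of_nat by (simp add: inverse_eq_divide)
      have "\<forall>\<^sub>F n in sequentially. (indicator (I n) x :: complex) = indicator {a<..} x"
      proof (cases "a < x")
        case True
        have "\<forall>\<^sub>F n in sequentially. 1 / real (Suc n) < x - a"
          using True by (intro order_tendstoD[OF inv]) auto
        moreover have "\<forall>\<^sub>F n in sequentially. 1 / real (Suc n) < 2 * pi - x"
          using elim by (intro order_tendstoD[OF inv]) auto
        ultimately show ?thesis
          by eventually_elim (use True elim in \<open>auto simp: I_def\<close>)
      next
        case False
        have "x \<notin> I n" for n
        proof
          assume "x \<in> I n"
          then have "a + 1 / real (Suc n) \<le> x" by (simp add: I_def)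
          moreover have "0 < 1 / real (Suc n)" by simp
          ultimately show False using False by linarith
        qed
        then show ?thesis using False by simp
      qed
      then show ?case by (intro tendsto_mult tendsto_const tendsto_eventually)
    qed
    show "AE x in circle_measure. norm (f x * indicator (I n) x) \<le> norm (f x)" for n
      by (simp add: norm_mult indicator_def)
  qed (use f in \<open>auto simp: I_def sets_circle_measure\<close>)
  moreover have "intC (\<lambda>x. f x * indicator (I n) x) = 0" for n
    unfolding I_def by (rule integral_Icc) (auto intro: pos_divide_less_eq[THEN iffD2])
  ultimately have "(\<lambda>n::nat. 0) \<longlonglongrightarrow> intC (\<lambda>x. f x * indicator {a<..} x)" by simp
  then show ?thesis by (simp add: LIMSEQ_const_iff)
qed

end

text \<open>Half-lines determine the measures. Since \<open>ennreal\<close> truncates negative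
  values to 0, the densities of \<open>h\<close> and \<open>- h\<close> are its positive and
  negative parts, and equality of the two measures makes both vanish.\<close>

lemma AE_zero_of_integral_Ioi:
  fixes h :: "real \<Rightarrow> real"
  assumes h: "integrable circle_measure h"
    and 0: "\<And>a. (\<integral>x. h x * indicator {a<..} x \<partial>circle_measure) = 0"
  shows "AE x in circle_measure. h x = 0"
proof -
  have [measurable]: "h \<in> borel_measurable circle_measure" using h by auto
  have ioi [measurable]: "{a<..} \<in> sets circle_measure" for a :: real by (simp add: sets_circle_measure)
  have int: "integrable circle_measure (\<lambda>x. max 0 (g x) * indicator {a<..} x)"
    if "integrable circle_measure g" for g :: "real \<Rightarrow> real" and a
    using that by (intro integrable_real_mult_indicator) auto
  have em: "emeasure (density circle_measure (\<lambda>x. ennreal (g x))) {a<..}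
      = ennreal (\<integral>x. max 0 (g x) * indicator {a<..} x \<partial>circle_measure)"
    if g: "integrable circle_measure g" for g a
  proof -
    have "emeasure (density circle_measure (\<lambda>x. ennreal (g x))) {a<..}
        = (\<integral>\<^sup>+x. ennreal (g x) * indicator {a<..} x \<partial>circle_measure)"
      using g by (intro emeasure_density) auto
    also have "\<dots> = (\<integral>\<^sup>+x. ennreal (max 0 (g x) * indicator {a<..} x) \<partial>circle_measure)"
      by (intro nn_integral_cong) (auto simp: indicator_def max_def ennreal_neg)
    also have "\<dots> = ennreal (\<integral>x. max 0 (g x) * indicator {a<..} x \<partial>circle_measure)"
      by (intro nn_integral_eq_integral int g) (auto simp: indicator_def)
    finally show ?thesis .
  qed
  have mh: "integrable circle_measure (\<lambda>x. - h x)" using h by simp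
  have "density circle_measure (\<lambda>x. ennreal (h x)) = density circle_measure (\<lambda>x. ennreal (- h x))"
  proof (rule measure_eqI_lessThan)
    fix a
    have "(\<integral>x. max 0 (h x) * indicator {a<..} x \<partial>circle_measure)
        - (\<integral>x. max 0 (- h x) * indicator {a<..} x \<partial>circle_measure)
        = (\<integral>x. max 0 (h x) * indicator {a<..} x - max 0 (- h x) * indicator {a<..} x \<partial>circle_measure)"
      by (rule Bochner_Integration.integral_diff[symmetric]) (intro int h mh)+
    also have "\<dots> = (\<integral>x. h x * indicator {a<..} x \<partial>circle_measure)"
      by (intro Bochner_Integration.integral_cong) (auto simp: max_def)
    finally have "(\<integral>x. max 0 (h x) * indicator {a<..} x \<partial>circle_measure)
        = (\<integral>x. max 0 (- h x) * indicator {a<..} x \<partial>circle_measure)" using 0 by simp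
    then show "emeasure (density circle_measure (\<lambda>x. ennreal (h x))) {a<..}
        = emeasure (density circle_measure (\<lambda>x. ennreal (- h x))) {a<..}"
      by (simp only: em[OF h] em[OF mh])
    show "emeasure (density circle_measure (\<lambda>x. ennreal (h x))) {a<..} < \<infinity>"
      by (simp add: em[OF h])
  qed (simp_all add: sets_circle_measure)
  then have "AE x in circle_measure. ennreal (h x) = ennreal (- h x)"
    by (subst (asm) circle.density_unique_iff) auto
  then show ?thesis
  proof eventually_elim
    case (elim x)
    then show ?case
      by (cases "0 \<le> h x") (auto simp: ennreal_neg ennreal_eq_0_iff dest: sym)
  qed
qed

text \<open>An L^1 statement: the integrals of \<open>f\<close> against half-lines vanish by
  approximation, and its real and imaginary parts are then treated separately.\<close>

theorem fourier_completeness: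
  assumes f: "integrable circle_measure f"
    and coeffs: "\<And>n::int. intC (\<lambda>x. f x * cis (of_int n * x)) = 0"
  shows "AE x in circle_measure. f x = 0"
proof -
  have int: "integrable circle_measure (\<lambda>x. f x * indicator {a<..} x)" for a
    by (rule integrable_mult_bounded[OF f, where B = 1]) (auto simp: sets_circle_measure indicator_def)
  have "AE x in circle_measure. Re (f x) = 0"
  proof (rule AE_zero_of_integral_Ioi)
    fix a
    have "(\<integral>x. Re (f x) * indicator {a<..} x \<partial>circle_measure) = Re (intC (\<lambda>x. f x * indicator {a<..} x))"
      by (subst integral_Re[OF int, symmetric]) (intro Bochner_Integration.integral_cong, auto simp: indicator_def)
    then show "(\<integral>x. Re (f x) * indicator {a<..} x \<partial>circle_measure) = 0"
      by (simp add: integral_Ioi[OF f coeffs])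
  qed (use f in simp)
  moreover have "AE x in circle_measure. Im (f x) = 0"
  proof (rule AE_zero_of_integral_Ioi)
    fix a
    have "(\<integral>x. Im (f x) * indicator {a<..} x \<partial>circle_measure) = Im (intC (\<lambda>x. f x * indicator {a<..} x))"
      by (subst integral_Im[OF int, symmetric]) (intro Bochner_Integration.integral_cong, auto simp: indicator_def)
    then show "(\<integral>x. Im (f x) * indicator {a<..} x \<partial>circle_measure) = 0"
      by (simp add: integral_Ioi[OF f coeffs])
  qed (use f in simp)
  ultimately show ?thesis by eventually_elim (simp add: complex_eq_iff)
qed

subsection \<open>Riesz--Fischer\<close>

definition trig_sum :: "(nat \<Rightarrow> complex) \<Rightarrow> nat set \<Rightarrow> real \<Rightarrow> complex" where
  "trig_sum c S t = (\<Sum>k\<in>S. c k * cis (of_int (int k) * t))"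

lemma trig_sum_measurable [measurable]: "measC (trig_sum c S)"
  unfolding trig_sum_def[abs_def] by measurable

lemma norm_trig_sum_le: "norm (trig_sum c S t) \<le> (\<Sum>k\<in>S. norm (c k))"
  unfolding trig_sum_def by (rule order_trans[OF norm_sum]) (simp add: norm_mult)

lemma sqC_trig_sum: "sqC (trig_sum c S)"
  by (rule sqC_bounded[OF trig_sum_measurable norm_trig_sum_le])

lemma integral_trig_sum_sq:
  assumes "finite S"
  shows "(\<integral>t. (norm (trig_sum c S t))\<^sup>2 \<partial>circle_measure) = (\<Sum>k\<in>S. (norm (c k))\<^sup>2)"
proof -
  have int: "integrable circle_measure (\<lambda>t. a * cis (of_int n * t))" for a n
    using sqC_integrable[OF sqC_scale[OF sqC_cis]] .
  have eq: "complex_of_real ((norm (trig_sum c S t))\<^sup>2)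
      = (\<Sum>j\<in>S. \<Sum>k\<in>S. (c j * cnj (c k)) * cis (of_int (int j - int k) * t))" for t
  proof -
    have "cis (of_int (int j - int k) * t) = cis (of_int (int j) * t) * cnj (cis (of_int (int k) * t))" for j k
      by (simp add: cis_cnj cis_mult algebra_simps)
    then show ?thesis
      unfolding complex_norm_square trig_sum_def cnj_sum sum_product
      by (intro sum.cong refl) (simp add: mult_ac)
  qed
  have "complex_of_real (\<integral>t. (norm (trig_sum c S t))\<^sup>2 \<partial>circle_measure)
      = intC (\<lambda>t. complex_of_real ((norm (trig_sum c S t))\<^sup>2))"
    by (rule integral_complex_of_real[symmetric])
  also have "\<dots> = (\<Sum>j\<in>S. \<Sum>k\<in>S. (c j * cnj (c k)) * intC (\<lambda>t. cis (of_int (int j - int k) * t)))"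
    unfolding eq by (subst Bochner_Integration.integral_sum; (intro Bochner_Integration.integrable_sum int)?)
      (intro sum.cong refl, subst Bochner_Integration.integral_sum; (intro int)?; simp)
  also have "\<dots> = (\<Sum>j\<in>S. \<Sum>k\<in>S. if k = j then c j * cnj (c k) else 0)"
    unfolding intC_cis by (intro sum.cong refl) auto
  also have "\<dots> = of_real (\<Sum>k\<in>S. (norm (c k))\<^sup>2)"
    using assms by (simp add: complex_norm_square del: of_real_power)
  finally show ?thesis by (simp only: of_real_eq_iff)
qed

lemma trig_sum_diff: "n \<le> m \<Longrightarrow> trig_sum c {..<m} t - trig_sum c {..<n} t = trig_sum c {n..<m} t"
  unfolding trig_sum_def using sum_diff_nat_ivl[of 0 n m "\<lambda>k. c k * cis (of_int (int k) * t)"]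
  by (simp add: lessThan_atLeast0)

lemma sum_tail_le: "(\<Sum>k\<in>{n..<m}. (norm (coef x k))\<^sup>2) \<le> (norm ((shl ^^ n) x))\<^sup>2"
proof (cases "n \<le> m")
  case True
  have "(\<Sum>k\<in>{n..<m}. (norm (coef x k))\<^sup>2) = (\<Sum>k<m-n. (norm (coef ((shl ^^ n) x) k))\<^sup>2)"
    using sum.shift_bounds_nat_ivl[of "\<lambda>k. (norm (coef x k))\<^sup>2" 0 n "m - n"] True
    by (simp add: lessThan_atLeast0 add.commute)
  also have "\<dots> \<le> (norm ((shl ^^ n) x))\<^sup>2" by (rule sum_coef_le_norm)
  finally show ?thesis .
qed simp

text \<open>A subsequence of partial sums with geometrically small blocks converges almost
  everywhere, and Fatou's lemma gives the error bound. Square integrability of the limit is the case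
  \<open>n = 0\<close>, where the partial sum is empty.\<close>

theorem riesz_fischer:
  fixes x :: ell2
  shows "\<exists>v. sqC v \<and> (\<forall>n. (\<integral>t. (norm (v t - trig_sum (coef x) {..<n} t))\<^sup>2 \<partial>circle_measure) \<le> (norm ((shl ^^ n) x))\<^sup>2)"
proof -
  have "\<exists>N. \<forall>n\<ge>N. norm ((shl ^^ n) x) \<le> (1/2) ^ k" for k
  proof -
    have "\<forall>\<^sub>F n in sequentially. norm ((shl ^^ n) x) < (1/2) ^ k"
      by (rule order_tendstoD[OF norm_shl_pow_tendsto]) simp
    then show ?thesis unfolding eventually_sequentially using less_imp_le by metis
  qed
  then obtain N where N: "\<And>k n. n \<ge> N k \<Longrightarrow> norm ((shl ^^ n) x) \<le> (1/2) ^ k" by metis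
  \<comment> \<open>Adding up the thresholds makes \<open>r\<close> monotone while it dominates both
    \<open>N k\<close> and \<open>k\<close>.\<close>
  define r where "r k = (\<Sum>j\<le>k. N j) + k" for k
  have r: "N k \<le> r k" "k \<le> r k" "r k \<le> r (Suc k)" for k
    by (auto simp: r_def intro: trans_le_add1 member_le_sum)
  let ?s = "\<lambda>n. trig_sum (coef x) {..<n}"
  define b where "b k = trig_sum (coef x) {r k..<r (Suc k)}" for k
  have s_eq: "?s (r k) t = ?s (r 0) t + (\<Sum>j<k. b j t)" for k t
  proof (induction k)
    case (Suc k)
    have "?s (r (Suc k)) t = ?s (r k) t + b k t"
      using trig_sum_diff[OF r(3), of "coef x" k t] by (simp add: b_def algebra_simps)
    then show ?case using Suc by simp
  qed simp
  have b_sq: "sqC (b k)" for k unfolding b_def by (rule sqC_trig_sum)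
  have b_le: "(\<integral>t. norm (b k t) \<partial>circle_measure) \<le> (1/2) ^ k" for k
  proof -
    have m1: "measure circle_measure UNIV = 1"
      by (simp add: measure_def emeasure_circle_measure_UNIV)
    have "(\<integral>t. norm (b k t) \<partial>circle_measure) \<le> sqrt (\<integral>t. (norm (b k t))\<^sup>2 \<partial>circle_measure)"
      using integral_norm_mult_le[OF b_sq sqC_bounded[of "\<lambda>_. 1" 1], of k] by (simp add: m1)
    also have "(\<integral>t. (norm (b k t))\<^sup>2 \<partial>circle_measure) = (\<Sum>j\<in>{r k..<r (Suc k)}. (norm (coef x j))\<^sup>2)"
      unfolding b_def by (rule integral_trig_sum_sq) simp
    also have "sqrt \<dots> \<le> norm ((shl ^^ (r k)) x)"
      using real_sqrt_le_mono[OF sum_tail_le[of x "r k" "r (Suc k)"]] by simp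
    also have "\<dots> \<le> (1/2) ^ k" by (rule N[OF r(1)])
    finally show ?thesis by simp
  qed
  have b_meas [measurable]: "measC (b k)" for k using b_sq by auto
  have "AE t in circle_measure. (\<Sum>k. ennreal (norm (b k t))) \<noteq> \<infinity>"
  proof (rule nn_integral_PInf_AE)
    have "(\<integral>\<^sup>+t. (\<Sum>k. ennreal (norm (b k t))) \<partial>circle_measure) = (\<Sum>k. \<integral>\<^sup>+t. ennreal (norm (b k t)) \<partial>circle_measure)"
      by (rule nn_integral_suminf) measurable
    also have "\<dots> = (\<Sum>k. ennreal (\<integral>t. norm (b k t) \<partial>circle_measure))"
      using sqC_integrable[OF b_sq] by (intro arg_cong[where f = suminf] ext nn_integral_eq_integral) auto
    also have "\<dots> \<le> (\<Sum>k. ennreal ((1/2) ^ k))"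
      by (intro suminf_le ennreal_leI b_le) auto
    also have "\<dots> = ennreal (\<Sum>k. (1/2) ^ k)"
      by (rule suminf_ennreal2) (simp_all add: summable_geometric)
    also have "\<dots> < \<infinity>" by simp
    finally show "(\<integral>\<^sup>+t. (\<Sum>k. ennreal (norm (b k t))) \<partial>circle_measure) \<noteq> \<infinity>" by simp
  qed measurable
  then have conv: "AE t in circle_measure. convergent (\<lambda>k. ?s (r k) t)"
  proof eventually_elim
    case (elim t)
    have "summable (\<lambda>k. norm (b k t))" by (rule summable_suminf_not_top) (use elim in auto)
    then have "summable (\<lambda>k. b k t)" by (rule summable_norm_cancel)
    then have "(\<lambda>k. ?s (r 0) t + (\<Sum>j<k. b j t)) \<longlonglongrightarrow> ?s (r 0) t + (\<Sum>j. b j t)"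
      by (intro tendsto_add tendsto_const summable_LIMSEQ)
    then show ?case unfolding s_eq[symmetric] by (auto simp: convergent_def)
  qed
  define v where "v t = lim (\<lambda>k. ?s (r k) t)" for t
  have v_meas [measurable]: "measC v"
    unfolding v_def[abs_def] by (rule borel_measurable_lim_metric) measurable
  have v_lim: "AE t in circle_measure. (\<lambda>k. ?s (r k) t) \<longlonglongrightarrow> v t"
    using conv by eventually_elim (simp add: v_def convergent_LIMSEQ_iff)
  have nn: "(\<integral>\<^sup>+t. ennreal ((norm (v t - ?s n t))\<^sup>2) \<partial>circle_measure) \<le> ennreal ((norm ((shl ^^ n) x))\<^sup>2)" for n
  proof -
    have "(\<integral>\<^sup>+t. ennreal ((norm (v t - ?s n t))\<^sup>2) \<partial>circle_measure)
        = (\<integral>\<^sup>+t. liminf (\<lambda>k. ennreal ((norm (?s (r k) t - ?s n t))\<^sup>2)) \<partial>circle_measure)"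
    proof (rule nn_integral_cong_AE, use v_lim in eventually_elim)
      case (elim t)
      then have "(\<lambda>k. ennreal ((norm (?s (r k) t - ?s n t))\<^sup>2)) \<longlonglongrightarrow> ennreal ((norm (v t - ?s n t))\<^sup>2)"
        by (intro tendsto_intros)
      then show ?case by (rule lim_imp_Liminf[OF sequentially_bot, symmetric])
    qed
    also have "\<dots> \<le> liminf (\<lambda>k. \<integral>\<^sup>+t. ennreal ((norm (?s (r k) t - ?s n t))\<^sup>2) \<partial>circle_measure)"
      by (rule nn_integral_liminf) measurable
    also have "\<dots> \<le> liminf (\<lambda>k. ennreal ((norm ((shl ^^ n) x))\<^sup>2))"
    proof (rule Liminf_mono)
      show "\<forall>\<^sub>F k in sequentially. (\<integral>\<^sup>+t. ennreal ((norm (?s (r k) t - ?s n t))\<^sup>2) \<partial>circle_measure)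
          \<le> ennreal ((norm ((shl ^^ n) x))\<^sup>2)"
        using eventually_ge_at_top[of n]
      proof eventually_elim
        case (elim k)
        then have nr: "n \<le> r k" using r(2)[of k] by simp
        have "(\<integral>\<^sup>+t. ennreal ((norm (?s (r k) t - ?s n t))\<^sup>2) \<partial>circle_measure)
            = ennreal (\<integral>t. (norm (trig_sum (coef x) {n..<r k} t))\<^sup>2 \<partial>circle_measure)"
          unfolding trig_sum_diff[OF nr] using sqC_trig_sum
          by (intro nn_integral_eq_integral) (auto simp: sqC_def)
        also have "\<dots> \<le> ennreal ((norm ((shl ^^ n) x))\<^sup>2)"
          by (intro ennreal_leI) (simp add: integral_trig_sum_sq sum_tail_le)
        finally show ?case .
      qed
    qed
    also have "\<dots> = ennreal ((norm ((shl ^^ n) x))\<^sup>2)" by (simp add: Liminf_const)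
    finally show ?thesis .
  qed
  have int: "integrable circle_measure (\<lambda>t. (norm (v t - ?s n t))\<^sup>2)" for n
    using le_less_trans[OF nn ennreal_less_top, of n]
    by (intro integrableI_bounded) auto
  have "(\<integral>t. (norm (v t - ?s n t))\<^sup>2 \<partial>circle_measure) \<le> (norm ((shl ^^ n) x))\<^sup>2" for n
    using nn[of n] unfolding nn_integral_eq_integral[OF int, simplified] by (simp add: ennreal_le_iff)
  moreover have "sqC v" unfolding sqC_def using int[of 0] by (simp add: trig_sum_def)
  ultimately show ?thesis by blast
qed

section \<open>Square integrable functions modulo null sets\<close>

lemma measC_cnj: "measC f \<Longrightarrow> measC (\<lambda>x. cnj (f x))"
  by (rule measurable_compose[of f _ borel]) (auto intro: borel_measurable_continuous_onI continuous_intros)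

lemma ae_eq_self: "ae_eq f f \<longleftrightarrow> measC f" by (simp add: ae_eq_def)

lemma L2_iff: "f \<in> L2 \<longleftrightarrow> square_integrable f" by (simp add: L2_def)

lemma L2_0 [simp]: "0 \<in> L2"
  unfolding L2_iff by transfer simp

lemma L2_add: "f \<in> L2 \<Longrightarrow> g \<in> L2 \<Longrightarrow> f + g \<in> L2"
  unfolding L2_iff by transfer (use sqC_add in \<open>auto simp: sqC_def ae_eq_self\<close>)

lemma L2_scaleT: "f \<in> L2 \<Longrightarrow> scaleT c f \<in> L2"
  unfolding L2_iff by transfer (use sqC_scale in \<open>auto simp: sqC_def ae_eq_self\<close>)

lemma L2_cnjT: "f \<in> L2 \<Longrightarrow> cnjT f \<in> L2"
  unfolding L2_iff by transfer simp

lemma L2_expT_mult: "f \<in> L2 \<Longrightarrow> expT n * f \<in> L2"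
  unfolding L2_iff by transfer (simp add: norm_mult)

lemma L2_expT [simp]: "expT n \<in> L2"
  unfolding L2_iff by transfer (use sqC_cis in \<open>auto simp: sqC_def\<close>)

lemma minus_eq_scaleT: "- f = scaleT (-1) f"
  by transfer (auto simp: ae_eq_def)

lemma L2_diff: "f \<in> L2 \<Longrightarrow> g \<in> L2 \<Longrightarrow> f - g \<in> L2"
  using L2_add[OF _ L2_scaleT[of g "-1"], of f] by (simp flip: minus_eq_scaleT)

lemma L2_sum: "(\<And>i. i \<in> S \<Longrightarrow> f i \<in> L2) \<Longrightarrow> sum f S \<in> L2"
  by (induction S rule: infinite_finite_induct) (auto intro: L2_add)

lemma cnjT_cnjT [simp]: "cnjT (cnjT f) = f"
  by transfer simp

lemma cnjT_mult [simp]: "cnjT (f * g) = cnjT f * cnjT g"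
  by transfer (simp, simp only: ae_eq_self, intro borel_measurable_times measC_cnj, simp_all)

lemma cnjT_expT [simp]: "cnjT (expT n) = expT (- n)"
proof transfer
  fix n :: int
  show "ae_eq (\<lambda>x. cnj (cis (real_of_int n * x))) (\<lambda>x. cis (real_of_int (- n) * x))"
    using measurable_cis_circle[of "- real_of_int n"] by (simp add: cis_cnj ae_eq_self)
qed

lemma expT_add: "expT m * expT n = expT (m + n)"
  by transfer (simp add: cis_mult ring_distribs(2)[symmetric] ae_eq_self del: of_int_add flip: of_int_add)

lemma innerT_add_left:
  assumes "f \<in> L2" "g \<in> L2" "h \<in> L2"
  shows "innerT (f + g) h = innerT f h + innerT g h"
  using assms unfolding innerT_def L2_iff
proof transfer
  fix f g h
  assume m: "ae_eq f f" "ae_eq g g" "ae_eq h h" and i: "integrable circle_measure (\<lambda>x. (norm (f x))\<^sup>2)"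
    "integrable circle_measure (\<lambda>x. (norm (g x))\<^sup>2)" "integrable circle_measure (\<lambda>x. (norm (h x))\<^sup>2)"
  then have "sqC f" "sqC g" "sqC (\<lambda>x. cnj (h x))" by (auto simp: ae_eq_self sqC_def measC_cnj)
  from sqC_integrable_mult[OF this(1,3)] sqC_integrable_mult[OF this(2,3)]
  show "intC (\<lambda>x. (f x + g x) * cnj (h x)) = intC (\<lambda>x. f x * cnj (h x)) + intC (\<lambda>x. g x * cnj (h x))"
    by (simp add: ring_distribs)
qed

lemma innerT_scaleT_left: "innerT (scaleT c f) h = c * innerT f h"
  unfolding innerT_def by transfer (simp add: mult.assoc)

lemma innerT_commute: "innerT g f = cnj (innerT f g)"
  unfolding innerT_def
proof transfer
  fix f g :: "real \<Rightarrow> complex"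
  show "intC (\<lambda>x. g x * cnj (f x)) = cnj (intC (\<lambda>x. f x * cnj (g x)))"
    unfolding Bochner_Integration.integral_cnj[symmetric] by (simp add: mult.commute)
qed

lemma innerT_minus_left: "innerT (- f) h = - innerT f h"
  by (simp only: minus_eq_scaleT innerT_scaleT_left) simp

lemma innerT_diff_left:
  assumes "f \<in> L2" "g \<in> L2" "h \<in> L2"
  shows "innerT (f - g) h = innerT f h - innerT g h"
  using innerT_add_left[OF assms(1) L2_scaleT[OF assms(2), of "-1"] assms(3)]
  by (simp add: innerT_minus_left flip: minus_eq_scaleT)

lemma innerT_0_left: "innerT 0 h = 0"
  using innerT_scaleT_left[of 0 0 h] by simp

lemma innerT_sum_left:
  assumes "h \<in> L2" "\<And>i. i \<in> S \<Longrightarrow> f i \<in> L2"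
  shows "innerT (sum f S) h = (\<Sum>i\<in>S. innerT (f i) h)"
  using assms(2)
  by (induction S rule: infinite_finite_induct) (auto simp: innerT_0_left innerT_add_left L2_sum assms(1))

lemma normL2_sq: "innerT f f = of_real ((normL2 f)\<^sup>2)"
proof -
  have "innerT f f = of_real (Re (innerT f f)) \<and> 0 \<le> Re (innerT f f)"
    unfolding innerT_def
  proof transfer
    fix f :: "real \<Rightarrow> complex"
    have "intC (\<lambda>x. f x * cnj (f x)) = of_real (\<integral>x. (norm (f x))\<^sup>2 \<partial>circle_measure)"
      by (simp add: complex_norm_square[symmetric] integral_complex_of_real del: of_real_power)
    then show "intC (\<lambda>x. f x * cnj (f x)) = of_real (Re (intC (\<lambda>x. f x * cnj (f x)))) \<and> 0 \<le> Re (intC (\<lambda>x. f x * cnj (f x)))"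
      by simp
  qed
  then show ?thesis by (simp add: normL2_def)
qed

lemma normL2_nonneg: "0 \<le> normL2 f"
  using normL2_sq[of f] by (simp add: normL2_def) (metis Re_complex_of_real normL2_def normL2_sq zero_le_power2)

lemma norm_innerT_le: "f \<in> L2 \<Longrightarrow> g \<in> L2 \<Longrightarrow> norm (innerT f g) \<le> normL2 f * normL2 g"
  unfolding normL2_def innerT_def L2_iff
proof transfer
  fix f g
  assume m: "ae_eq f f" "ae_eq g g" and i: "integrable circle_measure (\<lambda>x. (norm (f x))\<^sup>2)"
    "integrable circle_measure (\<lambda>x. (norm (g x))\<^sup>2)"
  then have fg: "sqC f" "sqC g" by (auto simp: ae_eq_self sqC_def)
  have eq: "Re (intC (\<lambda>x. f x * cnj (f x))) = (\<integral>x. (norm (f x))\<^sup>2 \<partial>circle_measure)" for f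
    by (simp add: complex_norm_square[symmetric] integral_complex_of_real del: of_real_power)
  have "norm (intC (\<lambda>x. f x * cnj (g x))) \<le> (\<integral>x. norm (f x * cnj (g x)) \<partial>circle_measure)"
    by (rule integral_norm_bound)
  also have "\<dots> = (\<integral>x. norm (f x) * norm (g x) \<partial>circle_measure)" by (simp add: norm_mult)
  also note integral_norm_mult_le[OF fg]
  finally show "norm (intC (\<lambda>x. f x * cnj (g x)))
      \<le> sqrt (Re (intC (\<lambda>x. f x * cnj (f x)))) * sqrt (Re (intC (\<lambda>x. g x * cnj (g x))))"
    by (simp only: eq)
qed

lemma fourier_innerT: "fourier f n = innerT f (expT n)"
  by (simp add: fourier_def innerT_def)

lemma fourier_expT: "fourier (expT m) n = (if m = n then 1 else 0)"
proof -
  have "fourier (expT m) n = integralT (expT (m - n))"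
    by (simp add: fourier_def expT_add)
  also have "\<dots> = (if m - n = 0 then 1 else 0)"
    by transfer (rule intC_cis)
  finally show ?thesis by simp
qed

lemma fourier_add: "f \<in> L2 \<Longrightarrow> g \<in> L2 \<Longrightarrow> fourier (f + g) n = fourier f n + fourier g n"
  by (simp add: fourier_innerT innerT_add_left)

lemma fourier_diff: "f \<in> L2 \<Longrightarrow> g \<in> L2 \<Longrightarrow> fourier (f - g) n = fourier f n - fourier g n"
  by (simp add: fourier_innerT innerT_diff_left)

lemma fourier_scaleT: "fourier (scaleT c f) n = c * fourier f n"
  by (simp add: fourier_innerT innerT_scaleT_left)

lemma norm_fourier_le: "f \<in> L2 \<Longrightarrow> norm (fourier f n) \<le> normL2 f"
proof -
  assume f: "f \<in> L2"
  have "normL2 (expT n) = 1"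
  proof -
    have "complex_of_real ((normL2 (expT n))\<^sup>2) = 1"
      using fourier_expT[of n n] by (simp only: normL2_sq[symmetric] fourier_innerT) simp
    then have "(normL2 (expT n))\<^sup>2 = 1" by (simp only: of_real_eq_1_iff)
    then show ?thesis using normL2_nonneg[of "expT n"] by (auto simp: power2_eq_1_iff)
  qed
  then show ?thesis using norm_innerT_le[OF f L2_expT, of n] by (simp add: fourier_innerT)
qed

lemma L2_eq_0:
  assumes "f \<in> L2" "\<And>n. fourier f n = 0"
  shows "f = 0"
  using assms unfolding L2_iff fourier_def
proof transfer
  fix f
  assume f: "ae_eq f f" "integrable circle_measure (\<lambda>x. (norm (f x))\<^sup>2)"
    "\<And>n. intC (\<lambda>x. f x * cis (real_of_int (- n) * x)) = 0"
  then have "sqC f" by (auto simp: ae_eq_self sqC_def)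
  then have "AE x in circle_measure. f x = 0"
    using f(3)[of "- n" for n] by (intro fourier_completeness sqC_integrable) auto
  then show "ae_eq f (\<lambda>_. 0)" using f(1) by (simp add: ae_eq_def)
qed

lemma L2_eqI:
  assumes "f \<in> L2" "g \<in> L2" "\<And>n. fourier f n = fourier g n"
  shows "f = g"
  using L2_eq_0[OF L2_diff[OF assms(1,2)]] assms by (simp add: fourier_diff)

definition psum :: "(nat \<Rightarrow> complex) \<Rightarrow> nat \<Rightarrow> tfun" where
  "psum c n = (\<Sum>k<n. scaleT (c k) (expT (int k)))"

lemma L2_psum [simp]: "psum c n \<in> L2"
  unfolding psum_def by (intro L2_sum L2_scaleT L2_expT)

lemma fourier_psum: "fourier (psum c n) m = (if 0 \<le> m \<and> m < int n then c (nat m) else 0)"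
proof -
  have "fourier (psum c n) m = (\<Sum>k<n. c k * fourier (expT (int k)) m)"
    unfolding psum_def fourier_innerT
    by (subst innerT_sum_left) (auto intro: L2_scaleT simp: innerT_scaleT_left)
  also have "\<dots> = (\<Sum>k<n. if k = nat m \<and> 0 \<le> m then c k else 0)"
    by (intro sum.cong) (auto simp: fourier_expT)
  also have "\<dots> = (if 0 \<le> m \<and> m < int n then c (nat m) else 0)"
    by (cases "0 \<le> m") (auto simp: nat_less_iff)
  finally show ?thesis .
qed

lemma innerT_psum_left: "f \<in> L2 \<Longrightarrow> innerT (psum c n) f = (\<Sum>k<n. c k * cnj (fourier f (int k)))"
  unfolding psum_def
  by (subst innerT_sum_left)
    (auto intro: L2_scaleT simp: innerT_scaleT_left fourier_innerT innerT_commute[of "expT _"])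

text \<open>Partial sums as classes of explicit functions, the form in which they can be compared
  with the representative from \<open>riesz_fischer\<close>.\<close>

lift_definition trigT :: "(nat \<Rightarrow> complex) \<Rightarrow> nat set \<Rightarrow> tfun" is trig_sum
  by (simp add: ae_eq_self)

lemma psum_eq_trigT: "psum c n = trigT c {..<n}"
proof (induction n)
  case 0
  show ?case unfolding psum_def by (simp, transfer) (simp add: trig_sum_def[abs_def] ae_eq_self)
next
  case (Suc n)
  have "trigT c {..<Suc n} = trigT c {..<n} + scaleT (c n) (expT (int n))"
  proof transfer
    fix c :: "nat \<Rightarrow> complex" and n
    have "trig_sum c {..<Suc n} = (\<lambda>x. trig_sum c {..<n} x + c n * cis (real_of_int (int n) * x))"
      by (simp add: trig_sum_def fun_eq_iff)
    then show "ae_eq (trig_sum c {..<Suc n}) (\<lambda>x. trig_sum c {..<n} x + c n * cis (real_of_int (int n) * x))"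
      using trig_sum_measurable[of c "{..<Suc n}"] by (simp add: ae_eq_self)
  qed
  then show ?case using Suc by (simp add: psum_def)
qed

lift_definition int_sq :: "tfun \<Rightarrow> real" is "\<lambda>f. \<integral>x. (norm (f x))\<^sup>2 \<partial>circle_measure"
proof -
  fix f g :: "real \<Rightarrow> complex"
  assume "ae_eq f g"
  then have [measurable]: "measC f" "measC g" and ae: "AE x in circle_measure. f x = g x"
    by (auto simp: ae_eq_def)
  show "(\<integral>x. (norm (f x))\<^sup>2 \<partial>circle_measure) = (\<integral>x. (norm (g x))\<^sup>2 \<partial>circle_measure)"
    by (rule integral_cong_AE) (use ae in auto)
qed

lemma int_sq_eq: "int_sq f = (normL2 f)\<^sup>2"
proof -
  have "innerT f f = of_real (int_sq f)"
    unfolding innerT_def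
    by transfer (simp add: complex_norm_square[symmetric] integral_complex_of_real del: of_real_power)
  then show ?thesis unfolding normL2_sq by (simp only: of_real_eq_iff)
qed

lemma riesz_fischer_tfun: "\<exists>v\<in>L2. \<forall>n. normL2 (v - psum (coef x) n) \<le> norm ((shl ^^ n) x)"
proof -
  obtain V where V: "sqC V" "\<And>n. (\<integral>t. (norm (V t - trig_sum (coef x) {..<n} t))\<^sup>2 \<partial>circle_measure) \<le> (norm ((shl ^^ n) x))\<^sup>2"
    using riesz_fischer[of x] by blast
  have VV: "ae_eq V V" using V(1) by (auto simp: ae_eq_self)
  have TT: "ae_eq (trig_sum c S) (trig_sum c S)" for c S by (simp add: ae_eq_self)
  have "abs_tfun V \<in> L2"
    using V(1) by (simp add: L2_iff square_integrable.abs_eq[OF VV] sqC_def)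
  moreover have "normL2 (abs_tfun V - psum (coef x) n) \<le> norm ((shl ^^ n) x)" for n
  proof (rule power2_le_imp_le)
    have m: "ae_eq (\<lambda>t. V t - trig_sum (coef x) {..<n} t) (\<lambda>t. V t - trig_sum (coef x) {..<n} t)"
      using V(1) by (auto simp: ae_eq_self)
    have "abs_tfun V - psum (coef x) n = abs_tfun (\<lambda>t. V t - trig_sum (coef x) {..<n} t)"
      unfolding psum_eq_trigT trigT.abs_eq by (intro minus_tfun.abs_eq VV TT)
    then show "(normL2 (abs_tfun V - psum (coef x) n))\<^sup>2 \<le> (norm ((shl ^^ n) x))\<^sup>2"
      using V(2)[of n] by (simp add: int_sq_eq[symmetric] int_sq.abs_eq[OF m])
  qed simp
  ultimately show ?thesis by blast
qed

text \<open>Cauchy-Schwarz for \<open>f\<close> against its own partial sum: the pairing and the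
  squared norm of the partial sum are the same number \<open>s\<close>.\<close>

lemma bessel: "f \<in> L2 \<Longrightarrow> (\<Sum>k<n. (norm (fourier f (int k)))\<^sup>2) \<le> (normL2 f)\<^sup>2"
proof -
  assume f: "f \<in> L2"
  define c where "c k = fourier f (int k)" for k
  define s where "s = (\<Sum>k<n. (norm (c k))\<^sup>2)"
  have s0: "0 \<le> s" by (simp add: s_def sum_nonneg)
  have gf: "innerT (psum c n) f = of_real s"
    by (simp add: innerT_psum_left[OF f] s_def complex_norm_square c_def del: of_real_power)
  have "innerT (psum c n) (psum c n) = of_real s"
    unfolding innerT_psum_left[OF L2_psum] s_def of_real_sum complex_norm_square
    by (intro sum.cong refl) (simp add: fourier_psum)
  then have g: "(normL2 (psum c n))\<^sup>2 = s" unfolding normL2_sq by (simp only: of_real_eq_iff)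
  have "s \<le> normL2 (psum c n) * normL2 f"
    using norm_innerT_le[OF L2_psum f, of c n] s0 by (simp add: gf)
  then have "s\<^sup>2 \<le> (normL2 (psum c n) * normL2 f)\<^sup>2" using s0 by (intro power_mono)
  then have "s * s \<le> s * (normL2 f)\<^sup>2" by (simp add: power_mult_distrib g power2_eq_square[of s])
  then have "s \<le> (normL2 f)\<^sup>2" using s0 by (cases "s = 0") (auto simp: mult_le_cancel_left)
  then show ?thesis by (simp add: s_def c_def)
qed

text \<open>Nonnegative frequencies alone are recorded, so the map is injective on
  \<open>L2_plus\<close> but not on \<open>L2\<close>.\<close>

definition fcoef :: "tfun \<Rightarrow> ell2" where "fcoef f = Abs_ell2 (\<lambda>n. fourier f (int n))"

lemma coef_fcoef: "f \<in> L2 \<Longrightarrow> coef (fcoef f) n = fourier f (int n)"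
proof -
  assume f: "f \<in> L2"
  have "summable (\<lambda>k. (norm (fourier f (int k)))\<^sup>2)"
    by (rule summableI_nonneg_bounded[OF _ bessel[OF f]]) simp
  then show ?thesis by (simp add: fcoef_def Abs_ell2_inverse)
qed

lemma fcoef_add: "f \<in> L2 \<Longrightarrow> g \<in> L2 \<Longrightarrow> fcoef (f + g) = fcoef f + fcoef g"
  and fcoef_diff: "f \<in> L2 \<Longrightarrow> g \<in> L2 \<Longrightarrow> fcoef (f - g) = fcoef f - fcoef g"
  and fcoef_scaleT: "f \<in> L2 \<Longrightarrow> fcoef (scaleT c f) = c *\<^sub>c fcoef f"
  by (auto intro!: ell2_eqI simp: coef_fcoef L2_add L2_diff L2_scaleT fourier_add fourier_diff fourier_scaleT)

lemma L2_plus_L2: "f \<in> L2_plus \<Longrightarrow> f \<in> L2" by (simp add: L2_plus_def)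

lemma fcoef_inj: "f \<in> L2_plus \<Longrightarrow> g \<in> L2_plus \<Longrightarrow> fcoef f = fcoef g \<Longrightarrow> f = g"
proof (rule L2_eqI)
  fix n assume f: "f \<in> L2_plus" and g: "g \<in> L2_plus" and eq: "fcoef f = fcoef g"
  show "fourier f n = fourier g n"
  proof (cases "n < 0")
    case False
    then obtain k where "n = int k" by (metis nonneg_int_cases not_less)
    then show ?thesis using eq f g by (metis coef_fcoef L2_plus_L2)
  qed (use f g in \<open>simp add: L2_plus_def\<close>)
qed (auto simp: L2_plus_L2)

lemma riesz_fischer_plus:
  "\<exists>v\<in>L2_plus. fcoef v = x \<and> (\<lambda>n. normL2 (v - psum (coef x) n)) \<longlonglongrightarrow> 0"
proof -
  obtain v where v: "v \<in> L2" "\<And>n. normL2 (v - psum (coef x) n) \<le> norm ((shl ^^ n) x)"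
    using riesz_fischer_tfun[of x] by blast
  have lim: "(\<lambda>n. normL2 (v - psum (coef x) n)) \<longlonglongrightarrow> 0"
    by (rule tendsto_sandwich[OF _ _ tendsto_const norm_shl_pow_tendsto[of x]])
      (auto simp: normL2_nonneg v(2))
  have fv: "fourier v m = (if 0 \<le> m then coef x (nat m) else 0)" for m
  proof -
    have "(\<lambda>n. fourier v m - fourier (psum (coef x) n) m) \<longlonglongrightarrow> 0"
    proof (rule Lim_null_comparison[OF _ lim])
      show "\<forall>\<^sub>F n in sequentially. norm (fourier v m - fourier (psum (coef x) n) m) \<le> normL2 (v - psum (coef x) n)"
        using norm_fourier_le[OF L2_diff[OF v(1) L2_psum]] by (simp add: fourier_diff v(1))
    qed
    moreover have "\<forall>\<^sub>F n in sequentially. fourier v m - fourier (psum (coef x) n) m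
        = fourier v m - (if 0 \<le> m then coef x (nat m) else 0)"
      using eventually_ge_at_top[of "nat m + 1"] by eventually_elim (auto simp: fourier_psum)
    then have "(\<lambda>n. fourier v m - fourier (psum (coef x) n) m) \<longlonglongrightarrow> fourier v m - (if 0 \<le> m then coef x (nat m) else 0)"
      by (rule tendsto_eventually)
    ultimately have "fourier v m - (if 0 \<le> m then coef x (nat m) else 0) = 0"
      by (rule LIMSEQ_unique[symmetric])
    then show ?thesis by simp
  qed
  have "v \<in> L2_plus" using v(1) by (simp add: L2_plus_def fv)
  moreover have "fcoef v = x" by (rule ell2_eqI) (simp add: coef_fcoef v(1) fv)
  ultimately show ?thesis using lim by blast
qed

lemma fcoef_surj: "\<exists>v\<in>L2_plus. fcoef v = x"
  using riesz_fischer_plus by blast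

text \<open>The first argument has no negative frequencies, so those of \<open>g\<close> do not
  contribute. The asymmetry is used for second arguments that contain \<open>cnjT\<close>.\<close>

lemma innerT_eq_cinner:
  assumes f: "f \<in> L2_plus" and g: "g \<in> L2"
  shows "innerT f g = cinner (fcoef f) (fcoef g)"
proof -
  let ?s = "psum (coef (fcoef f))"
  have lim: "(\<lambda>n. normL2 (f - ?s n)) \<longlonglongrightarrow> 0"
    using riesz_fischer_plus[of "fcoef f"] fcoef_inj[OF f] by metis
  have le: "norm (innerT f g - innerT (?s n) g) \<le> normL2 (f - ?s n) * normL2 g" for n
    unfolding innerT_diff_left[OF L2_plus_L2[OF f] L2_psum g, symmetric]
    by (rule norm_innerT_le[OF L2_diff[OF L2_plus_L2[OF f] L2_psum] g])
  have "(\<lambda>n. innerT f g - innerT (?s n) g) \<longlonglongrightarrow> 0"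
  proof (rule Lim_null_comparison)
    show "\<forall>\<^sub>F n in sequentially. norm (innerT f g - innerT (?s n) g) \<le> normL2 (f - ?s n) * normL2 g"
      by (rule always_eventually) (use le in blast)
    show "(\<lambda>n. normL2 (f - ?s n) * normL2 g) \<longlonglongrightarrow> 0" by (rule tendsto_mult_left_zero[OF lim])
  qed
  moreover have "(\<lambda>n. innerT (?s n) g) \<longlonglongrightarrow> cinner (fcoef f) (fcoef g)"
    unfolding innerT_psum_left[OF g] cinner_def coef_fcoef[OF g, symmetric]
    by (rule summable_LIMSEQ[OF summable_cinner])
  ultimately have "(\<lambda>n::nat. innerT f g) \<longlonglongrightarrow> 0 + cinner (fcoef f) (fcoef g)"
    using tendsto_add[of "\<lambda>n. innerT f g - innerT (?s n) g" 0 sequentially "\<lambda>n. innerT (?s n) g"] by simp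
  then show ?thesis by (simp add: LIMSEQ_const_iff)
qed

lemma normL2_eq_norm: "f \<in> L2_plus \<Longrightarrow> normL2 f = norm (fcoef f)"
proof -
  assume f: "f \<in> L2_plus"
  have "complex_of_real ((normL2 f)\<^sup>2) = of_real ((norm (fcoef f))\<^sup>2)"
    using innerT_eq_cinner[OF f L2_plus_L2[OF f]] by (simp only: normL2_sq cinner_self_norm)
  then have "(normL2 f)\<^sup>2 = (norm (fcoef f))\<^sup>2" by (simp only: of_real_eq_iff)
  then show ?thesis using normL2_nonneg[of f] by simp
qed

section \<open>The shift, the projector and Hankel operators in coordinates\<close>

lemma L2_plus_add: "f \<in> L2_plus \<Longrightarrow> g \<in> L2_plus \<Longrightarrow> f + g \<in> L2_plus"
  and L2_plus_diff: "f \<in> L2_plus \<Longrightarrow> g \<in> L2_plus \<Longrightarrow> f - g \<in> L2_plus"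
  and L2_plus_scaleT: "f \<in> L2_plus \<Longrightarrow> scaleT c f \<in> L2_plus"
  by (auto simp: L2_plus_def L2_add L2_diff L2_scaleT fourier_add fourier_diff fourier_scaleT)

lemma fourier_expT_mult: "fourier (expT m * f) n = fourier f (n - m)"
proof -
  have "expT m * f * expT (- n) = f * (expT m * expT (- n))" by (simp add: mult_ac)
  also have "\<dots> = f * expT (- (n - m))" by (simp add: expT_add)
  finally show ?thesis by (simp add: fourier_def)
qed

lemma L2_plus_expT_1: "f \<in> L2_plus \<Longrightarrow> expT 1 * f \<in> L2_plus"
  by (simp add: L2_plus_def L2_expT_mult fourier_expT_mult)

lemma coef_shr_pow: "coef ((shr ^^ n) x) k = (if n \<le> k then coef x (k - n) else 0)"
  by (induction n arbitrary: k) (auto simp: coef_shr split: nat.split)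

lemma fcoef_expT_mult: "f \<in> L2_plus \<Longrightarrow> fcoef (expT (int n) * f) = (shr ^^ n) (fcoef f)"
proof (rule ell2_eqI)
  fix k assume f: "f \<in> L2_plus"
  show "coef (fcoef (expT (int n) * f)) k = coef ((shr ^^ n) (fcoef f)) k"
  proof (cases "n \<le> k")
    case True
    then have "int k - int n = int (k - n)" by (simp add: of_nat_diff)
    then show ?thesis
      using True by (simp add: coef_fcoef L2_expT_mult L2_plus_L2[OF f] fourier_expT_mult coef_shr_pow)
  next
    case False
    then have "fourier f (int k - int n) = 0" using f by (simp add: L2_plus_def)
    then show ?thesis
      using False by (simp add: coef_fcoef L2_expT_mult L2_plus_L2[OF f] fourier_expT_mult coef_shr_pow)
  qed
qed

lemma fcoef_expT_1: "f \<in> L2_plus \<Longrightarrow> fcoef (expT 1 * f) = shr (fcoef f)"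
  using fcoef_expT_mult[of f 1] by simp

text \<open>Evaluates the description in \<open>szego\<close> from the nonnegative Fourier
  coefficients alone. This suits the products in \<open>hankel\<close>, which in general are not
  square integrable.\<close>

lemma szego_fcoef:
  assumes "\<And>n. fourier f (int n) = coef x n"
  shows "szego f \<in> L2_plus \<and> fcoef (szego f) = x"
proof -
  obtain v where v: "v \<in> L2_plus" "fcoef v = x" using fcoef_surj by blast
  have fv: "fourier v n = fourier f n" if n: "n \<ge> 0" for n
  proof -
    obtain k where "n = int k" using n by (metis nonneg_int_cases)
    then show ?thesis using assms[of k] v coef_fcoef[OF L2_plus_L2[OF v(1)], of k] by simp
  qed
  have "szego f = v"
    unfolding szego_def
  proof (rule the_equality)
    fix g assume g: "g \<in> L2_plus \<and> (\<forall>n\<ge>0. fourier g n = fourier f n)"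
    have "fcoef g = x"
      by (rule ell2_eqI) (use g assms in \<open>simp add: coef_fcoef L2_plus_L2\<close>)
    then show "g = v" using fcoef_inj g v by blast
  qed (use v fv in auto)
  then show ?thesis using v by simp
qed

text \<open>A coefficient of the product is read as the pairing of \<open>u\<close> with a shifted
  \<open>h\<close>, which stays within L^2. The shifts then move to \<open>u\<close>, where they are
  the values of the Hankel operator on basis vectors.\<close>

lemma hankel_fcoef:
  assumes u: "u \<in> L2_plus" "asum (fcoef u)" and h: "h \<in> L2_plus"
  shows "hankel u h \<in> L2_plus \<and> fcoef (hankel u h) = hank (fcoef u) (fcoef h)"
  unfolding hankel_def
proof (rule szego_fcoef)
  fix n
  have hb: "hank (fcoef u) (basis n) = (shl ^^ n) (fcoef u)"
    by (induction n) (use hank_shr[OF u(2)] in \<open>simp_all add: u(2) flip: shr_basis\<close>)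
  have "fourier (u * cnjT h) (int n) = innerT u (expT (int n) * h)"
    by (simp add: fourier_innerT innerT_def mult_ac)
  also have "\<dots> = cinner (fcoef u) ((shr ^^ n) (fcoef h))"
    using innerT_eq_cinner[OF u(1) L2_expT_mult[OF L2_plus_L2[OF h]]] by (simp add: fcoef_expT_mult h)
  also have "\<dots> = cinner ((shl ^^ n) (fcoef u)) (fcoef h)"
    by (metis cinner_commute cinner_shr_pow_left)
  also have "\<dots> = cinner (hank (fcoef u) (fcoef h)) (basis n)"
    by (simp only: cinner_hank[OF u(2), of "fcoef h"] hb)
  finally show "fourier (u * cnjT h) (int n) = coef (hank (fcoef u) (fcoef h)) n" by simp
qed

lemma shifted_hankel_fcoef:
  assumes u: "u \<in> L2_plus" "asum (fcoef u)" and h: "h \<in> L2_plus"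
  shows "shifted_hankel u h \<in> L2_plus \<and> fcoef (shifted_hankel u h) = kank (fcoef u) (fcoef h)"
  using hankel_fcoef[OF u L2_plus_expT_1[OF h]]
  by (simp add: shifted_hankel_def fcoef_expT_1 h hank_shr_kank u)

subsection \<open>Products with functions in the Wiener algebra\<close>

lift_definition bddT :: "tfun \<Rightarrow> real \<Rightarrow> bool" is "\<lambda>f B. AE x in circle_measure. norm (f x) \<le> B"
proof -
  fix f g :: "real \<Rightarrow> complex"
  assume "ae_eq f g"
  then have ae: "AE x in circle_measure. f x = g x" by (simp add: ae_eq_def)
  show "(\<lambda>B. AE x in circle_measure. norm (f x) \<le> B) = (\<lambda>B. AE x in circle_measure. norm (g x) \<le> B)"
  proof (rule ext, rule iffI)
    fix B
    assume "AE x in circle_measure. norm (f x) \<le> B"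
    with ae show "AE x in circle_measure. norm (g x) \<le> B" by eventually_elim simp
  next
    fix B
    assume "AE x in circle_measure. norm (g x) \<le> B"
    with ae show "AE x in circle_measure. norm (f x) \<le> B" by eventually_elim simp
  qed
qed

lemma L2_mult_bddT: "bddT u B \<Longrightarrow> g \<in> L2 \<Longrightarrow> u * g \<in> L2"
  unfolding L2_iff
proof transfer
  fix u g :: "real \<Rightarrow> complex" and B
  assume m: "ae_eq u u" "ae_eq g g" and u: "AE x in circle_measure. norm (u x) \<le> B"
    and g: "integrable circle_measure (\<lambda>x. (norm (g x))\<^sup>2)"
  have [measurable]: "measC u" "measC g" using m by (auto simp: ae_eq_self)
  show "integrable circle_measure (\<lambda>x. (norm (u x * g x))\<^sup>2)"
  proof (rule Bochner_Integration.integrable_bound)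
    show "integrable circle_measure (\<lambda>x. B\<^sup>2 * (norm (g x))\<^sup>2)" using g by simp
    show "AE x in circle_measure. norm ((norm (u x * g x))\<^sup>2) \<le> norm (B\<^sup>2 * (norm (g x))\<^sup>2)"
      using u
    proof eventually_elim
      case (elim x)
      have "(norm (u x))\<^sup>2 \<le> B\<^sup>2" by (intro power_mono elim) auto
      then show ?case by (simp add: norm_mult power_mult_distrib mult_right_mono)
    qed
  qed measurable
qed

text \<open>The absolutely convergent Fourier series defines a bounded function \<open>G\<close>,
  and equality of Fourier coefficients identifies it with \<open>u\<close> almost everywhere.
  Boundedness is what makes u^2 square integrable.\<close>

lemma bddT_of_asum:
  assumes u: "u \<in> L2_plus" "asum (fcoef u)"
  shows "bddT u (anorm (fcoef u))"
proof -
  define x where "x = fcoef u"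
  define G where "G t = (\<Sum>k. coef x k * cis (of_int (int k) * t))" for t
  have s: "summable (\<lambda>k. norm (coef x k))" using u(2) by (simp add: asum_def x_def)
  have sG: "summable (\<lambda>k. norm (coef x k * cis (of_int (int k) * t)))" for t
    using s by (simp add: norm_mult)
  have G_lim: "(\<lambda>n. trig_sum (coef x) {..<n} t) \<longlonglongrightarrow> G t" for t
    unfolding trig_sum_def G_def by (rule summable_LIMSEQ[OF summable_norm_cancel[OF sG]])
  have G_le: "norm (G t) \<le> anorm x" for t
    unfolding G_def anorm_def using summable_norm[OF sG[of t]] by (simp add: norm_mult)
  have G_meas: "measC G"
    by (rule borel_measurable_LIMSEQ_metric[OF _ G_lim]) measurable
  have GG: "ae_eq G G" using G_meas by (simp add: ae_eq_self)
  have tail: "norm (G t - trig_sum (coef x) {..<n} t) \<le> (\<Sum>k. norm (coef x (k + n)))" for t n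
  proof -
    have "G t - trig_sum (coef x) {..<n} t = (\<Sum>k. coef x (k + n) * cis (of_int (int (k + n)) * t))"
      unfolding G_def trig_sum_def using suminf_minus_initial_segment[OF summable_norm_cancel[OF sG[of t]], of n] by simp
    also have "norm \<dots> \<le> (\<Sum>k. norm (coef x (k + n) * cis (of_int (int (k + n)) * t)))"
      by (rule summable_norm) (use summable_ignore_initial_segment[OF sG[of t], of n] in simp)
    finally show ?thesis by (simp add: norm_mult)
  qed
  let ?g = "abs_tfun G"
  have g: "?g \<in> L2"
    using sqC_bounded[OF G_meas G_le] by (simp add: L2_iff square_integrable.abs_eq[OF GG] sqC_def)
  have TT: "ae_eq (trig_sum c S) (trig_sum c S)" for c S by (simp add: ae_eq_self)
  have norm_le: "normL2 (?g - psum (coef x) n) \<le> (\<Sum>k. norm (coef x (k + n)))" for n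
  proof (rule power2_le_imp_le)
    let ?d = "\<lambda>t. G t - trig_sum (coef x) {..<n} t"
    have dm: "measC ?d" using G_meas by measurable
    then have m: "ae_eq ?d ?d" by (simp add: ae_eq_self)
    have "?g - psum (coef x) n = abs_tfun ?d"
      unfolding psum_eq_trigT trigT.abs_eq by (intro minus_tfun.abs_eq GG TT)
    then have "(normL2 (?g - psum (coef x) n))\<^sup>2 = (\<integral>t. (norm (?d t))\<^sup>2 \<partial>circle_measure)"
      by (simp add: int_sq_eq[symmetric] int_sq.abs_eq[OF m])
    also have "\<dots> \<le> (\<integral>t. (\<Sum>k. norm (coef x (k + n)))\<^sup>2 \<partial>circle_measure)"
      using sqC_bounded[OF dm tail] tail by (intro integral_mono power_mono) (auto simp: sqC_def)
    also have "\<dots> = (\<Sum>k. norm (coef x (k + n)))\<^sup>2"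
      by (simp add: measure_def emeasure_circle_measure_UNIV)
    finally show "(normL2 (?g - psum (coef x) n))\<^sup>2 \<le> (\<Sum>k. norm (coef x (k + n)))\<^sup>2" .
    show "0 \<le> (\<Sum>k. norm (coef x (k + n)))"
      by (rule suminf_nonneg[OF summable_ignore_initial_segment[OF s]]) simp
  qed
  have lim: "(\<lambda>n. normL2 (?g - psum (coef x) n)) \<longlonglongrightarrow> 0"
    by (rule tendsto_sandwich[OF _ _ tendsto_const suminf_exist_split2[OF s]])
      (auto simp: normL2_nonneg norm_le)
  have "?g = u"
  proof (rule L2_eqI[OF g L2_plus_L2[OF u(1)]])
    fix m
    have "(\<lambda>n. fourier ?g m - fourier (psum (coef x) n) m) \<longlonglongrightarrow> 0"
    proof (rule Lim_null_comparison[OF _ lim])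
      show "\<forall>\<^sub>F n in sequentially. norm (fourier ?g m - fourier (psum (coef x) n) m) \<le> normL2 (?g - psum (coef x) n)"
        using norm_fourier_le[OF L2_diff[OF g L2_psum]] by (simp add: fourier_diff g)
    qed
    moreover have "\<forall>\<^sub>F n in sequentially. fourier ?g m - fourier (psum (coef x) n) m = fourier ?g m - fourier u m"
      using eventually_ge_at_top[of "nat m + 1"]
    proof eventually_elim
      case (elim n)
      then show ?case using u(1)
        by (auto simp: fourier_psum x_def coef_fcoef L2_plus_def)
    qed
    then have "(\<lambda>n. fourier ?g m - fourier (psum (coef x) n) m) \<longlonglongrightarrow> fourier ?g m - fourier u m"
      by (rule tendsto_eventually)
    ultimately have "fourier ?g m - fourier u m = 0" by (rule LIMSEQ_unique[symmetric])
    then show "fourier ?g m = fourier u m" by simp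
  qed
  moreover have "bddT ?g (anorm x)" using G_le by (simp add: bddT.abs_eq[OF GG])
  ultimately show ?thesis by (simp add: x_def)
qed

lemma coef_toep: "asum u \<Longrightarrow> coef (toep u x) n = cinner u (flip n x)"
proof -
  assume u: "asum u"
  have "(\<lambda>k. coef (coef u k *\<^sub>c (shr ^^ k) x) n) sums coef (toep u x) n"
    using bounded_linear.sums[OF cinner.bounded_linear_left toep_sums[OF u, of x], of "basis n"] by simp
  moreover have "(\<lambda>k. coef (coef u k *\<^sub>c (shr ^^ k) x) n) = (\<lambda>k. coef u k * cnj (coef (flip n x) k))"
    by (auto simp: coef_shr_pow coef_flip fun_eq_iff)
  ultimately show ?thesis unfolding cinner_def by (simp only: sums_iff)
qed

text \<open>Each coefficient is the pairing of \<open>u\<close> with \<open>expT n * cnjT u\<close>,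
  whose nonnegative frequencies, for \<open>n\<close> nonnegative, form \<open>flip\<close> of the
  coefficients of \<open>u\<close>. No product of series has to be rearranged.\<close>

lemma square_fcoef:
  assumes u: "u \<in> L2_plus" "asum (fcoef u)"
  shows "u * u \<in> L2_plus \<and> fcoef (u * u) = toep (fcoef u) (fcoef u)"
proof -
  have uL: "u \<in> L2" by (rule L2_plus_L2[OF u(1)])
  have uu: "u * u \<in> L2" by (rule L2_mult_bddT[OF bddT_of_asum[OF u] uL])
  have c: "fourier (cnjT u) m = cnj (fourier u (- m))" for m
  proof -
    have "fourier (cnjT u) m = innerT (expT (- m)) u" by (simp add: fourier_innerT innerT_def mult.commute)
    then show ?thesis by (simp add: innerT_commute[of "expT (- m)"] fourier_innerT)
  qed
  have eq: "fourier (u * u) n = cinner (fcoef u) (fcoef (expT n * cnjT u))" for n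
  proof -
    have "fourier (u * u) n = innerT u (expT n * cnjT u)"
      by (simp add: fourier_innerT innerT_def mult_ac)
    then show ?thesis by (simp add: innerT_eq_cinner[OF u(1)] L2_expT_mult L2_cnjT uL)
  qed
  have f: "coef (fcoef (expT n * cnjT u)) k = cnj (fourier u (n - int k))" for n k
    by (simp add: coef_fcoef L2_expT_mult L2_cnjT uL fourier_expT_mult c)
  have "fourier (u * u) n = 0" if "n < 0" for n
    using that u(1) by (simp add: eq cinner_def f L2_plus_def)
  moreover have "fcoef (u * u) = toep (fcoef u) (fcoef u)"
  proof (rule ell2_eqI)
    fix n
    have "fcoef (expT (int n) * cnjT u) = flip n (fcoef u)"
    proof (rule ell2_eqI)
      fix k
      show "coef (fcoef (expT (int n) * cnjT u)) k = coef (flip n (fcoef u)) k"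
      proof (cases "k \<le> n")
        case True
        then have "int n - int k = int (n - k)" by (simp add: of_nat_diff)
        then show ?thesis using True by (simp add: f coef_flip coef_fcoef uL)
      next
        case False
        then have "fourier u (int n - int k) = 0" using u(1) by (simp add: L2_plus_def)
        then show ?thesis using False by (simp add: f coef_flip)
      qed
    qed
    then show "coef (fcoef (u * u)) n = coef (toep (fcoef u) (fcoef u)) n"
      by (simp add: coef_fcoef uu eq coef_toep u(2))
  qed
  ultimately show ?thesis using uu by (simp add: L2_plus_def)
qed

lemma massQ_fcoef: "u \<in> L2_plus \<Longrightarrow> massQ u = (norm (fcoef u))\<^sup>2"
  using normL2_sq[of u] by (simp add: massQ_def innerT_def normL2_eq_norm del: of_real_power)

lemma cubicJ_fcoef:
  assumes u: "u \<in> L2_plus" "asum (fcoef u)"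
  shows "cubicJ u = cinner (toep (fcoef u) (fcoef u)) (fcoef u)"
proof -
  have "cubicJ u = innerT (u * u) u" by (simp add: cubicJ_def innerT_def mult_ac)
  then show ?thesis
    using square_fcoef[OF u] innerT_eq_cinner[of "u * u" u] L2_plus_L2[OF u(1)] by simp
qed

lemma szego_abs_sq_fcoef:
  assumes u: "u \<in> L2_plus" "asum (fcoef u)"
  shows "szego (u * cnjT u) \<in> L2_plus \<and> fcoef (szego (u * cnjT u)) = toepS (fcoef u) (fcoef u)"
  using hankel_fcoef[OF u u(1)] by (simp add: hankel_def toepS_self u(2))

subsection \<open>Sobolev norms\<close>

definition sobolev_term :: "real \<Rightarrow> ell2 \<Rightarrow> nat \<Rightarrow> real" where
  "sobolev_term s x k = (1 + (real k)\<^sup>2) powr s * (norm (coef x k))\<^sup>2"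

lemma sobolev_term_nonneg: "0 \<le> sobolev_term s x k"
  by (simp add: sobolev_term_def)

lemma summable_on_int_nonneg_support:
  fixes g :: "int \<Rightarrow> real"
  assumes "\<And>n. n < 0 \<Longrightarrow> g n = 0" "\<And>n. 0 \<le> g n"
  shows "g summable_on UNIV \<longleftrightarrow> summable (\<lambda>k. g (int k))"
    and "summable (\<lambda>k. g (int k)) \<Longrightarrow> infsum g UNIV = (\<Sum>k. g (int k))"
proof -
  have neg: "n < 0" if "n \<notin> range int" for n
    using that by (metis nonneg_int_cases not_less rangeI)
  have "g summable_on UNIV \<longleftrightarrow> g summable_on range int"
    by (rule summable_on_cong_neutral) (use assms(1) neg in auto)
  also have "\<dots> \<longleftrightarrow> (g \<circ> int) summable_on UNIV" by (rule summable_on_reindex) simp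
  also have "\<dots> \<longleftrightarrow> summable (g \<circ> int)" by (rule summable_on_UNIV_nonneg_real_iff) (simp add: assms)
  finally show "g summable_on UNIV \<longleftrightarrow> summable (\<lambda>k. g (int k))" by (simp add: o_def)
  assume s: "summable (\<lambda>k. g (int k))"
  have "infsum g UNIV = infsum g (range int)"
    by (rule infsum_cong_neutral) (use assms(1) neg in auto)
  also have "\<dots> = infsum (g \<circ> int) UNIV" by (rule infsum_reindex) simp
  also have "\<dots> = (\<Sum>k. g (int k))"
  proof -
    have "(g \<circ> int) summable_on UNIV"
      by (subst summable_on_UNIV_nonneg_real_iff) (use s assms in \<open>simp_all add: o_def\<close>)
    from has_sum_imp_sums[OF has_sum_infsum[OF this]] show ?thesis by (simp add: sums_iff o_def)
  qed
  finally show "infsum g UNIV = (\<Sum>k. g (int k))" .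
qed

lemma Hs_plus_iff: "f \<in> Hs_plus s \<longleftrightarrow> f \<in> L2_plus \<and> summable (sobolev_term s (fcoef f))"
proof (cases "f \<in> L2_plus")
  case True
  let ?g = "\<lambda>n::int. (1 + (of_int n)\<^sup>2) powr s * (norm (fourier f n))\<^sup>2"
  have "?g summable_on UNIV \<longleftrightarrow> summable (\<lambda>k. ?g (int k))"
    by (rule summable_on_int_nonneg_support) (use True in \<open>auto simp: L2_plus_def\<close>)
  also have "(\<lambda>k. ?g (int k)) = sobolev_term s (fcoef f)"
    by (simp add: sobolev_term_def fun_eq_iff coef_fcoef L2_plus_L2 True)
  finally show ?thesis using True by (simp add: Hs_plus_def)
qed (simp add: Hs_plus_def)

lemma Hs_norm_eq: "f \<in> Hs_plus s \<Longrightarrow> Hs_norm s f = sqrt (\<Sum>k. sobolev_term s (fcoef f) k)"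
proof -
  assume "f \<in> Hs_plus s"
  then have f: "f \<in> L2_plus" and s: "summable (sobolev_term s (fcoef f))" by (auto simp: Hs_plus_iff)
  let ?g = "\<lambda>n::int. (1 + (of_int n)\<^sup>2) powr s * (norm (fourier f n))\<^sup>2"
  have eq: "(\<lambda>k. ?g (int k)) = sobolev_term s (fcoef f)"
    by (simp add: sobolev_term_def fun_eq_iff coef_fcoef L2_plus_L2 f)
  have "infsum ?g UNIV = (\<Sum>k. ?g (int k))"
  proof (rule summable_on_int_nonneg_support(2))
    show "summable (\<lambda>k. ?g (int k))" unfolding eq by (rule s)
  qed (use f in \<open>auto simp: L2_plus_def\<close>)
  then show ?thesis unfolding Hs_norm_def eq by simp
qed

lemma Hs_plus_L2_plus: "f \<in> Hs_plus s \<Longrightarrow> f \<in> L2_plus"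
  by (simp add: Hs_plus_iff)

lemma Hs_plus_scaleT: "f \<in> Hs_plus s \<Longrightarrow> scaleT c f \<in> Hs_plus s"
proof -
  assume f: "f \<in> Hs_plus s"
  have "sobolev_term s (c *\<^sub>c x) = (\<lambda>k. (norm c)\<^sup>2 * sobolev_term s x k)" for x
    by (auto simp: sobolev_term_def norm_mult power_mult_distrib)
  then show ?thesis
    using f by (simp add: Hs_plus_iff L2_plus_scaleT fcoef_scaleT L2_plus_L2 summable_mult)
qed

lemma Hs_plus_diff: "f \<in> Hs_plus s \<Longrightarrow> g \<in> Hs_plus s \<Longrightarrow> f - g \<in> Hs_plus s"
proof -
  assume f: "f \<in> Hs_plus s" and g: "g \<in> Hs_plus s"
  have "summable (\<lambda>k. 2 * sobolev_term s (fcoef f) k + 2 * sobolev_term s (fcoef g) k)"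
    using f g by (intro summable_add summable_mult) (auto simp: Hs_plus_iff)
  then have "summable (sobolev_term s (fcoef f - fcoef g))"
  proof (rule summable_comparison_test'[where N = 0])
    fix k
    have "(norm (coef (fcoef f) k + - coef (fcoef g) k))\<^sup>2 \<le> 2 * (norm (coef (fcoef f) k))\<^sup>2 + 2 * (norm (coef (fcoef g) k))\<^sup>2"
      using power2_norm_add_le[of "coef (fcoef f) k" "- coef (fcoef g) k"] by simp
    then have "(1 + (real k)\<^sup>2) powr s * (norm (coef (fcoef f) k + - coef (fcoef g) k))\<^sup>2
        \<le> (1 + (real k)\<^sup>2) powr s * (2 * (norm (coef (fcoef f) k))\<^sup>2 + 2 * (norm (coef (fcoef g) k))\<^sup>2)"
      by (intro mult_left_mono) auto
    then show "norm (sobolev_term s (fcoef f - fcoef g) k) \<le> 2 * sobolev_term s (fcoef f) k + 2 * sobolev_term s (fcoef g) k"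
      by (simp add: sobolev_term_def algebra_simps)
  qed
  then show ?thesis
    using f g by (simp add: Hs_plus_iff L2_plus_diff fcoef_diff L2_plus_L2)
qed

lemma summable_sobolev_weight:
  assumes "s > 1/2"
  shows "summable (\<lambda>k. (1 + (real k)\<^sup>2) powr (- s))"
proof -
  have "summable (\<lambda>k. real k powr (- 2 * s))" using assms by (simp add: summable_real_powr_iff)
  then show ?thesis
  proof (rule summable_comparison_test'[where N = 1])
    fix k :: nat assume k: "1 \<le> k"
    have "(1 + (real k)\<^sup>2) powr (- s) \<le> ((real k)\<^sup>2) powr (- s)"
      using k assms by (intro powr_mono2') auto
    also have "(real k)\<^sup>2 = real k powr 2" using k by simp
    also have "(real k powr 2) powr (- s) = real k powr (- 2 * s)" by (simp only: powr_powr) simp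
    finally show "norm ((1 + (real k)\<^sup>2) powr (- s)) \<le> real k powr (- 2 * s)" by simp
  qed
qed

text \<open>Cauchy-Schwarz with the weight split in half. In the second claim the constant is the
  tail of a convergent series of weights, so it is small for large \<open>p\<close>, uniformly on
  Sobolev balls.\<close>

lemma asum_of_sobolev:
  assumes s: "s > 1/2" and x: "summable (sobolev_term s x)"
  shows "asum x" and "anorm ((shl ^^ p) x) \<le> sqrt (\<Sum>k. (1 + (real (k + p))\<^sup>2) powr (- s)) * sqrt (\<Sum>k. sobolev_term s x k)"
proof -
  let ?w = "\<lambda>k::nat. 1 + (real k)\<^sup>2"
  have w: "0 < ?w k" for k by (simp add: add_pos_nonneg)
  have bound: "(\<Sum>k<N. norm (coef x (k + p)))
      \<le> sqrt (\<Sum>k. ?w (k + p) powr (- s)) * sqrt (\<Sum>k. sobolev_term s x k)" for N p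
  proof -
    have "(\<Sum>k<N. norm (coef x (k + p))) = (\<Sum>k<N. ?w (k + p) powr (- s/2) * (?w (k + p) powr (s/2) * norm (coef x (k + p))))"
      using w by (intro sum.cong refl) (simp add: mult.assoc[symmetric] powr_add[symmetric] less_imp_neq[symmetric] del: of_nat_add)
    also have "\<dots> \<le> sqrt ((\<Sum>k<N. (?w (k + p) powr (- s/2))\<^sup>2) * (\<Sum>k<N. (?w (k + p) powr (s/2) * norm (coef x (k + p)))\<^sup>2))"
      by (rule real_le_rsqrt) (rule Cauchy_Schwarz_ineq_sum)
    also have "\<dots> = sqrt (\<Sum>k<N. ?w (k + p) powr (- s)) * sqrt (\<Sum>k<N. sobolev_term s x (k + p))"
      by (simp add: real_sqrt_mult power_mult_distrib sobolev_term_def powr_powr[symmetric] flip: powr_numeral)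
        (simp add: powr_powr)
    also have "\<dots> \<le> sqrt (\<Sum>k. ?w (k + p) powr (- s)) * sqrt (\<Sum>k. sobolev_term s x k)"
    proof (intro mult_mono real_sqrt_le_mono real_sqrt_ge_zero)
      show "(\<Sum>k<N. ?w (k + p) powr (- s)) \<le> (\<Sum>k. ?w (k + p) powr (- s))"
        using summable_ignore_initial_segment[OF summable_sobolev_weight[OF s], of p]
        by (intro sum_le_suminf) auto
      have "(\<Sum>k<N. sobolev_term s x (k + p)) = (\<Sum>k\<in>{p..<N+p}. sobolev_term s x k)"
        using sum.shift_bounds_nat_ivl[of "sobolev_term s x" 0 p N] by (simp add: lessThan_atLeast0)
      also have "\<dots> \<le> (\<Sum>k. sobolev_term s x k)"
        by (intro sum_le_suminf x) (auto simp: sobolev_term_nonneg)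
      finally show "(\<Sum>k<N. sobolev_term s x (k + p)) \<le> (\<Sum>k. sobolev_term s x k)" .
      show "0 \<le> (\<Sum>k. ?w (k + p) powr (- s))"
        using summable_ignore_initial_segment[OF summable_sobolev_weight[OF s], of p]
        by (intro suminf_nonneg) auto
      show "0 \<le> (\<Sum>k<N. sobolev_term s x (k + p))" by (intro sum_nonneg sobolev_term_nonneg)
    qed
    finally show ?thesis .
  qed
  show a: "asum x"
    unfolding asum_def by (rule summableI_nonneg_bounded[OF _ bound[where p = 0, simplified]]) simp
  have "(\<Sum>k. norm (coef x (k + p))) \<le> sqrt (\<Sum>k. ?w (k + p) powr (- s)) * sqrt (\<Sum>k. sobolev_term s x k)"
    using summable_ignore_initial_segment[of "\<lambda>k. norm (coef x k)" p] a bound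
    by (intro suminf_le_const) (auto simp: asum_def)
  then show "anorm ((shl ^^ p) x) \<le> sqrt (\<Sum>k. (1 + (real (k + p))\<^sup>2) powr (- s)) * sqrt (\<Sum>k. sobolev_term s x k)"
    by (simp add: anorm_def add.commute)
qed

lemma summable_weight_geometric:
  assumes "s > 0" "0 < p"
  shows "summable (\<lambda>k. (1 + (real (Suc k))\<^sup>2) powr s * (1/4) ^ (k div p))"
proof -
  \<comment> \<open>The step function \<open>(1/4) ^ (k div p)\<close> is at most 4 times the
    geometric sequence of ratio \<rho>; the factor 4 pays for the rounding in \<open>div\<close>.
    The base 1/4 is the square of the halving factor.\<close>
  define \<rho> :: real where "\<rho> = (1/4) powr (1 / real p)"
  have \<rho>: "0 < \<rho>" "\<rho> < 1" using assms(2) powr01_less_one[of "1/4" "1 / real p"] by (simp_all add: \<rho>_def)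
  have div: "(1/4) ^ (k div p) \<le> 4 * \<rho> ^ k" for k
  proof -
    have "k < p * (k div p) + p" using assms(2) by (metis add_strict_left_mono mod_less_divisor mult_div_mod_eq)
    then have "real k < real p * real (k div p) + real p" by (metis of_nat_add of_nat_less_iff of_nat_mult)
    then have "real k / real p - 1 \<le> real (k div p)" using assms(2) by (simp add: field_simps)
    then have "(1/4 :: real) powr (real (k div p)) \<le> (1/4) powr (real k / real p - 1)"
      by (intro powr_mono') auto
    also have "\<dots> = 4 * (1/4) powr (real k / real p)" by (simp add: powr_diff)
    also have "(1/4 :: real) powr (real k / real p) = \<rho> ^ k"
      using \<rho>(1) by (simp add: \<rho>_def powr_powr flip: powr_realpow)
    finally show ?thesis by (simp add: powr_realpow)
  qed
  let ?g = "\<lambda>k. (1 + (real (Suc k))\<^sup>2) powr s * \<rho> ^ k"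
  \<comment> \<open>The ratio of consecutive weights tends to 1, so \<rho> decides the ratio
    test.\<close>
  let ?q = "\<lambda>k. (1 + (real (Suc (Suc k)))\<^sup>2) / (1 + (real (Suc k))\<^sup>2)"
  have pos: "0 < 1 + (real k)\<^sup>2" for k by (simp add: add_pos_nonneg)
  have "?q \<longlonglongrightarrow> 1"
  proof (rule tendsto_sandwich[of "\<lambda>_. 1"])
    have q: "1 \<le> ?q k \<and> ?q k \<le> 1 + 3 * (1 / real (Suc k))" for k
    proof -
      define y where "y = real (Suc k)"
      have y: "1 \<le> y" by (simp add: y_def)
      then have y2: "0 < 1 + y\<^sup>2" "0 < y" by (simp_all add: add_pos_nonneg)
      have "y * 1 \<le> y * y" using y by (intro mult_left_mono) auto
      then have "y \<le> y * y + 3" by simp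
      then have "y * (1 + (y + 1)\<^sup>2) \<le> (y + 3) * (1 + y\<^sup>2)"
        by (simp add: power2_eq_square algebra_simps)
      then have "(1 + (y + 1)\<^sup>2) / (1 + y\<^sup>2) \<le> 1 + 3 * (1 / y)"
        using y2 by (simp add: field_simps)
      moreover have "1 \<le> (1 + (y + 1)\<^sup>2) / (1 + y\<^sup>2)"
        using y y2 by (simp add: power2_eq_square algebra_simps)
      ultimately show ?thesis by (simp add: y_def add.commute)
    qed
    show "\<forall>\<^sub>F k in sequentially. 1 \<le> ?q k" "\<forall>\<^sub>F k in sequentially. ?q k \<le> 1 + 3 * (1 / real (Suc k))"
      using q by (auto intro: always_eventually)
    have "(\<lambda>k. 1 + 3 * (1 / real (Suc k))) \<longlonglongrightarrow> 1 + 3 * 0"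
      by (intro tendsto_intros) (use LIMSEQ_inverse_real_of_nat in \<open>simp add: inverse_eq_divide\<close>)
    then show "(\<lambda>k. 1 + 3 * (1 / real (Suc k))) \<longlonglongrightarrow> 1" by simp
  qed simp
  then have "(\<lambda>k. ?q k powr s * \<rho>) \<longlonglongrightarrow> 1 powr s * \<rho>" by (intro tendsto_intros) auto
  then have "\<forall>\<^sub>F k in sequentially. ?q k powr s * \<rho> < (1 + \<rho>) / 2"
    by (rule order_tendstoD) (use \<rho> in simp)
  then obtain N where N: "\<And>k. k \<ge> N \<Longrightarrow> ?q k powr s * \<rho> < (1 + \<rho>) / 2"
    by (auto simp: eventually_sequentially)
  have "summable ?g"
  proof (rule summable_ratio_test[of "(1 + \<rho>) / 2" N])
    fix k assume k: "k \<ge> N"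
    have "?g (Suc k) = (?q k powr s * \<rho>) * ?g k"
      using pos[of "Suc k"] pos[of "Suc (Suc k)"] by (simp add: powr_divide)
    also have "\<dots> \<le> (1 + \<rho>) / 2 * ?g k"
      using N[OF k] \<rho> by (intro mult_right_mono) auto
    finally show "norm (?g (Suc k)) \<le> (1 + \<rho>) / 2 * norm (?g k)" using \<rho> by (simp add: abs_mult)
  qed (use \<rho> in simp)
  then have "summable (\<lambda>k. 4 * ?g k)" by (rule summable_mult)
  then show ?thesis
  proof (rule summable_comparison_test'[where N = 0])
    fix k
    have "(1 + (real (Suc k))\<^sup>2) powr s * (1/4) ^ (k div p) \<le> (1 + (real (Suc k))\<^sup>2) powr s * (4 * \<rho> ^ k)"
      by (intro mult_left_mono div) auto
    then show "norm ((1 + (real (Suc k))\<^sup>2) powr s * (1/4) ^ (k div p)) \<le> 4 * ?g k"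
      by (simp add: mult_ac)
  qed
qed

section \<open>Sobolev bounds and uniform decay\<close>

context szego_flow
begin

text \<open>Geometric decay of the coefficients beats every polynomial weight, and the majorant
  \<open>b\<close> is independent of \<open>t\<close> because the norm of \<open>u t\<close> is
  conserved.\<close>

lemma sobolev_bound_of_decay:
  assumes "s > 0" "0 < p"
  shows "\<exists>C. \<forall>t. uniform_decay p t \<longrightarrow> summable (sobolev_term s (u t)) \<and> (\<Sum>k. sobolev_term s (u t) k) \<le> C"
proof -
  let ?Q = "(norm (u 0))\<^sup>2"
  define b where "b k = (case k of 0 \<Rightarrow> ?Q | Suc n \<Rightarrow> (1 + (real (Suc n))\<^sup>2) powr s * (1/4) ^ (n div p) * ?Q)" for k
  have "summable (\<lambda>n. b (Suc n))"
    unfolding b_def nat.case by (intro summable_mult2 summable_weight_geometric assms)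
  then have sb: "summable b" by (simp only: summable_Suc_iff)
  have "summable (sobolev_term s (u t)) \<and> (\<Sum>k. sobolev_term s (u t) k) \<le> (\<Sum>k. b k)"
    if t: "uniform_decay p t" for t
  proof -
    have le: "sobolev_term s (u t) k \<le> b k" for k
    proof (cases k)
      case 0
      then show ?thesis using power_mono[OF norm_coef_le[of "u t" 0], of 2] norm_u_const[of t 0]
        by (simp add: sobolev_term_def b_def)
    next
      case (Suc n)
      have "(norm (coef (u t) (Suc n)))\<^sup>2 \<le> ((1/2) ^ (n div p) * norm (u t))\<^sup>2"
        by (intro power_mono coef_u_decay t assms) auto
      also have "\<dots> = (1/4) ^ (n div p) * ?Q"
        using norm_u_const[of t 0] by (simp add: power_mult_distrib power_divide flip: power_mult)
          (simp add: mult.commute power_mult)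
      finally show ?thesis
        using Suc by (simp add: sobolev_term_def b_def mult_left_mono mult.assoc)
    qed
    have s: "summable (sobolev_term s (u t))"
      by (rule summable_comparison_test'[OF sb, where N = 0]) (use le sobolev_term_nonneg in auto)
    then show ?thesis using suminf_le[OF le s sb] by blast
  qed
  then show ?thesis by blast
qed

end

context finite_rank_flow
begin

text \<open>On a Sobolev ball the Wiener tails of \<open>u t\<close> are uniformly small, and
  \<open>uniform_decay_of_tails\<close> turns this into decay.\<close>

lemma decay_of_sobolev_bound:
  assumes s: "s > 1/2"
  shows "\<exists>p>0. \<forall>t. summable (sobolev_term s (u t)) \<and> sqrt (\<Sum>k. sobolev_term s (u t) k) \<le> C \<longrightarrow> uniform_decay p t"
proof -
  obtain \<delta> where \<delta>: "0 < \<delta>" "\<And>t p. anorm ((shl ^^ p) (u t)) \<le> \<delta> \<Longrightarrow> uniform_decay p t"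
    using uniform_decay_of_tails by blast
  have "(\<lambda>p. \<Sum>k. (1 + (real (k + p))\<^sup>2) powr (- s)) \<longlonglongrightarrow> 0"
    by (rule suminf_exist_split2[OF summable_sobolev_weight[OF s]])
  from tendsto_mult_left_zero[OF tendsto_real_sqrt[OF this, unfolded real_sqrt_zero], of "\<bar>C\<bar>"]
  have "\<forall>\<^sub>F p in sequentially. sqrt (\<Sum>k. (1 + (real (k + p))\<^sup>2) powr (- s)) * \<bar>C\<bar> < \<delta>"
    by (rule order_tendstoD) (rule \<delta>(1))
  then have "\<forall>\<^sub>F p in sequentially. 0 < p \<and> sqrt (\<Sum>k. (1 + (real (k + p))\<^sup>2) powr (- s)) * \<bar>C\<bar> < \<delta>"
    using eventually_gt_at_top[of 0] by eventually_elim simp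
  then obtain p where p: "0 < p" "sqrt (\<Sum>k. (1 + (real (k + p))\<^sup>2) powr (- s)) * \<bar>C\<bar> < \<delta>"
    using eventually_happens'[OF sequentially_bot] by blast
  have "uniform_decay p t" if t: "summable (sobolev_term s (u t))" "sqrt (\<Sum>k. sobolev_term s (u t) k) \<le> C" for t
  proof (rule \<delta>(2))
    have "anorm ((shl ^^ p) (u t)) \<le> sqrt (\<Sum>k. (1 + (real (k + p))\<^sup>2) powr (- s)) * sqrt (\<Sum>k. sobolev_term s (u t) k)"
      by (rule asum_of_sobolev(2)[OF s t(1)])
    also have "\<dots> \<le> sqrt (\<Sum>k. (1 + (real (k + p))\<^sup>2) powr (- s)) * \<bar>C\<bar>"
    proof (intro mult_left_mono real_sqrt_ge_zero)
      show "sqrt (\<Sum>k. sobolev_term s (u t) k) \<le> \<bar>C\<bar>" using t(2) by simp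
      show "0 \<le> (\<Sum>k. (1 + (real (k + p))\<^sup>2) powr (- s))"
        using summable_ignore_initial_segment[OF summable_sobolev_weight[OF s], of p]
        by (intro suminf_nonneg) auto
    qed
    finally show "anorm ((shl ^^ p) (u t)) \<le> \<delta>" using p(2) by simp
  qed
  then show ?thesis using p(1) by blast
qed

end

subsection \<open>Solutions and eigenspaces in coordinates\<close>

lemma solution_szego_flow:
  assumes s: "s > 1/2" and sol: "Hs_solution s u"
  shows "\<exists>u'. szego_flow (\<lambda>t. fcoef (u t)) u'"
proof -
  have uH: "u t \<in> Hs_plus s" for t using sol by (simp add: Hs_solution_def)
  obtain v where v: "\<And>t. has_Hs_derivative s u (v t) t"
    "\<And>t. scaleT \<i> (v t) = scaleT (2 * cubicJ (u t)) (szego (u t * cnjT (u t)))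
                      + scaleT (cnj (cubicJ (u t))) (u t * u t)"
    using sol unfolding Hs_solution_def by metis
  have vH: "v t \<in> Hs_plus s" for t using v(1) by (simp add: has_Hs_derivative_def)
  have uP: "u t \<in> L2_plus" and vP: "v t \<in> L2_plus" for t
    using uH vH by (auto intro: Hs_plus_L2_plus)
  note uL = L2_plus_L2[OF uP] and vL = L2_plus_L2[OF vP]
  have asum_H: "asum (fcoef f)" if "f \<in> Hs_plus s" for f
    using that asum_of_sobolev(1)[OF s] by (simp add: Hs_plus_iff)
  have "szego_flow (\<lambda>t. fcoef (u t)) (\<lambda>t. fcoef (v t))"
  proof
    fix t
    show a: "asum (fcoef (u t))" and "asum (fcoef (v t))" by (intro asum_H uH vH)+
    \<comment> \<open>The embedding constant of \<open>Hs_plus s\<close> in the Wiener algebra, in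
      the form of \<open>asum_of_sobolev\<close> at \<open>p = 0\<close>.\<close>
    let ?W = "sqrt (\<Sum>k. (1 + (real (k + 0))\<^sup>2) powr (- s))"
    have lim: "((\<lambda>h. ?W * Hs_norm s (scaleT (of_real (1 / h)) (u (t + h) - u t) - v t)) \<longlongrightarrow> 0) (at 0)"
      using v(1)[of t] by (intro tendsto_mult_right_zero) (simp add: has_Hs_derivative_def)
    show "((\<lambda>h. anorm ((1 / h) *\<^sub>R (fcoef (u (t + h)) - fcoef (u t)) - fcoef (v t))) \<longlongrightarrow> 0) (at 0)"
    proof (rule Lim_null_comparison[OF always_eventually lim], rule allI)
      fix h
      let ?d = "scaleT (of_real (1 / h)) (u (t + h) - u t) - v t"
      have d: "?d \<in> Hs_plus s" by (intro Hs_plus_diff Hs_plus_scaleT uH vH)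
      have "fcoef ?d = (1 / h) *\<^sub>R (fcoef (u (t + h)) - fcoef (u t)) - fcoef (v t)"
        by (simp add: fcoef_diff fcoef_scaleT L2_diff L2_scaleT uL vL scaleR_cmul)
      moreover have "anorm (fcoef ?d) \<le> ?W * Hs_norm s ?d"
        using asum_of_sobolev(2)[OF s, of "fcoef ?d" 0] d by (simp add: Hs_norm_eq Hs_plus_iff)
      moreover have "0 \<le> anorm (fcoef ?d)"
        using asum_sum_le[OF asum_H[OF d], of 0] by simp
      ultimately show "norm (anorm ((1 / h) *\<^sub>R (fcoef (u (t + h)) - fcoef (u t)) - fcoef (v t))) \<le> ?W * Hs_norm s ?d"
        by simp
    qed
    note w = szego_abs_sq_fcoef[OF uP a] and sq = square_fcoef[OF uP a]
    have "\<i> *\<^sub>c fcoef (v t) = fcoef (scaleT \<i> (v t))" by (simp add: fcoef_scaleT vL)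
    also have "\<dots> = (2 * cubicJ (u t)) *\<^sub>c toepS (fcoef (u t)) (fcoef (u t))
        + cnj (cubicJ (u t)) *\<^sub>c toep (fcoef (u t)) (fcoef (u t))"
      unfolding v(2) using w sq by (simp add: fcoef_add fcoef_scaleT L2_scaleT L2_plus_L2)
    finally show "\<i> *\<^sub>c fcoef (v t)
      = (2 * cinner (toep (fcoef (u t)) (fcoef (u t))) (fcoef (u t))) *\<^sub>c toepS (fcoef (u t)) (fcoef (u t))
        + cnj (cinner (toep (fcoef (u t)) (fcoef (u t))) (fcoef (u t))) *\<^sub>c toep (fcoef (u t)) (fcoef (u t))"
      by (simp only: cubicJ_fcoef[OF uP a])
  qed
  then show ?thesis by blast
qed

lemma range_kank:
  assumes u: "u \<in> L2_plus" "asum (fcoef u)"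
  shows "range (kank (fcoef u)) = fcoef ` shifted_hankel u ` L2_plus"
proof -
  have "kank (fcoef u) x \<in> fcoef ` shifted_hankel u ` L2_plus" for x
  proof -
    obtain h where "h \<in> L2_plus" "fcoef h = x" using fcoef_surj by blast
    then show ?thesis using shifted_hankel_fcoef[OF u, of h] by (metis imageI)
  qed
  moreover have "fcoef (shifted_hankel u h) \<in> range (kank (fcoef u))" if "h \<in> L2_plus" for h
    using shifted_hankel_fcoef[OF u that] by simp
  ultimately show ?thesis by blast
qed

text \<open>The spanning set in \<open>finite_dim\<close> may contain functions outside
  \<open>L2\<close>, where \<open>fcoef\<close> has no meaning. It is therefore replaced by a basis
  inside the range before passing to coordinates.\<close>

lemma finite_dim_range_kank:
  assumes u: "u \<in> L2_plus" "asum (fcoef u)" and fin: "finite_dim (shifted_hankel u ` L2_plus)"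
  shows "\<exists>B. finite B \<and> range (kank (fcoef u)) \<subseteq> ell2c.span B"
proof -
  let ?V = "shifted_hankel u ` L2_plus"
  obtain B0 where B0: "finite B0" "?V \<subseteq> tfun.span B0" using fin by (auto simp: finite_dim_def)
  obtain B where B: "B \<subseteq> ?V" "\<not> tfun.dependent B" "?V \<subseteq> tfun.span B"
    using tfun.maximal_independent_subset by blast
  have finB: "finite B" using tfun.independent_span_bound[OF B0(1) B(2)] B(1) B0(2) by blast
  have BP: "b \<in> L2_plus" if "b \<in> B" for b
    using that B(1) shifted_hankel_fcoef[OF u] by blast
  have "fcoef f \<in> ell2c.span (fcoef ` B)" if f: "f \<in> tfun.span B" for f
  proof -
    have "f \<in> L2_plus \<and> fcoef f \<in> ell2c.span (fcoef ` B)"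
      using f
    proof (induction rule: tfun.span_induct_alt)
      case base
      have "(0::tfun) \<in> L2_plus" using L2_plus_diff[OF u(1) u(1)] by simp
      moreover have "fcoef 0 = 0" using fcoef_diff[OF L2_plus_L2 L2_plus_L2, OF u(1) u(1)] by simp
      ultimately show ?case by (simp add: ell2c.span_zero)
    next
      case (step c b f)
      have "fcoef b \<in> ell2c.span (fcoef ` B)" using step(1) by (intro ell2c.span_base) simp
      then have "c *\<^sub>c fcoef b + fcoef f \<in> ell2c.span (fcoef ` B)"
        using step by (intro ell2c.span_add ell2c.span_scale) auto
      then show ?case
        using BP[OF step(1)] step by (simp add: L2_plus_add L2_plus_scaleT fcoef_add fcoef_scaleT L2_plus_L2 L2_scaleT)
    qed
    then show ?thesis by blast
  qed
  then show ?thesis using finB B(3) range_kank[OF u] by (intro exI[of _ "fcoef ` B"]) auto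
qed

lemma K_eigenspace_fcoef:
  assumes u: "u \<in> L2_plus" "asum (fcoef u)" and h: "h \<in> L2_plus"
  shows "h \<in> K_eigenspace u \<mu> \<longleftrightarrow> kank (fcoef u) (kank (fcoef u) (fcoef h)) = of_real \<mu> *\<^sub>c fcoef h"
proof -
  note K = shifted_hankel_fcoef[OF u]
  have KK: "shifted_hankel u (shifted_hankel u h) \<in> L2_plus"
    "fcoef (shifted_hankel u (shifted_hankel u h)) = kank (fcoef u) (kank (fcoef u) (fcoef h))"
    using K[OF h] K[of "shifted_hankel u h"] by auto
  have "shifted_hankel u (shifted_hankel u h) = scaleT (of_real \<mu>) h
      \<longleftrightarrow> fcoef (shifted_hankel u (shifted_hankel u h)) = fcoef (scaleT (of_real \<mu>) h)"
    using fcoef_inj[OF KK(1) L2_plus_scaleT[OF h]] by auto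
  then show ?thesis using h by (simp add: K_eigenspace_def KK(2) fcoef_scaleT L2_plus_L2)
qed

text \<open>Eigenvectors for distinct real eigenvalues are orthogonal, hence independent, and for
  nonzero eigenvalues they lie in the range; so there are at most \<open>card B\<close> such
  eigenvalues.\<close>

lemma finite_eigenvalues:
  fixes T :: "ell2 \<Rightarrow>\<^sub>L ell2"
  assumes sym: "\<And>x y. cinner (T x) y = cinner x (T y)"
    and T: "\<And>c x. T (c *\<^sub>c x) = c *\<^sub>c T x"
    and V: "range T \<subseteq> ell2c.span B" "finite B"
  shows "finite {\<mu>::real. \<mu> \<noteq> 0 \<and> (\<exists>h. h \<noteq> 0 \<and> T h = of_real \<mu> *\<^sub>c h)}" (is "finite ?S")
proof -
  have "card G \<le> card B" if G: "G \<subseteq> ?S" "finite G" for G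
  proof -
    have "\<forall>\<mu>\<in>G. \<exists>h. h \<noteq> 0 \<and> T h = of_real \<mu> *\<^sub>c h" using G(1) by blast
    then obtain e where e: "\<And>\<mu>. \<mu> \<in> G \<Longrightarrow> e \<mu> \<noteq> 0" "\<And>\<mu>. \<mu> \<in> G \<Longrightarrow> T (e \<mu>) = of_real \<mu> *\<^sub>c e \<mu>"
      by metis
    have orth: "cinner (e \<mu>) (e \<nu>) = 0" if "\<mu> \<in> G" "\<nu> \<in> G" "\<mu> \<noteq> \<nu>" for \<mu> \<nu>
    proof -
      have "of_real \<mu> * cinner (e \<mu>) (e \<nu>) = of_real \<nu> * cinner (e \<mu>) (e \<nu>)"
        using sym[of "e \<mu>" "e \<nu>"] e(2)[OF that(1)] e(2)[OF that(2)] by simp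
      then show ?thesis using that(3) by simp
    qed
    have self: "cinner (e \<mu>) (e \<mu>) \<noteq> 0" if "\<mu> \<in> G" for \<mu>
      using e(1)[OF that] by (simp add: cinner_self_norm)
    have inj: "inj_on e G"
      using orth self by (intro inj_onI) metis
    have "\<not> ell2c.dependent (e ` G)"
    proof
      assume "ell2c.dependent (e ` G)"
      then obtain c where c: "\<exists>x\<in>e ` G. c x \<noteq> 0" "(\<Sum>x\<in>e ` G. c x *\<^sub>c x) = 0"
        using G(2) by (subst (asm) ell2c.dependent_finite) auto
      then obtain \<nu> where \<nu>: "\<nu> \<in> G" "c (e \<nu>) \<noteq> 0" by blast
      have "0 = cinner (\<Sum>x\<in>e ` G. c x *\<^sub>c x) (e \<nu>)" using c(2) by simp
      also have "\<dots> = (\<Sum>\<mu>\<in>G. c (e \<mu>) * cinner (e \<mu>) (e \<nu>))"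
        by (simp add: sum.reindex[OF inj] cinner_sum_left)
      also have "\<dots> = (\<Sum>\<mu>\<in>G. if \<mu> = \<nu> then c (e \<nu>) * cinner (e \<nu>) (e \<nu>) else 0)"
        using orth \<nu>(1) by (intro sum.cong) auto
      also have "\<dots> = c (e \<nu>) * cinner (e \<nu>) (e \<nu>)" using G(2) \<nu>(1) by simp
      finally show False using \<nu> self by simp
    qed
    moreover have "e ` G \<subseteq> ell2c.span B"
    proof
      fix x assume "x \<in> e ` G"
      then obtain \<mu> where \<mu>: "\<mu> \<in> G" "x = e \<mu>" by blast
      then have "\<mu> \<noteq> 0" using G(1) by blast
      then have "x = T (of_real (1 / \<mu>) *\<^sub>c x)" using e(2)[OF \<mu>(1)] \<mu>(2) by (simp add: T)
      then have "x \<in> range T" by (rule range_eqI)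
      then show "x \<in> ell2c.span B" using V(1) by blast
    qed
    ultimately have "card (e ` G) \<le> card B" using ell2c.independent_span_bound[OF V(2)] by blast
    then show ?thesis by (simp add: card_image[OF inj])
  qed
  then show ?thesis using finite_if_finite_subsets_card_bdd by blast
qed

text \<open>Evaluates the description in \<open>orth_proj\<close>: two candidates differ by a vector
  of the subspace that is orthogonal to it.\<close>

lemma orth_proj_fcoef:
  assumes V: "V \<subseteq> L2_plus" and f: "f \<in> L2_plus"
    and C: "finite C" "orthonormal C" "fcoef ` V = ell2c.span C"
  shows "orth_proj V f \<in> V \<and> fcoef (orth_proj V f) = proj C (fcoef f)"
proof -
  obtain p where p: "p \<in> V" "fcoef p = proj C (fcoef f)"
    using proj_in_span[of C "fcoef f"] C(3) by (metis imageE)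
  have ip: "innerT (f - g) h = cinner (fcoef f - fcoef g) (fcoef h)" if "g \<in> V" "h \<in> V" for g h
    using that V f by (subst innerT_eq_cinner) (auto simp: L2_plus_diff L2_plus_L2 fcoef_diff subset_iff)
  have "orth_proj V f = p"
    unfolding orth_proj_def
  proof (rule the_equality)
    show "p \<in> V \<and> (\<forall>h\<in>V. innerT (f - p) h = 0)"
    proof (intro conjI ballI p(1))
      fix h assume h: "h \<in> V"
      then have "fcoef h \<in> ell2c.span C" using C(3) by blast
      from cinner_diff_proj[OF C(1,2) this] show "innerT (f - p) h = 0"
        unfolding ip[OF p(1) h] p(2) .
    qed
    fix g assume g: "g \<in> V \<and> (\<forall>h\<in>V. innerT (f - g) h = 0)"
    have "cinner (fcoef g - fcoef p) y = 0" if y: "y \<in> ell2c.span C" for y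
    proof -
      obtain h where h: "h \<in> V" "y = fcoef h" using y C(3) by (metis imageE)
      have "cinner (fcoef f - fcoef g) y = 0" using g h ip by auto
      moreover have "cinner (fcoef f - fcoef p) y = 0" using cinner_diff_proj[OF C(1,2) y] by (simp add: p(2))
      ultimately show ?thesis by simp
    qed
    from this[of "fcoef g - fcoef p"] have "cinner (fcoef g - fcoef p) (fcoef g - fcoef p) = 0"
      using g p(1) C(3) ell2c.span_diff by blast
    then have "fcoef g = fcoef p" by (simp add: cinner_self_norm del: cinner_simps)
    then show "g = p" using fcoef_inj g p(1) V by blast
  qed
  then show ?thesis using p by simp
qed

theorem corollary1p3:
  fixes d :: nat and u0 :: tfun and u :: "real \<Rightarrow> tfun"
  assumes "u0 \<in> V_rank d"
    and "solution u" and "u 0 = u0"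
    and "\<exists>s0>1/2. unbounded_in_Hs s0 u"
  shows "(\<forall>s>1/2. unbounded_in_Hs s u) \<and>
    (\<exists>k\<ge>1. \<exists>\<mu>. is_kth_eigenvalue u0 k \<mu> \<and> ell u0 \<mu> = 0)"
proof -
  obtain s where s: "s > 1/2" and sol: "Hs_solution s u" using assms(2) by (auto simp: solution_def)
  have uH: "u t \<in> Hs_plus s" for t using sol by (simp add: Hs_solution_def)
  have uP: "u t \<in> L2_plus" for t using uH by (rule Hs_plus_L2_plus)
  have ua: "asum (fcoef (u t))" for t
    using uH[of t] asum_of_sobolev(1)[OF s] by (simp add: Hs_plus_iff)
  define x where "x t = fcoef (u t)" for t
  obtain x' where flow: "szego_flow x x'"
    using solution_szego_flow[OF s sol] unfolding x_def[abs_def] by blast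
  have "finite_dim (shifted_hankel (u 0) ` L2_plus)"
    using assms(1,3) by (simp add: V_rank_def)
  from finite_dim_range_kank[OF uP ua this] obtain B where B: "finite B" "range (kank (x 0)) \<subseteq> ell2c.span B"
    unfolding x_def by blast
  interpret finite_rank_flow x x' B
  proof -
    interpret szego_flow x x' by (rule flow)
    show "finite_rank_flow x x' B"
      by unfold_locales (use B in \<open>simp_all add: K_def\<close>)
  qed
  have Hs_iff: "u t \<in> Hs_plus r \<longleftrightarrow> summable (sobolev_term r (x t))" for r t
    by (simp add: Hs_plus_iff uP x_def)
  \<comment> \<open>At a fixed time the solution's own norm serves as the bound: membership in one
    Sobolev space gives decay for some \<open>p\<close>, and this gives membership in all the
    others.\<close>
  have smooth: "u t \<in> Hs_plus r" if r: "r > 1/2" for r t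
  proof -
    obtain p where p: "0 < p" "uniform_decay p t"
      using decay_of_sobolev_bound[OF s, of "sqrt (\<Sum>k. sobolev_term s (x t) k)"] uH[of t]
      by (auto simp: Hs_iff)
    show ?thesis
      using sobolev_bound_of_decay[of r p] p r by (auto simp: Hs_iff)
  qed
  have decay_bounded: "\<exists>C. \<forall>t. Hs_norm r (u t) \<le> C" if p: "0 < p" "\<And>t. uniform_decay p t" and r: "r > 1/2" for p r
  proof -
    obtain C where "\<And>t. (\<Sum>k. sobolev_term r (x t) k) \<le> C"
      using sobolev_bound_of_decay[of r p] p r by auto
    then have "Hs_norm r (u t) \<le> sqrt C" for t
      using Hs_norm_eq[OF smooth[OF r]] by (simp add: x_def)
    then show ?thesis by blast
  qed
  obtain s0 where s0: "s0 > 1/2" "\<not> (\<exists>C. \<forall>t. Hs_norm s0 (u t) \<le> C)"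
    using assms(4) by (auto simp: unbounded_in_Hs_def)
  have no_decay: "\<not> (\<exists>p>0. \<forall>t. uniform_decay p t)"
    using decay_bounded[OF _ _ s0(1)] s0(2) by blast
  have "unbounded_in_Hs r u" if r: "r > 1/2" for r
    unfolding unbounded_in_Hs_def
  proof (intro conjI allI notI smooth[OF r])
    assume "\<exists>C. \<forall>t. Hs_norm r (u t) \<le> C"
    then obtain C where "\<And>t. Hs_norm r (u t) \<le> C" by blast
    then have C: "sqrt (\<Sum>k. sobolev_term r (x t) k) \<le> C" for t
      using Hs_norm_eq[OF smooth[OF r]] by (simp add: x_def)
    have S: "summable (sobolev_term r (x t))" for t using smooth[OF r] by (simp add: Hs_iff)
    obtain p where p: "0 < p" "\<forall>t. summable (sobolev_term r (x t)) \<and>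
        sqrt (\<Sum>k. sobolev_term r (x t) k) \<le> C \<longrightarrow> uniform_decay p t"
      using decay_of_sobolev_bound[OF r, of C] by (elim exE conjE)
    have "\<forall>t. uniform_decay p t" using p(2) C S by simp
    then show False using no_decay p(1) by blast
  qed
  moreover have "\<exists>k\<ge>1. \<exists>\<mu>. is_kth_eigenvalue u0 k \<mu> \<and> ell u0 \<mu> = 0"
  proof -
    obtain \<mu> where \<mu>: "\<mu> > 0" "\<exists>h\<in>E \<mu>. h \<noteq> 0" and ell0: "\<And>c. c \<in> E \<mu> \<Longrightarrow> ellc \<mu> c 0 = 0"
      using ellc_eq_0_of_no_uniform_decay[OF no_decay] by blast
    have x0: "x 0 = fcoef u0" by (simp add: x_def assms(3))
    have u0: "u0 \<in> L2_plus" "asum (fcoef u0)" using uP[of 0] ua[of 0] by (simp_all add: assms(3))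
    have KE: "K_eigenspace u0 \<nu> \<subseteq> L2_plus" "fcoef ` K_eigenspace u0 \<nu> = E \<nu>" for \<nu>
    proof -
      show P: "K_eigenspace u0 \<nu> \<subseteq> L2_plus" by (auto simp: K_eigenspace_def)
      show "fcoef ` K_eigenspace u0 \<nu> = E \<nu>"
      proof (intro equalityI subsetI)
        fix y assume "y \<in> fcoef ` K_eigenspace u0 \<nu>"
        then obtain h where h: "h \<in> K_eigenspace u0 \<nu>" "y = fcoef h" by blast
        then have "h \<in> L2_plus" using P by blast
        then show "y \<in> E \<nu>" using h K_eigenspace_fcoef[OF u0] by (simp add: E_def K_def x0)
      next
        fix y assume y: "y \<in> E \<nu>"
        obtain h where h: "h \<in> L2_plus" "fcoef h = y" using fcoef_surj by blast
        then have "h \<in> K_eigenspace u0 \<nu>"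
          using y K_eigenspace_fcoef[OF u0 h(1)] by (simp add: E_def K_def x0)
        then show "y \<in> fcoef ` K_eigenspace u0 \<nu>" using h by blast
      qed
    qed
    have f0: "fcoef 0 = 0" using fcoef_diff[OF L2_plus_L2 L2_plus_L2, OF u0(1) u0(1)] by simp
    \<comment> \<open>Finiteness of the set of eigenvalues is what gives \<mu> a position
      \<open>k\<close>, counted from the largest eigenvalue.\<close>
    have ev: "nonzero_eigenvalues u0 \<subseteq> {\<nu>::real. \<nu> \<noteq> 0 \<and> (\<exists>h. h \<noteq> 0 \<and> (K 0 o\<^sub>L K 0) h = of_real \<nu> *\<^sub>c h)}"
    proof
      fix \<nu> assume "\<nu> \<in> nonzero_eigenvalues u0"
      then obtain h where h: "\<nu> \<noteq> 0" "h \<in> K_eigenspace u0 \<nu>" "h \<noteq> 0" by (auto simp: nonzero_eigenvalues_def)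
      have "fcoef h \<in> E \<nu>" using KE(2) h(2) by blast
      moreover have "fcoef h \<noteq> 0"
        using fcoef_inj[of h 0] h(2,3) KE(1) L2_plus_diff[OF u0(1) u0(1)] f0 by auto
      ultimately show "\<nu> \<in> {\<nu>. \<nu> \<noteq> 0 \<and> (\<exists>h. h \<noteq> 0 \<and> (K 0 o\<^sub>L K 0) h = of_real \<nu> *\<^sub>c h)}"
        using h(1) by (auto simp: E_def)
    qed
    have "range (K 0 o\<^sub>L K 0) \<subseteq> range (K 0)" by auto
    then have "finite {\<nu>::real. \<nu> \<noteq> 0 \<and> (\<exists>h. h \<noteq> 0 \<and> (K 0 o\<^sub>L K 0) h = of_real \<nu> *\<^sub>c h)}"
      by (intro finite_eigenvalues[OF _ _ order_trans[OF _ range_K0] finite_B]) (simp_all add: cinner_K_K)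
    then have fin: "finite (nonzero_eigenvalues u0)" using ev finite_subset by blast
    have mem: "\<mu> \<in> nonzero_eigenvalues u0"
    proof -
      obtain h where h: "h \<in> K_eigenspace u0 \<mu>" "fcoef h \<noteq> 0" using \<mu>(2) KE(2)[of \<mu>] by (metis imageE)
      then have "h \<noteq> 0" using f0 by auto
      then show ?thesis using h \<mu>(1) by (auto simp: nonzero_eigenvalues_def)
    qed
    let ?S = "{\<nu> \<in> nonzero_eigenvalues u0. \<mu> \<le> \<nu>}"
    have finS: "finite ?S" using fin by simp
    have "\<mu> \<in> ?S" using mem by simp
    then have "card ?S \<ge> 1" using finS by (metis One_nat_def Suc_leI card_gt_0_iff empty_iff)
    moreover have "is_kth_eigenvalue u0 (card ?S) \<mu>"
      using mem finS by (simp add: is_kth_eigenvalue_def)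
    moreover have "ell u0 \<mu> = 0"
    proof -
      have sub: "ell2c.subspace (E \<mu>)"
        by (rule ell2c.subspaceI) (simp_all add: E_def blinfun.add_right blinfun.zero_right cmul_distribs mult.commute)
      \<comment> \<open>Eigenvectors for nonzero \<mu> lie in the range of \<open>K 0\<close>, which
        makes the eigenspace finite-dimensional.\<close>
      have "E \<mu> \<subseteq> range (K 0)"
      proof
        fix h assume "h \<in> E \<mu>"
        then have "h = K 0 (of_real (1 / \<mu>) *\<^sub>c K 0 h)" using \<mu>(1) by (simp add: E_def)
        then show "h \<in> range (K 0)" by (rule range_eqI)
      qed
      then obtain C where C: "finite C" "orthonormal C" "ell2c.span C = E \<mu>"
        using subspace_orthonormal_basis[OF sub order_trans[OF _ range_K0] finite_B] by blast
      have C': "fcoef ` K_eigenspace u0 \<mu> = ell2c.span C" using KE(2) C(3) by simp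
      note w0 = szego_abs_sq_fcoef[OF u0]
      define p where "p = proj C (fcoef u0)"
      define q where "q = proj C (toepS (fcoef u0) (fcoef u0))"
      have np: "normL2 (orth_proj (K_eigenspace u0 \<mu>) u0) = norm p"
      proof -
        note o = orth_proj_fcoef[OF KE(1) u0(1) C(1,2) C']
        have "orth_proj (K_eigenspace u0 \<mu>) u0 \<in> L2_plus" using o KE(1) by blast
        then show ?thesis using o by (simp add: normL2_eq_norm p_def)
      qed
      have nq: "normL2 (orth_proj (K_eigenspace u0 \<mu>) (szego (u0 * cnjT u0))) = norm q"
      proof -
        note o = orth_proj_fcoef[OF KE(1) conjunct1[OF w0] C(1,2) C']
        have "orth_proj (K_eigenspace u0 \<mu>) (szego (u0 * cnjT u0)) \<in> L2_plus" using o KE(1) by blast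
        then show ?thesis using o w0 by (simp add: normL2_eq_norm q_def)
      qed
      have pE: "p \<in> E \<mu>" and qE: "q \<in> E \<mu>" using proj_in_span[of C] C(3) by (auto simp: p_def q_def)
      let ?m = "\<mu> + 2 * (norm (x 0))\<^sup>2"
      \<comment> \<open>Vanishing of the form on the whole eigenspace is tested on the two
        projections \<open>p\<close> and \<open>q\<close> themselves. This gives two relations
        between their norms and the mixed product \<open>cinner p q\<close>; eliminating the latter
        and taking the root leaves \<open>ell u0 \<mu> = 0\<close>.\<close>
      have N: "?m * (norm (cinner p c))\<^sup>2 = (norm (cinner q c))\<^sup>2" if c: "c \<in> E \<mu>" for c
      proof -
        have "cinner (x 0) c = cinner p c" "cinner (w 0) c = cinner q c"
          using cinner_diff_proj[OF C(1,2), of c] c C(3) by (simp_all add: p_def q_def x0 w_def)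
        then show ?thesis using ell0[OF c] by (simp add: ellc_def \<alpha>_def \<beta>_def)
      qed
      have m: "0 < ?m" using \<mu>(1) by (simp add: add_pos_nonneg)
      have pq: "norm (cinner q p) = norm (cinner p q)" by (subst cinner_commute) simp
      have "?m * ((norm p)\<^sup>2)\<^sup>2 = (norm (cinner p q))\<^sup>2"
        using N[OF pE] by (simp add: cinner_self_norm pq norm_power)
      moreover have "?m * (norm (cinner p q))\<^sup>2 = ((norm q)\<^sup>2)\<^sup>2"
        using N[OF qE] by (simp add: cinner_self_norm norm_power)
      ultimately have "(?m * (norm p)\<^sup>2)\<^sup>2 = ((norm q)\<^sup>2)\<^sup>2"
        by (simp add: power_mult_distrib power2_eq_square[of ?m] mult.assoc)
      then have "?m * (norm p)\<^sup>2 = (norm q)\<^sup>2" by (rule power2_eq_imp_eq) (use m in auto)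
      then show ?thesis by (simp add: ell_def np nq massQ_fcoef[OF u0(1)] x0 add.commute)
    qed
    ultimately show ?thesis by blast
  qed
  ultimately show ?thesis by blast
qed

end
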